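(* Let $M\ge0$ be a fixed integer, $\mu,\nu$ fixed complex numbers, and $0<\delta\le\frac{\pi}{2}$ fixed. Suppose $|\arg z|\le\frac{\pi}{2}-\delta$, $|z|$ is large, and $N=\frac12|z|+\rho$ is a positive integer with $\rho$ bounded. Write $\theta=\arg z$. Then $$R_N(z,\mu,\nu)=z^{\mu-1}\sum_{m=0}^{M-1}v_{N,m}(z,\mu,\nu)+\widehat R_{N,M}(z,\mu,\nu),$$ where $$v_{N,m}(z,\mu,\nu)=\frac{(-1)^N}{z^{2N}}\frac{e^{-2i\theta m}}{(1+e^{-2i\theta})^{m+1}}\sum_{k=0}^m\binom mk(-1)^k\frac{a_{N+k}(-\mu,\nu)}{|z|^{2k}}=\frac{1}{(1+e^{-2i\theta})^{m+1}}\sum_{k=0}^m\binom mk(-1)^{N+k}\frac{a_{N+k}(-\mu,\nu)}{z^{2N+2k}}e^{-2i\theta(m-k)},$$ and $\widehat R_{N,M}(z,\mu,\nu)=\mathcal O_{M,\mu,\nu,\rho,\delta}\left(\frac{e^{-|z|}}{|z|^{\frac M2+1}}\right)$.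
   Context: $S_{\mu,\nu}$ is the Lommel function (NIST DLMF 11.9); $R_N(z,\mu,\nu)$ is defined by $S_{\mu,\nu}(z)=z^{\mu-1}\sum_{n=0}^{N-1}(-1)^n a_n(-\mu,\nu)z^{-2n}+R_N(z,\mu,\nu)$ with $a_n(\mu,\nu)=\prod_{k=1}^n((\mu+2k-1)^2-\nu^2)=2^{2n}\left(\frac{\mu-\nu+1}{2}\right)_n\left(\frac{\mu+\nu+1}{2}\right)_n$. $\widehat R_{N,M}$ is defined by the displayed equality. Subscripts on $\mathcal O$ indicate dependence of the implied constant. *)

theory Defs
  imports "HOL-Analysis.Analysis"
begin

definition lommel_a :: "nat \<Rightarrow> complex \<Rightarrow> complex \<Rightarrow> complex" where
  "lommel_a n \<mu> \<nu> = (\<Prod>k=1..n. (\<mu> + of_nat (2*k) - 1)^2 - \<nu>^2)"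

text \<open>Bessel function of the first kind (DLMF 10.2.2), principal branch; rGamma = 1/Gamma.\<close>
definition bessel_J :: "complex \<Rightarrow> complex \<Rightarrow> complex" where
  "bessel_J \<nu> z = (z/2) powr \<nu> *
     (\<Sum>k. (-(z^2)/4)^k * rGamma (\<nu> + of_nat k + 1) / fact k)"

text \<open>Bessel function of the second kind for non-integer order (DLMF 10.2.3).\<close>
definition bessel_Y_gen :: "complex \<Rightarrow> complex \<Rightarrow> complex" where
  "bessel_Y_gen \<nu> z =
     (bessel_J \<nu> z * cos (\<nu> * of_real pi) - bessel_J (-\<nu>) z) / sin (\<nu> * of_real pi)"

text \<open>Lommel function s_{mu,nu} (DLMF 11.9.3).\<close>
definition lommel_s :: "complex \<Rightarrow> complex \<Rightarrow> complex \<Rightarrow> complex" where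
  "lommel_s \<mu> \<nu> z = z powr (\<mu> + 1) *
     (\<Sum>k. (-1)^k * z^(2*k) / lommel_a (Suc k) \<mu> \<nu>)"

text \<open>Parameters where DLMF 11.9.5 applies directly (no limiting process needed).\<close>
definition lommel_generic :: "complex \<Rightarrow> complex \<Rightarrow> bool" where
  "lommel_generic \<mu> \<nu> \<longleftrightarrow> \<nu> \<notin> \<int> \<and>
     (\<forall>k::nat. \<mu> + \<nu> \<noteq> - of_nat (2*k+1) \<and> \<mu> - \<nu> \<noteq> - of_nat (2*k+1))"

text \<open>DLMF 11.9.5 at generic parameters.\<close>
definition lommel_S_gen :: "complex \<Rightarrow> complex \<Rightarrow> complex \<Rightarrow> complex" where
  "lommel_S_gen \<mu> \<nu> z = lommel_s \<mu> \<nu> z +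
     2 powr (\<mu> - 1) * Gamma ((\<mu> + \<nu> + 1)/2) * Gamma ((\<mu> - \<nu> + 1)/2) *
     (sin ((\<mu> - \<nu>) * of_real pi / 2) * bessel_J \<nu> z
      - cos ((\<mu> - \<nu>) * of_real pi / 2) * bessel_Y_gen \<nu> z)"

text \<open>Lommel function S_{mu,nu}(z): DLMF 11.9.5, with the non-generic parameter values
  (integer nu, or mu +- nu an odd negative integer) given by the limiting value.\<close>
definition lommel_S :: "complex \<Rightarrow> complex \<Rightarrow> complex \<Rightarrow> complex" where
  "lommel_S \<mu> \<nu> z =
     Lim (at (\<mu>, \<nu>) within {p. lommel_generic (fst p) (snd p)})
         (\<lambda>p. lommel_S_gen (fst p) (snd p) z)"

definition lommel_R :: "nat \<Rightarrow> complex \<Rightarrow> complex \<Rightarrow> complex \<Rightarrow> complex" where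
  "lommel_R N z \<mu> \<nu> = lommel_S \<mu> \<nu> z
     - z powr (\<mu> - 1) * (\<Sum>n<N. (-1)^n * lommel_a n (-\<mu>) \<nu> / z^(2*n))"

definition lommel_v :: "nat \<Rightarrow> nat \<Rightarrow> complex \<Rightarrow> complex \<Rightarrow> complex \<Rightarrow> complex" where
  "lommel_v N m z \<mu> \<nu> =
     (-1)^N / z^(2*N) *
     exp (-2 * \<i> * of_real (Arg z) * of_nat m) / (1 + exp (-2 * \<i> * of_real (Arg z)))^(m+1) *
     (\<Sum>k\<le>m. of_nat (m choose k) * (-1)^k * lommel_a (N+k) (-\<mu>) \<nu> / of_real (cmod z ^ (2*k)))"

definition lommel_Rhat :: "nat \<Rightarrow> nat \<Rightarrow> complex \<Rightarrow> complex \<Rightarrow> complex \<Rightarrow> complex" where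
  "lommel_Rhat N M z \<mu> \<nu> = lommel_R N z \<mu> \<nu> - z powr (\<mu> - 1) * (\<Sum>m<M. lommel_v N m z \<mu> \<nu>)"

end

theory Submission
  imports Defs "HOL-Complex_Analysis.Complex_Analysis"
begin

text \<open>
  Put \<open>a = (1 - \<mu> - \<nu>)/2\<close>, \<open>b = (1 - \<mu> + \<nu>)/2\<close>, \<open>r = |z|\<close>, \<open>q = e^(-2i\<theta>)\<close>. The remainder is a Mellin--Barnes integral,
  \<open>R_N = (-1)^N z^(\<mu>-1) (2/z)^(2N) / (\<Gamma>(a) \<Gamma>(b)) * L(a + N, b + N)\<close>, where \<open>L(A, B)\<close> is the integral of
  \<open>(2\<pi>i)^(-1) \<pi>/sin(\<pi>s) \<Gamma>(A-s) \<Gamma>(B-s) (z/2)^(2s)\<close> over \<open>Re s = 1/2\<close>: shifting the line to the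
  right to infinity, the poles of \<open>1/sin(\<pi>s)\<close> produce the partial sum and the series of \<open>s_{\<mu>,\<nu>}\<close>, and the poles of the
  two Gamma factors produce the Bessel functions \<open>J_{-\<nu>}\<close> and \<open>J_\<nu>\<close>. Double poles are avoided by a small
  perturbation of \<open>\<mu>\<close>; dominated convergence then covers all parameters.

  Shifting the line by one unit to the left instead shows that \<open>Y_k = (2/r)^(2k) L(A+k, B+k)\<close> satisfies
  \<open>Y_k + q Y_(k+1) = (2/r)^(2k) \<Gamma>(A+k) \<Gamma>(B+k)\<close>. Solving this recurrence by \<open>M\<close> steps of the Euler transform gives
  exactly the terms \<open>v_{N,m}\<close>, with remainder \<open>(q/(1+q))^M\<close> times the \<open>M\<close>-th difference of \<open>Y\<close>.
  Differences of \<open>\<Gamma>(\<alpha>+k) (2/r)^k\<close> are moments of \<open>1 - 2u/r\<close> under a gamma distribution with shape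
  \<open>\<alpha> = r/2 + O(1)\<close>, so each difference gains a factor \<open>r^(-1/2)\<close>; Stirling's bound supplies \<open>e^(-r)\<close>.
\<close>

section \<open>Finite differences of scaled Gamma functions\<close>

text \<open>On the line \<open>Re s = 1/2\<close>, and on every line reached from it by unit shifts,
  \<open>|sin(\<pi> s)| = cosh(\<pi> Im s)\<close>, so these lines avoid the zeros of the sine. Of
  the Gamma factors only boundedness on vertical lines is used; convergence comes from
  \<open>1/sin(\<pi> s)\<close>, of size \<open>e^(-\<pi>|t|)\<close>, against the growth
  \<open>e^(2|\<theta>||t|)\<close> of \<open>(z/2)^(2s)\<close>. Here the sector condition enters:
  it leaves \<open>e^(-2\<delta>|t|)\<close>, and it also keeps
  \<open>|1 + q| = 2 cos \<theta>\<close> away from 0.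

  The \<open>M\<close>-th difference is taken under the integral sign, so differences of
  \<open>\<Gamma>(A - s + k) c^(-k)\<close> with \<open>c = r/2\<close> must be bounded uniformly in
  \<open>Im s\<close>. Estimating the binomial terms one by one would gain nothing. The gain is
  cancellation: a gamma distribution with shape \<open>c + O(1)\<close> has standard deviation of
  order \<open>sqrt c\<close>, so \<open>1 - u/c\<close> is typically of size
  \<open>c^(-1/2)\<close>.

  \<open>lommel_S\<close> is a limit over generic parameters. The remainder formula is therefore
  written with the entire function \<open>rGamma\<close>: it is continuous in (\<mu>, \<nu>) and
  passes to that limit.\<close>

definition fdiff :: "(nat \<Rightarrow> 'a::comm_ring_1) \<Rightarrow> nat \<Rightarrow> 'a" where
  "fdiff f k = f k - f (Suc k)"

lemma funpow_fdiff_Suc: "(fdiff ^^ Suc n) f k = (fdiff ^^ n) f k - (fdiff ^^ n) f (Suc k)"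
  by (simp add: fdiff_def)

lemma funpow_fdiff_add:
  "(fdiff ^^ n) (\<lambda>k. f k + g k) k = (fdiff ^^ n) f k + (fdiff ^^ n) g k"
  by (induction n arbitrary: k) (simp_all add: fdiff_def)

lemma funpow_fdiff_cmult:
  "(fdiff ^^ n) (\<lambda>k. a * f k) k = a * (fdiff ^^ n) f k"
  by (induction n arbitrary: k) (simp_all add: fdiff_def algebra_simps)

lemma funpow_fdiff_shift:
  "(fdiff ^^ n) (\<lambda>k. f (Suc k)) k = (fdiff ^^ n) f (Suc k)"
  by (induction n arbitrary: k) (simp_all add: fdiff_def)

lemma funpow_fdiff_shift':
  "(fdiff ^^ n) (\<lambda>k. f (k + m)) k = (fdiff ^^ n) f (k + m)"
  by (induction n arbitrary: k) (simp_all add: fdiff_def)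

text \<open>With \<open>E\<close> the index shift, \<open>fdiff\<close> is \<open>1 - E\<close>, and
  this is the binomial expansion of \<open>(1 - E)^n\<close>. The sign convention is the one of the
  inner sum in \<open>lommel_v\<close>.\<close>

lemma funpow_fdiff_eq_sum:
  "(fdiff ^^ n) f k = (\<Sum>i\<le>n. of_nat (n choose i) * (-1) ^ i * f (k + i))"
proof (induction n arbitrary: k)
  case (Suc n)
  have "(\<Sum>i\<le>Suc n. of_nat (Suc n choose i) * (-1) ^ i * f (k + i))
      = f k + (\<Sum>i\<le>n. of_nat (Suc n choose Suc i) * (-1) ^ Suc i * f (k + Suc i))"
    by (subst sum.atMost_Suc_shift) simp
  also have "(\<Sum>i\<le>n. of_nat (Suc n choose Suc i) * (-1) ^ Suc i * f (k + Suc i))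
      = (\<Sum>i\<le>n. of_nat (n choose Suc i) * (-1) ^ Suc i * f (k + Suc i)
                - of_nat (n choose i) * (-1) ^ i * f (Suc k + i))"
    by (intro sum.cong refl) (simp add: algebra_simps)
  also have "f k + \<dots> = (f k + (\<Sum>i\<le>n. of_nat (n choose Suc i) * (-1) ^ Suc i * f (k + Suc i)))
      - (\<Sum>i\<le>n. of_nat (n choose i) * (-1) ^ i * f (Suc k + i))"
    by (simp only: sum_subtractf add_diff_eq)
  also have "f k + (\<Sum>i\<le>n. of_nat (n choose Suc i) * (-1) ^ Suc i * f (k + Suc i))
      = (\<Sum>i\<le>Suc n. of_nat (n choose i) * (-1) ^ i * f (k + i))"
    by (subst sum.atMost_Suc_shift) simp
  also have "\<dots> = (\<Sum>i\<le>n. of_nat (n choose i) * (-1) ^ i * f (k + i))"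
    by (simp add: binomial_eq_0)
  finally show ?case by (simp only: funpow_fdiff_Suc Suc.IH)
qed simp

text \<open>Iterates the Leibniz rule \<open>fdiff (f g) = fdiff f * g + E f * fdiff g\<close>,
  where \<open>E\<close> shifts the index; \<open>2 ^ j\<close> counts the resulting terms. Each
  step costs one difference or one shift, so only the triangle \<open>j + k \<le> M\<close> is ever
  visited. That matters because the available constants depend on \<open>k\<close>.\<close>

lemma fdiff_mult_bound:
  fixes f g :: "nat \<Rightarrow> 'a::real_normed_field"
  assumes "\<And>j k. j + k \<le> M \<Longrightarrow> norm ((fdiff ^^ j) f k) \<le> F * x ^ j"
    and "\<And>j k. j + k \<le> M \<Longrightarrow> norm ((fdiff ^^ j) g k) \<le> G * x ^ j"
    and "j + k \<le> M"
  shows "norm ((fdiff ^^ j) (\<lambda>k. f k * g k) k) \<le> 2 ^ j * (F * G) * x ^ j"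
  using assms
proof (induction j arbitrary: M F G f g k)
  case 0
  have "norm (f k) \<le> F" "norm (g k) \<le> G"
    using 0(1)[of 0 k] 0(2)[of 0 k] 0(3) by auto
  then show ?case
    by (auto simp: norm_mult intro!: mult_mono order.trans[OF norm_ge_zero])
next
  case (Suc j)
  then obtain M' where M: "M = Suc M'" by (cases M) auto
  have prod: "fdiff (\<lambda>k. f k * g k) = (\<lambda>k. fdiff f k * g k + f (Suc k) * fdiff g k)"
    by (auto simp: fdiff_def algebra_simps)
  have swap: "(fdiff ^^ j) (fdiff h) = (fdiff ^^ Suc j) h" for j and h :: "nat \<Rightarrow> 'a"
    by (simp add: funpow_swap1)
  \<comment> \<open>On the smaller triangle of size \<open>M'\<close>, \<open>fdiff f\<close>
    satisfies the hypothesis with constant \<open>F * x\<close>, while \<open>g\<close> keeps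
    \<open>G\<close>. In \<open>b2\<close> the shifted \<open>f\<close> keeps \<open>F\<close>, and
    the factor \<open>x\<close> goes to \<open>g\<close>.\<close>
  have b1: "norm ((fdiff ^^ j) (\<lambda>k. fdiff f k * g k) k) \<le> 2 ^ j * ((F * x) * G) * x ^ j"
    using Suc.prems(3) unfolding M
    by (intro Suc.IH[where M = M']; (subst swap)?; (intro order.trans[OF Suc.prems(1)] order.trans[OF Suc.prems(2)])?) 
       (auto simp: M algebra_simps)
  have b2: "norm ((fdiff ^^ j) (\<lambda>k. f (Suc k) * fdiff g k) k) \<le> 2 ^ j * (F * (G * x)) * x ^ j"
    using Suc.prems(3) unfolding M
    by (intro Suc.IH[where M = M']; (subst swap funpow_fdiff_shift)?; (intro order.trans[OF Suc.prems(1)] order.trans[OF Suc.prems(2)])?) 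
       (auto simp: M algebra_simps)
  have "(fdiff ^^ Suc j) (\<lambda>k. f k * g k) k
      = (fdiff ^^ j) (\<lambda>k. fdiff f k * g k) k + (fdiff ^^ j) (\<lambda>k. f (Suc k) * fdiff g k) k"
    by (simp add: funpow_swap1 prod funpow_fdiff_add)
  also have "norm \<dots> \<le> 2 ^ j * ((F * x) * G) * x ^ j + 2 ^ j * (F * (G * x)) * x ^ j"
    by (rule norm_triangle_le[OF add_mono[OF b1 b2]])
  also have "\<dots> = 2 ^ Suc j * (F * G) * x ^ Suc j"
    by (simp add: algebra_simps)
  finally show ?case .
qed

text \<open>In terms of the shift \<open>E\<close>, the recurrence reads
  \<open>(1 + q E) Y = \<Phi>\<close>, and \<open>1 + q E = (1 + q) - q (1 - E)\<close>. Expanding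
  the inverse as a geometric series in \<open>q (1 - E) / (1 + q)\<close> and stopping after
  \<open>M\<close> terms gives the sum with an exact remainder.\<close>

lemma euler_transform_remainder:
  fixes Y \<Phi> :: "nat \<Rightarrow> 'a::field"
  assumes "\<And>k. Y k + q * Y (Suc k) = \<Phi> k" and "1 + q \<noteq> 0"
  shows "Y 0 = (\<Sum>m<M. q ^ m / (1 + q) ^ (m + 1) * (fdiff ^^ m) \<Phi> 0)
               + (q / (1 + q)) ^ M * (fdiff ^^ M) Y 0"
proof (induction M)
  case (Suc M)
  have "(fdiff ^^ M) \<Phi> = (fdiff ^^ M) (\<lambda>k. Y k + q * Y (Suc k))"
    using assms(1) by simp
  then have "(fdiff ^^ M) \<Phi> 0 = (fdiff ^^ M) Y 0 + q * (fdiff ^^ M) Y (Suc 0)"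
    by (simp add: funpow_fdiff_add funpow_fdiff_cmult funpow_fdiff_shift)
  then have "(1 + q) * (fdiff ^^ M) Y 0 = (fdiff ^^ M) \<Phi> 0 + q * (fdiff ^^ Suc M) Y 0"
    by (simp add: fdiff_def algebra_simps)
  then have "(fdiff ^^ M) Y 0 = ((fdiff ^^ M) \<Phi> 0 + q * (fdiff ^^ Suc M) Y 0) / (1 + q)"
    using assms(2) by (simp add: field_simps)
  then have "(q / (1 + q)) ^ M * (fdiff ^^ M) Y 0 = q ^ M / (1 + q) ^ (M + 1) * (fdiff ^^ M) \<Phi> 0
     + (q / (1 + q)) ^ Suc M * (fdiff ^^ Suc M) Y 0"
    using assms(2) by (simp add: power_divide add_divide_distrib algebra_simps)
  then show ?case using Suc by simp
qed simp

text \<open>Division by \<open>c ^ i\<close> compensates the growth of \<open>Gamma (A + i)\<close>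
  when \<open>Re A\<close> is close to \<open>c\<close>, so neighbouring values nearly agree and
  differences can be small. The type is left open because bounds for complex \<open>A\<close> are
  reduced to real ones.\<close>

definition scaled_Gamma :: "real \<Rightarrow> 'a::{Gamma,field} \<Rightarrow> nat \<Rightarrow> 'a" where
  "scaled_Gamma c A i = Gamma (A + of_nat i) / of_real c ^ i"

lemma scaled_Gamma_Suc: "scaled_Gamma c A (Suc i) = scaled_Gamma c (A + 1) i / of_real c"
  by (simp add: scaled_Gamma_def add_ac)

lemma fdiff_scaled_Gamma_Suc:
  "(fdiff ^^ Suc n) (scaled_Gamma c A) 0 = (fdiff ^^ n) (scaled_Gamma c A) 0 - (fdiff ^^ n) (scaled_Gamma c (A + 1)) 0 / of_real c"
proof -
  have "(fdiff ^^ n) (scaled_Gamma c A) (Suc 0) = (fdiff ^^ n) (\<lambda>k. scaled_Gamma c A (Suc k)) 0"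
    by (simp add: funpow_fdiff_shift)
  also have "\<dots> = (fdiff ^^ n) (\<lambda>k. inverse (of_real c) * scaled_Gamma c (A + 1) k) 0"
    by (simp add: scaled_Gamma_Suc field_simps)
  finally have "(fdiff ^^ n) (scaled_Gamma c A) (Suc 0) = inverse (of_real c) * (fdiff ^^ n) (scaled_Gamma c (A + 1)) 0"
    by (simp only: funpow_fdiff_cmult)
  then show ?thesis
    by (simp add: fdiff_def divide_inverse mult_ac)
qed

lemma fdiff_scaled_Gamma_shift:
  "(fdiff ^^ n) (scaled_Gamma c A) k = (fdiff ^^ n) (scaled_Gamma c (A + of_nat k)) 0 / of_real c ^ k"
proof -
  have "(fdiff ^^ n) (scaled_Gamma c A) k = (fdiff ^^ n) (\<lambda>i. scaled_Gamma c A (i + k)) 0"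
    by (subst funpow_fdiff_shift') simp
  also have "(\<lambda>i. scaled_Gamma c A (i + k)) = (\<lambda>i. inverse (of_real c ^ k) * scaled_Gamma c (A + of_nat k) i)"
    by (auto simp: scaled_Gamma_def add_ac power_add field_simps)
  finally show ?thesis
    by (simp only: funpow_fdiff_cmult) (simp add: divide_inverse mult_ac)
qed

text \<open>Up to the factor \<open>Gamma \<alpha>\<close>, the left-hand differences are the moments of \<open>1 - u/c\<close> for the
  gamma distribution with shape \<open>\<alpha>\<close>; the recurrence is integration by parts in disguise.\<close>
lemma fdiff_scaled_Gamma_rec:
  fixes \<alpha> c :: real
  assumes "\<alpha> > 0" "c > 0"
  shows "c * (fdiff ^^ Suc (Suc j)) (scaled_Gamma c \<alpha>) 0
    = (c - \<alpha> - real (Suc j)) * (fdiff ^^ Suc j) (scaled_Gamma c \<alpha>) 0 + real (Suc j) * (fdiff ^^ j) (scaled_Gamma c \<alpha>) 0"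
    and "c * (fdiff ^^ Suc 0) (scaled_Gamma c \<alpha>) 0 = (c - \<alpha>) * Gamma \<alpha>"
proof -
  have base: "c * (fdiff ^^ Suc 0) (scaled_Gamma c \<alpha>) 0 = (c - \<alpha>) * Gamma \<alpha>" if "\<alpha> > 0" for \<alpha>
  proof -
    have "\<alpha> \<notin> \<int>\<^sub>\<le>\<^sub>0" using that by (auto elim!: nonpos_Ints_cases)
    then have "Gamma (\<alpha> + 1) = \<alpha> * Gamma \<alpha>" by (rule Gamma_plus1)
    then show ?thesis using assms by (simp add: fdiff_def scaled_Gamma_def field_simps)
  qed
  show "c * (fdiff ^^ Suc 0) (scaled_Gamma c \<alpha>) 0 = (c - \<alpha>) * Gamma \<alpha>"
    using base assms by simp
  define D :: "nat \<Rightarrow> real \<Rightarrow> real" where "D j \<alpha> = (fdiff ^^ j) (scaled_Gamma c \<alpha>) 0" for j \<alpha>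
  have D_Suc: "D (Suc j) \<alpha> = D j \<alpha> - D j (\<alpha> + 1) / c" for j and \<alpha> :: real
    unfolding D_def by (subst fdiff_scaled_Gamma_Suc) simp
  have D0: "D 0 \<alpha>' = Gamma \<alpha>'" for \<alpha>' by (simp add: D_def scaled_Gamma_def)
    have D1: "c * D (Suc 0) \<alpha> = (c - \<alpha>) * D 0 \<alpha>" if "\<alpha> > 0" for \<alpha>
    using base[OF that] by (simp only: D_def[symmetric] D0)
  have "c * D (Suc (Suc j)) \<alpha> = (c - \<alpha> - real (Suc j)) * D (Suc j) \<alpha> + real (Suc j) * D j \<alpha>"
    using \<open>\<alpha> > 0\<close>
  \<comment> \<open>A difference of the next order combines the shapes \<open>\<alpha>\<close> and
    \<open>\<alpha> + 1\<close>, so the induction hypothesis is needed at both. The values at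
    \<open>\<alpha> + 1\<close> are then eliminated again with \<open>D_Suc\<close>.\<close>
  proof (induction j arbitrary: \<alpha>)
    case 0
    have e1: "D 0 (\<alpha> + 1) / c = D 0 \<alpha> - D (Suc 0) \<alpha>"
      using D_Suc[of 0 \<alpha>] by simp
    have "c * D (Suc (Suc 0)) \<alpha> = c * D (Suc 0) \<alpha> - (c * D (Suc 0) (\<alpha> + 1)) / c"
      using D_Suc[of "Suc 0" \<alpha>] assms by (simp add: field_simps)
    also have "c * D (Suc 0) (\<alpha> + 1) = (c - (\<alpha> + 1)) * D 0 (\<alpha> + 1)"
      using 0 by (intro D1) simp
    also have "\<dots> / c = (c - (\<alpha> + 1)) * (D 0 \<alpha> - D (Suc 0) \<alpha>)"
      unfolding e1[symmetric] by simp
    finally show ?case using D1[OF 0] by (simp add: algebra_simps)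
  next
    case (Suc j)
    have e1: "D (Suc j) (\<alpha> + 1) = c * (D (Suc j) \<alpha> - D (Suc (Suc j)) \<alpha>)"
             "D j (\<alpha> + 1) = c * (D j \<alpha> - D (Suc j) \<alpha>)"
      using D_Suc[of j \<alpha>] D_Suc[of "Suc j" \<alpha>] assms by (auto simp: field_simps)
    have "c * D (Suc (Suc (Suc j))) \<alpha> = c * D (Suc (Suc j)) \<alpha> - (c * D (Suc (Suc j)) (\<alpha> + 1)) / c"
      using D_Suc[of "Suc (Suc j)" \<alpha>] assms by (simp add: field_simps)
    also have "c * D (Suc (Suc j)) (\<alpha> + 1) = 
         (c - (\<alpha> + 1) - real (Suc j)) * D (Suc j) (\<alpha> + 1) + real (Suc j) * D j (\<alpha> + 1)"
      using Suc.prems by (intro Suc.IH) simp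
    also have "\<dots> / c = (c - (\<alpha> + 1) - real (Suc j)) * (D (Suc j) \<alpha> - D (Suc (Suc j)) \<alpha>)
        + real (Suc j) * (D j \<alpha> - D (Suc j) \<alpha>)"
      unfolding e1 using assms by (simp add: field_simps)
    finally show ?case using Suc.IH[OF Suc.prems] by (simp add: algebra_simps)
  qed
  then show "c * (fdiff ^^ Suc (Suc j)) (scaled_Gamma c \<alpha>) 0
    = (c - \<alpha> - real (Suc j)) * (fdiff ^^ Suc j) (scaled_Gamma c \<alpha>) 0 + real (Suc j) * (fdiff ^^ j) (scaled_Gamma c \<alpha>) 0"
    by (simp only: D_def)
qed

text \<open>In the three-term recurrence the coefficient \<open>c - \<alpha> - (j + 1)\<close> is
  bounded, because \<alpha> stays within \<open>K\<close> of \<open>c\<close>. Dividing by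
  \<open>c\<close> therefore gains \<open>1 / c\<close> over two orders, that is
  \<open>1 / sqrt c\<close> per order.\<close>

lemma fdiff_scaled_Gamma_real_bound:
  assumes "K \<ge> 0"
  shows "\<exists>C\<ge>0. \<forall>c \<alpha>. c \<ge> 1 \<and> \<alpha> > 0 \<and> \<bar>\<alpha> - c\<bar> \<le> K \<longrightarrow>
     \<bar>(fdiff ^^ j) (scaled_Gamma c \<alpha>) 0\<bar> \<le> C * (1 / sqrt c) ^ j * Gamma (\<alpha>::real)"
proof (induction j rule: less_induct)
  case (less j)
  consider "j = 0" | "j = Suc 0" | i where "j = Suc (Suc i)" by (metis not0_implies_Suc)
  then show ?case
  proof cases
    case 1
    then show ?thesis by (intro exI[of _ 1]) (auto simp: scaled_Gamma_def Gamma_real_pos less_imp_le)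
  next
    case 2
    have "\<bar>(fdiff ^^ j) (scaled_Gamma c \<alpha>) 0\<bar> \<le> K * (1 / sqrt c) ^ j * Gamma \<alpha>"
      if c: "c \<ge> 1" "\<alpha> > 0" "\<bar>\<alpha> - c\<bar> \<le> K" for c \<alpha>
    proof -
      have "(fdiff ^^ j) (scaled_Gamma c \<alpha>) 0 = (c - \<alpha>) / c * Gamma \<alpha>"
        using fdiff_scaled_Gamma_rec(2)[of \<alpha> c] c unfolding 2 by (simp add: field_simps)
      moreover have "\<bar>(c - \<alpha>) / c\<bar> \<le> K / sqrt c"
      proof -
        have "sqrt c \<le> c" using c by (intro real_le_lsqrt) (auto simp: power2_eq_square)
        then show ?thesis using c assms by (auto simp: abs_minus_commute intro!: frac_le)
      qed
      ultimately have "\<bar>(fdiff ^^ j) (scaled_Gamma c \<alpha>) 0\<bar> \<le> K / sqrt c * Gamma \<alpha>"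
        using c Gamma_real_pos[of \<alpha>] by (auto simp only: abs_mult intro!: mult_mono) auto
      then show ?thesis using 2 by simp
    qed
    then show ?thesis using assms by blast
  next
    case (3 i)
    obtain C1 where C1: "C1 \<ge> 0" "\<And>c \<alpha>. c \<ge> 1 \<Longrightarrow> \<alpha> > 0 \<Longrightarrow> \<bar>\<alpha> - c\<bar> \<le> K \<Longrightarrow>
     \<bar>(fdiff ^^ Suc i) (scaled_Gamma c \<alpha>) 0\<bar> \<le> C1 * (1 / sqrt c) ^ Suc i * Gamma (\<alpha>::real)"
      using less.IH[of "Suc i"] 3 by auto
    obtain C0 where C0: "C0 \<ge> 0" "\<And>c \<alpha>. c \<ge> 1 \<Longrightarrow> \<alpha> > 0 \<Longrightarrow> \<bar>\<alpha> - c\<bar> \<le> K \<Longrightarrow>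
     \<bar>(fdiff ^^ i) (scaled_Gamma c \<alpha>) 0\<bar> \<le> C0 * (1 / sqrt c) ^ i * Gamma (\<alpha>::real)"
      using less.IH[of "i"] 3 by auto
    define C where "C = (K + real (Suc i)) * C1 + real (Suc i) * C0"
    have "\<bar>(fdiff ^^ j) (scaled_Gamma c \<alpha>) 0\<bar> \<le> C * (1 / sqrt c) ^ j * Gamma \<alpha>"
      if c: "c \<ge> 1" "\<alpha> > 0" "\<bar>\<alpha> - c\<bar> \<le> K" for c \<alpha>
    proof -
      define x where "x = 1 / sqrt c"
      have x: "0 < x" "x \<le> 1" "x^2 = 1 / c" using c by (auto simp: x_def power_divide)
      have G: "Gamma \<alpha> > 0" using c by (simp add: Gamma_real_pos)
      have "(fdiff ^^ j) (scaled_Gamma c \<alpha>) 0 = x^2 * ((c - \<alpha> - real (Suc i)) * (fdiff ^^ Suc i) (scaled_Gamma c \<alpha>) 0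
           + real (Suc i) * (fdiff ^^ i) (scaled_Gamma c \<alpha>) 0)"
        using fdiff_scaled_Gamma_rec(1)[of \<alpha> c i] c unfolding x(3) 3 by (simp add: field_simps)
      also have "\<bar>\<dots>\<bar> \<le> x^2 * ((K + real (Suc i)) * (C1 * x ^ Suc i * Gamma \<alpha>) +
            real (Suc i) * (C0 * x ^ i * Gamma \<alpha>))"
      proof -
        have "\<bar>(c - \<alpha> - real (Suc i)) * (fdiff ^^ Suc i) (scaled_Gamma c \<alpha>) 0\<bar> \<le> (K + real (Suc i)) * (C1 * x ^ Suc i * Gamma \<alpha>)"
          unfolding abs_mult using C1(2)[OF c] c(3) by (intro mult_mono) (auto simp: x_def)
        moreover have "\<bar>real (Suc i) * (fdiff ^^ i) (scaled_Gamma c \<alpha>) 0\<bar> \<le> real (Suc i) * (C0 * x ^ i * Gamma \<alpha>)"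
          unfolding abs_mult using C0(2)[OF c] by (intro mult_mono) (auto simp: x_def)
        ultimately show ?thesis
          unfolding abs_mult[of "x^2"] by (intro mult_mono order.trans[OF abs_triangle_ineq] add_mono) auto
      qed
      \<comment> \<open>The term of order \<open>i + 1\<close> carries one power of \<open>x\<close>
        too many; it is discarded below by \<open>x \<le> 1\<close>.\<close>
      also have "\<dots> = x ^ j * Gamma \<alpha> * ((K + real (Suc i)) * C1 * x + real (Suc i) * C0)"
        by (simp add: 3 algebra_simps power2_eq_square)
      also have "\<dots> \<le> x ^ j * Gamma \<alpha> * C"
        unfolding C_def using x G assms C1(1)
        by (intro mult_left_mono add_right_mono mult_left_le) auto
      finally show ?thesis by (simp add: x_def mult_ac)
    qed
    moreover have "C \<ge> 0" unfolding C_def using assms C0(1) C1(1) by auto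
    ultimately show ?thesis by blast
  qed
qed

text \<open>Replacing \<open>A\<close> by \<open>A + 1\<close> multiplies the integrand of Euler's
  integral by \<open>t\<close>, so each difference inserts a factor
  \<open>1 - t / c\<close>.\<close>

lemma fdiff_scaled_Gamma_has_integral:
  assumes "Re A > 0" "c > 0"
  shows "((\<lambda>t. of_real t powr (A - 1) / of_real (exp t) * of_real ((1 - t / c) ^ n)) has_integral
            (fdiff ^^ n) (scaled_Gamma c A) 0) {0<..}"
  using assms(1)
proof (induction n arbitrary: A)
  case 0
  then show ?case using Gamma_integral_complex'[of A] by (simp add: scaled_Gamma_def)
next
  case (Suc n)
  have "((\<lambda>t. of_real t powr (A - 1) / of_real (exp t) * of_real ((1 - t / c) ^ n)
         - of_real t powr (A + 1 - 1) / of_real (exp t) * of_real ((1 - t / c) ^ n) / of_real c)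
       has_integral (fdiff ^^ Suc n) (scaled_Gamma c A) 0) {0<..}"
    unfolding fdiff_scaled_Gamma_Suc using Suc.prems
    by (intro has_integral_diff has_integral_divide Suc.IH) auto
  then show ?case
  proof (rule has_integral_eq[rotated])
    fix t :: real assume t: "t \<in> {0<..}"
    have "of_real t powr (A + 1 - 1) = of_real t powr (A - 1) * complex_of_real t"
      using t powr_add[of "of_real t :: complex" "A - 1" 1] by simp
    then show "of_real t powr (A - 1) / of_real (exp t) * of_real ((1 - t / c) ^ n)
         - of_real t powr (A + 1 - 1) / of_real (exp t) * of_real ((1 - t / c) ^ n) / of_real c
        = of_real t powr (A - 1) / of_real (exp t) * of_real ((1 - t / c) ^ Suc n)"
      by (simp add: algebra_simps diff_divide_distrib)
  qed
qed

lemma fdiff_scaled_Gamma_has_integral_real: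
  assumes "\<alpha> > 0" "c > 0"
  shows "((\<lambda>t. t powr (\<alpha> - 1) / exp t * (1 - t / c) ^ n) has_integral
            (fdiff ^^ n) (scaled_Gamma c \<alpha>) 0) {0<..}"
proof -
  have eq: "(fdiff ^^ n) (scaled_Gamma c (of_real \<alpha> :: complex)) 0 = of_real ((fdiff ^^ n) (scaled_Gamma c \<alpha>) 0)"
    unfolding funpow_fdiff_eq_sum scaled_Gamma_def by (simp flip: Gamma_complex_of_real)
  have "((\<lambda>t. of_real t powr (of_real \<alpha> - 1) / of_real (exp t) * of_real ((1 - t / c) ^ n)) has_integral
            complex_of_real ((fdiff ^^ n) (scaled_Gamma c \<alpha>) 0)) {0<..}"
    using fdiff_scaled_Gamma_has_integral[of "of_real \<alpha>" c n] assms unfolding eq by simp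
  from has_integral_linear[OF this bounded_linear_Re]
  have "(Re \<circ> (\<lambda>t. of_real t powr (of_real \<alpha> - 1) / of_real (exp t) * of_real ((1 - t / c) ^ n))
      has_integral (fdiff ^^ n) (scaled_Gamma c \<alpha>) 0) {0<..}"
    by (simp only: Re_complex_of_real)
  then show ?thesis
  proof (rule has_integral_eq[rotated])
    fix t :: real assume t: "t \<in> {0<..}"
    then have "complex_of_real t powr (of_real \<alpha> - 1) = of_real (t powr (\<alpha> - 1))"
      using powr_of_real[of t "\<alpha> - 1"] by simp
    then show "(Re \<circ> (\<lambda>t. of_real t powr (of_real \<alpha> - 1) / of_real (exp t) * of_real ((1 - t / c) ^ n))) t
        = t powr (\<alpha> - 1) / exp t * (1 - t / c) ^ n"
      by (simp only: o_def Re_complex_of_real flip: of_real_divide of_real_mult)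
  qed
qed

text \<open>The recurrence is of no direct use for complex \<open>A\<close>, since
  \<open>|c - A|\<close> grows with \<open>Im A\<close>, and the bound has to be uniform along a
  vertical line. In the integral, however, \<open>|t powr (A - 1)|\<close> depends only on
  \<open>Re A\<close>, which leaves an absolute moment for a real shape.\<close>

lemma fdiff_scaled_Gamma_complex_bound:
  assumes "K \<ge> 0"
  shows "\<exists>C\<ge>0. \<forall>c A. c \<ge> 1 \<and> Re A > 0 \<and> \<bar>Re A - c\<bar> \<le> K \<longrightarrow>
     norm ((fdiff ^^ n) (scaled_Gamma c A) 0) \<le> C * (1 / sqrt c) ^ n * Gamma (Re A)"
proof -
  obtain C where C: "C \<ge> 0" "\<And>c \<alpha>. c \<ge> 1 \<Longrightarrow> \<alpha> > 0 \<Longrightarrow> \<bar>\<alpha> - c\<bar> \<le> K \<Longrightarrow>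
     \<bar>(fdiff ^^ (2 * n)) (scaled_Gamma c \<alpha>) 0\<bar> \<le> C * (1 / sqrt c) ^ (2 * n) * Gamma (\<alpha>::real)"
    using fdiff_scaled_Gamma_real_bound[OF assms, of "2 * n"] by blast
  have "norm ((fdiff ^^ n) (scaled_Gamma c A) 0) \<le> ((1 + C) / 2) * (1 / sqrt c) ^ n * Gamma (Re A)"
    if c: "c \<ge> 1" "Re A > 0" "\<bar>Re A - c\<bar> \<le> K" for c A
  proof -
    \<comment> \<open>The expected size of the \<open>n\<close>-th absolute moment. Used as weight
      in the inequality between arithmetic and geometric mean, it makes both resulting terms of this
      same order.\<close>
    define x where "x = (1 / sqrt c) ^ n"
    have x: "x > 0" using c by (simp add: x_def)
    let ?f = "\<lambda>t. of_real t powr (A - 1) / of_real (exp t) * of_real ((1 - t / c) ^ n) :: complex"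
    let ?g = "\<lambda>t. (t powr (Re A - 1) / exp t * (1 - t / c) ^ 0 * x 
               + t powr (Re A - 1) / exp t * (1 - t / c) ^ (2 * n) / x) / 2"
    have f: "(?f has_integral (fdiff ^^ n) (scaled_Gamma c A) 0) {0<..}"
      using c by (intro fdiff_scaled_Gamma_has_integral) auto
    have g: "(?g has_integral ((fdiff ^^ 0) (scaled_Gamma c (Re A)) 0 * x + (fdiff ^^ (2*n)) (scaled_Gamma c (Re A)) 0 / x) / 2) {0<..}"
      using c by (intro fdiff_scaled_Gamma_has_integral_real has_integral_divide has_integral_add has_integral_mult_left) auto
    have "norm (integral {0<..} ?f) \<le> integral {0<..} ?g"
    proof (rule integral_norm_bound_integral)
      show "?f integrable_on {0<..}" "?g integrable_on {0<..}" using f g by blast+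
      fix t :: real assume t: "t \<in> {0<..}"
      define y where "y = \<bar>1 - t / c\<bar> ^ n"
      \<comment> \<open>AM-GM trades the odd absolute moment for an even one, which is again a difference.\<close>
      have "0 \<le> (x - y)^2" by simp
      then have "y \<le> (x + y^2 / x) / 2" using x by (simp add: field_simps power2_eq_square)
      then have "t powr (Re A - 1) / exp t * y \<le> t powr (Re A - 1) / exp t * ((x + y^2 / x) / 2)"
        by (intro mult_left_mono) auto
      moreover have "norm (?f t) = t powr (Re A - 1) / exp t * y"
        using t unfolding norm_mult norm_divide norm_of_real y_def power_abs by (simp add: norm_powr_real_powr)
      moreover have "y^2 = (1 - t / c) ^ (2 * n)"
      proof -
        have "y^2 = \<bar>1 - t / c\<bar> ^ (n * 2)" unfolding y_def by (rule power_mult[symmetric])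
        also have "\<dots> = (1 - t / c) ^ (n * 2)" by (rule power_even_abs) simp
        finally show ?thesis by (simp only: mult.commute)
      qed
      ultimately show "norm (?f t) \<le> ?g t" by (simp add: algebra_simps)
    qed
    then have "norm ((fdiff ^^ n) (scaled_Gamma c A) 0) \<le> (Gamma (Re A) * x + (fdiff ^^ (2*n)) (scaled_Gamma c (Re A)) 0 / x) / 2"
      unfolding integral_unique[OF f] integral_unique[OF g] by (simp add: scaled_Gamma_def)
    also have "(fdiff ^^ (2*n)) (scaled_Gamma c (Re A)) 0 \<le> C * x^2 * Gamma (Re A)"
      using C(2)[OF c] by (simp add: x_def power_mult mult.commute[of 2 n])
    also have "(Gamma (Re A) * x + C * x^2 * Gamma (Re A) / x) / 2 = ((1 + C) / 2) * x * Gamma (Re A)"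
      using x by (simp add: field_simps power2_eq_square)
    finally show ?thesis using x by (simp add: x_def divide_right_mono)
  qed
  then show ?thesis using C(1) by (intro exI[of _ "(1 + C) / 2"]) auto
qed

text \<open>The quotient of the two Gamma values is a product of \<open>k\<close> factors, each at
  most \<open>(1 + K + k) * c\<close>. Division by \<open>c ^ k\<close> later cancels this
  growth.\<close>

lemma Gamma_shift_bound:
  assumes "c \<ge> 1" "\<alpha> > 0" "\<bar>\<alpha> - c\<bar> \<le> K"
  shows "Gamma (\<alpha> + real k) \<le> ((1 + K + k) * c) ^ k * Gamma \<alpha>"
proof -
  have "\<alpha> \<notin> \<int>\<^sub>\<le>\<^sub>0" using assms by (auto elim!: nonpos_Ints_cases)
  then have "Gamma (\<alpha> + real k) = pochhammer \<alpha> k * Gamma \<alpha>"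
    using Gamma_real_pos[OF assms(2)] by (simp add: pochhammer_Gamma)
  also have "pochhammer \<alpha> k \<le> (\<Prod>i<k. (1 + K + k) * c)"
    unfolding pochhammer_prod lessThan_atLeast0[symmetric]
  proof (intro prod_mono conjI)
    fix i assume "i \<in> {..<k}"
    then have "\<alpha> + real i \<le> c + (K + k) * 1" using assms by auto
    also have "\<dots> \<le> c + (K + k) * c" using assms by (intro add_left_mono mult_left_mono) auto
    finally show "\<alpha> + real i \<le> (1 + K + k) * c" by (simp add: algebra_simps)
  qed (use assms in auto)
  finally show ?thesis using Gamma_real_pos[of \<alpha>] assms by (simp add: mult_right_mono)
qed

text \<open>Starting at index \<open>k\<close> amounts to replacing \<open>A\<close> by
  \<open>A + k\<close> and the radius \<open>K\<close> by \<open>K + k\<close>. Hence the constant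
  depends on \<open>k\<close>.\<close>

lemma fdiff_scaled_Gamma_bound:
  assumes "K \<ge> 0"
  shows "\<exists>C\<ge>0. \<forall>c A. c \<ge> 1 \<and> Re A > 0 \<and> \<bar>Re A - c\<bar> \<le> K \<longrightarrow>
     norm ((fdiff ^^ n) (scaled_Gamma c A) k) \<le> C * (1 / sqrt c) ^ n * Gamma (Re A)"
proof -
  obtain C where C: "C \<ge> 0" "\<And>c A. c \<ge> 1 \<Longrightarrow> Re A > 0 \<Longrightarrow> \<bar>Re A - c\<bar> \<le> K + k \<Longrightarrow>
     norm ((fdiff ^^ n) (scaled_Gamma c A) 0) \<le> C * (1 / sqrt c) ^ n * Gamma (Re A)"
    using fdiff_scaled_Gamma_complex_bound[of "K + real k" n] assms by fastforce
  have "norm ((fdiff ^^ n) (scaled_Gamma c A) k) \<le> (C * (1 + K + k) ^ k) * (1 / sqrt c) ^ n * Gamma (Re A)"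
    if c: "c \<ge> 1" "Re A > 0" "\<bar>Re A - c\<bar> \<le> K" for c A
  proof -
    have "norm ((fdiff ^^ n) (scaled_Gamma c A) k) = norm ((fdiff ^^ n) (scaled_Gamma c (A + of_nat k)) 0) / c ^ k"
      unfolding fdiff_scaled_Gamma_shift[of n c A k] using c by (simp add: norm_divide norm_power)
    also have "\<dots> \<le> C * (1 / sqrt c) ^ n * Gamma (Re A + k) / c ^ k"
      using C(2)[of c "A + of_nat k"] c by (intro divide_right_mono) auto
    also have "\<dots> \<le> C * (1 / sqrt c) ^ n * (((1 + K + k) * c) ^ k * Gamma (Re A)) / c ^ k"
      using c C(1) Gamma_shift_bound[OF c] by (intro divide_right_mono mult_left_mono) auto
    also have "\<dots> = (C * (1 + K + k) ^ k) * (1 / sqrt c) ^ n * Gamma (Re A)"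
      using c by (simp add: power_mult_distrib)
    finally show ?thesis .
  qed
  moreover have "C * (1 + K + k) ^ k \<ge> 0" using C(1) assms by auto
  ultimately show ?thesis by blast
qed

lemma fdiff_scaled_Gamma_mult_bound:
  assumes "K \<ge> 0"
  shows "\<exists>C\<ge>0. \<forall>c A B. c \<ge> 1 \<and> Re A > 0 \<and> \<bar>Re A - c\<bar> \<le> K \<and> Re B > 0 \<and> \<bar>Re B - c\<bar> \<le> K \<longrightarrow>
     norm ((fdiff ^^ M) (\<lambda>k. scaled_Gamma c A k * scaled_Gamma c B k) 0) \<le> C * (1 / sqrt c) ^ M * (Gamma (Re A) * Gamma (Re B))"
proof -
  obtain C where C: "\<And>j k. C j k \<ge> 0" "\<And>j k c A. c \<ge> 1 \<Longrightarrow> Re A > 0 \<Longrightarrow> \<bar>Re A - c\<bar> \<le> K \<Longrightarrow>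
     norm ((fdiff ^^ j) (scaled_Gamma c A) k) \<le> C j k * (1 / sqrt c) ^ j * Gamma (Re A)"
    using fdiff_scaled_Gamma_bound[OF assms] by metis
  \<comment> \<open>One constant for all pairs in the triangle, as the Leibniz estimate
    requires.\<close>
  define D where "D = (\<Sum>j\<le>M. \<Sum>k\<le>M. C j k)"
  have D: "C j k \<le> D" if "j + k \<le> M" for j k
  proof -
    have "C j k \<le> (\<Sum>k\<le>M. C j k)" using that C(1) by (intro member_le_sum) auto
    also have "\<dots> \<le> D" unfolding D_def
      using that C(1) by (intro member_le_sum[of j _ "\<lambda>j. \<Sum>k\<le>M. C j k"]) (auto intro!: sum_nonneg)
    finally show ?thesis .
  qed
  have b: "norm ((fdiff ^^ j) (scaled_Gamma c A) k) \<le> (D * Gamma (Re A)) * (1 / sqrt c) ^ j"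
    if "c \<ge> 1" "Re A > 0" "\<bar>Re A - c\<bar> \<le> K" "j + k \<le> M" for c A j k
  proof -
    have "norm ((fdiff ^^ j) (scaled_Gamma c A) k) \<le> C j k * ((1 / sqrt c) ^ j * Gamma (Re A))"
      using C(2)[OF that(1-3), of j k] by (simp add: mult_ac)
    also have "\<dots> \<le> D * ((1 / sqrt c) ^ j * Gamma (Re A))"
      using that Gamma_real_pos[of "Re A"] by (intro mult_right_mono D) auto
    finally show ?thesis by (simp add: mult_ac)
  qed
  show ?thesis
  proof (intro exI[of _ "2 ^ M * D^2"] conjI allI impI)
    fix c A B assume *: "c \<ge> 1 \<and> Re A > 0 \<and> \<bar>Re A - c\<bar> \<le> K \<and> Re B > 0 \<and> \<bar>Re B - c\<bar> \<le> K"
    have "norm ((fdiff ^^ M) (\<lambda>k. scaled_Gamma c A k * scaled_Gamma c B k) 0) 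
       \<le> 2 ^ M * ((D * Gamma (Re A)) * (D * Gamma (Re B))) * (1 / sqrt c) ^ M"
      using * by (intro fdiff_mult_bound[where M = M] b) auto
    then show "norm ((fdiff ^^ M) (\<lambda>k. scaled_Gamma c A k * scaled_Gamma c B k) 0) 
       \<le> 2 ^ M * D^2 * (1 / sqrt c) ^ M * (Gamma (Re A) * Gamma (Re B))"
      by (simp add: power2_eq_square mult_ac)
  qed auto
qed

section \<open>Contour shifts in vertical strips\<close>

lemma ln_one_plus_lower_bound':
  fixes x :: real
  assumes "x \<ge> 0"
  shows "x - x\<^sup>2 / 2 \<le> ln (1 + x)"
proof -
  let ?f = "\<lambda>t::real. ln (1 + t) - t + t\<^sup>2 / 2"
  have "?f 0 \<le> ?f x"
  proof (rule DERIV_nonneg_imp_nondecreasing[OF assms])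
    fix t :: real assume "0 \<le> t" "t \<le> x"
    then show "\<exists>y. (?f has_real_derivative y) (at t) \<and> 0 \<le> y"
      by (intro exI[of _ "t\<^sup>2 / (1 + t)"])
         (auto intro!: derivative_eq_intros simp: field_simps power2_eq_square)
  qed
  then show ?thesis by simp
qed

text \<open>A one-sided Stirling estimate by monotonicity. Per unit step, the logarithm of the
  quotient of the two sides increases by at most \<open>K / n^2\<close>. The correction
  \<open>K / (n - 1)\<close> in the exponent of \<open>g\<close> drops by
  \<open>K / (n (n - 1))\<close>, which is at least as much, so \<open>g\<close> decreases.\<close>

lemma Gamma_nat_add_bound:
  fixes p :: real
  shows "\<exists>C N0. C \<ge> 0 \<and> (\<forall>n\<ge>N0. 0 < real n + p \<and> 
     Gamma (real n + p) \<le> C * real n powr (real n + p - 1 / 2) * exp (- real n))"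
proof -
  define K where "K = \<bar>p\<bar> + 1"
  define N where "N = nat \<lceil>K\<rceil> + 2"
  have N: "real N \<ge> K + 2" by (simp add: N_def) linarith
  define g where "g n = Gamma (real n + p) * exp (real n) * exp (K / (real n - 1)) / real n powr (real n + p - 1 / 2)" for n
  have decr: "g (Suc n) \<le> g n" if "n \<ge> N" for n
  proof -
    have n: "real n \<ge> K + 2" using that N by linarith
    have K: "K \<ge> 1" "\<bar>p\<bar> \<le> K" by (auto simp: K_def)
    define x where "x = 1 / real n"
    have x: "0 < x" "x \<le> 1" using n K by (auto simp: x_def)
    have pos: "real n + p > 0" using n K by linarith
    have "ln (1 + p * x) \<le> p * x"
      using pos n K by (intro ln_add_one_self_le_self2) (auto simp: x_def field_simps)
    moreover have "x - x\<^sup>2 / 2 \<le> ln (1 + x)"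
      using x by (intro ln_one_plus_lower_bound') auto
    then have "(real n + p + 1 / 2) * (x - x\<^sup>2 / 2) \<le> (real n + p + 1 / 2) * ln (1 + x)"
      using pos by (intro mult_left_mono) auto
    moreover have "(real n + p + 1 / 2) * (x - x\<^sup>2 / 2) = 1 + p * x - (p + 1 / 2) * x^2 / 2"
    proof -
      have "real n * x = 1" using n K by (simp add: x_def)
      then have "(real n + p + 1 / 2) * (x - x\<^sup>2 / 2) = 1 + (p + 1 / 2) * x - x / 2 - (p + 1 / 2) * x^2 / 2"
      proof -
        assume nx: "real n * x = 1"
        have "(real n + p + 1 / 2) * (x - x\<^sup>2 / 2) =
            real n * x + (p + 1 / 2) * x - (real n * x) * x / 2 - (p + 1 / 2) * x^2 / 2"
          by (simp add: field_simps power2_eq_square)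
        then show ?thesis unfolding nx by simp
      qed
      then show ?thesis by (simp add: algebra_simps)
    qed
    moreover have "(p + 1 / 2) * x^2 / 2 \<le> K * x^2"
    proof -
      have "p \<le> K" using K(2) abs_ge_self[of p] by linarith
      then have "(p + 1 / 2) / 2 \<le> K" using K(1) by simp
      then show ?thesis using mult_right_mono[of "(p + 1 / 2) / 2" K "x^2"] by simp
    qed
    moreover have "K * x^2 \<le> K / (real n - 1) - K / real n"
    proof -
      have "x^2 \<le> 1 / (real n - 1) - 1 / real n"
        using n K by (simp add: x_def field_simps power2_eq_square)
      then have "K * x^2 \<le> K * (1 / (real n - 1) - 1 / real n)"
        using K by (intro mult_left_mono) auto
      then show ?thesis by (simp add: right_diff_distrib)
    qed
    ultimately have le: "ln (1 + p * x) + 1 + K / real n \<le> (real n + p + 1 / 2) * ln (1 + x) + K / (real n - 1)"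
      by linarith
    have "\<not> real n + p \<in> \<int>\<^sub>\<le>\<^sub>0" using pos by (auto elim!: nonpos_Ints_cases)
    then have G: "Gamma (real (Suc n) + p) = (real n + p) * Gamma (real n + p)"
      using Gamma_plus1[of "real n + p"] by (simp add: add_ac)
    have Gp: "Gamma (real n + p) > 0" using pos by (rule Gamma_real_pos)
    have Gp0: "Gamma (real n + p) \<noteq> 0" using Gp by linarith
    have lng: "ln (g n) = ln (Gamma (real n + p)) + real n + K / (real n - 1) - (real n + p - 1/2) * ln (real n)"
      using n K Gp0 unfolding g_def by (simp add: ln_mult ln_div ln_powr)
    have lng': "ln (g (Suc n)) = ln (real n + p) + ln (Gamma (real n + p)) + (real n + 1) + K / real n - (real n + p + 1/2) * ln (real n + 1)"
      using n K Gp0 pos unfolding g_def G by (simp add: ln_mult ln_div ln_powr add_ac)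
    have n0: "real n > 0" using n K by linarith
    have eqs: "real n + p = real n * (1 + p * x)" "real n + 1 = real n * (1 + x)"
      using n0 by (auto simp: x_def field_simps)
    have "ln (real n + p) = ln (real n) + ln (1 + p * x)"
      using pos n0 unfolding eqs by (intro ln_mult_pos) (simp_all add: zero_less_mult_iff)
    moreover have "ln (real n + 1) = ln (real n) + ln (1 + x)"
      using n0 x unfolding eqs by (intro ln_mult_pos) simp_all
    ultimately have "ln (g (Suc n)) - ln (g n) = 
        ln (1 + p * x) + 1 + K / real n - ((real n + p + 1 / 2) * ln (1 + x) + K / (real n - 1))"
      unfolding lng lng' by (simp add: algebra_simps)
    with le have "ln (g (Suc n)) \<le> ln (g n)" by linarith
    moreover have "g n > 0" "g (Suc n) > 0"
      using Gp pos n K unfolding g_def G by (auto intro!: divide_pos_pos mult_pos_pos)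
    ultimately show ?thesis by simp
  qed
  have le: "g n \<le> g N" if "n \<ge> N" for n
    using that by (induction rule: dec_induct) (use decr in \<open>force+\<close>)
  show ?thesis
  proof (intro exI conjI allI impI)
    have "real N + p > 0" using N by (simp add: K_def)
    then have "Gamma (real N + p) > 0" by (rule Gamma_real_pos)
    then show "0 \<le> g N" by (simp add: g_def)
    fix n assume n: "n \<ge> N"
    then show pos: "0 < real n + p" using N by (simp add: K_def)
    have n0: "real n > 1" using n N by (simp add: K_def)
    have Gp: "Gamma (real n + p) > 0" using pos by (rule Gamma_real_pos)
    have "Gamma (real n + p) * 1 \<le> Gamma (real n + p) * exp (K / (real n - 1))"
      using n0 Gp by (intro mult_left_mono) (auto simp: K_def)
    also have "\<dots> = g n * real n powr (real n + p - 1 / 2) * exp (- real n)"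
      using n0 by (simp add: g_def exp_minus field_simps)
    also have "\<dots> \<le> g N * real n powr (real n + p - 1 / 2) * exp (- real n)"
      using le[OF n] by (intro mult_right_mono) auto
    finally show "Gamma (real n + p) \<le> g N * real n powr (real n + p - 1 / 2) * exp (- real n)"
      by simp
  qed
qed

lemma complex_Gamma_norm_le:
  assumes "Re z > 0"
  shows "cmod (Gamma z) \<le> Gamma (Re z)"
proof -
  let ?f = "\<lambda>t. complex_of_real t powr (z - 1) / of_real (exp t)"
  let ?g = "\<lambda>t. t powr (Re z - 1) / exp t"
  have f: "(?f has_integral Gamma z) {0..}" and g: "(?g has_integral Gamma (Re z)) {0..}"
    using Gamma_integral_complex[of z] Gamma_integral_real[of "Re z"] assms by auto
  have "norm (integral {0..} ?f) \<le> integral {0..} ?g"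
  proof (rule integral_norm_bound_integral)
    show "?f integrable_on {0..}" "?g integrable_on {0..}" using f g by blast+
    fix t :: real assume t: "t \<in> {0..}"
    then show "norm (?f t) \<le> ?g t"
      unfolding norm_divide norm_of_real by (cases "t = 0") (simp_all add: norm_powr_real_powr)
  qed
  then show ?thesis unfolding integral_unique[OF f] integral_unique[OF g] .
qed

section \<open>Residue theorem on an unbounded vertical strip\<close>

lemma integrable_exp_neg_abs:
  assumes "\<kappa> > 0"
  shows "integrable lborel (\<lambda>t::real. exp (- \<kappa> * \<bar>t\<bar>))"
proof -
  have 1: "set_integrable lborel {0..} (\<lambda>t::real. exp (- (\<kappa> * t)))"
  proof -
    have "set_integrable lebesgue {0..} (\<lambda>t::real. exp (- \<kappa> * t))"
      using integrable_on_exp_minus_to_infinity[OF assms, of 0]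
      by (intro nonnegative_absolutely_integrable_1) auto
    then show ?thesis
      unfolding set_integrable_def by (subst (asm) integrable_completion) auto
  qed
  have "integrable lborel (\<lambda>t::real. indicator {0..} t *\<^sub>R exp (- (\<kappa> * t)))"
    using 1 by (simp add: set_integrable_def)
  then have 2: "integrable lborel (\<lambda>t::real. indicator {0..} (-t) *\<^sub>R exp (- (\<kappa> * -t)))"
    using lborel_integrable_real_affine[of "\<lambda>t::real. indicator {0..} t *\<^sub>R exp (- (\<kappa> * t))" "-1" 0] by simp
  have "integrable lborel (\<lambda>t::real. indicator {0..} t *\<^sub>R exp (- (\<kappa> * t)) + indicator {0..} (-t) *\<^sub>R exp (- (\<kappa> * -t)))"
    using 1 2 by (intro Bochner_Integration.integrable_add) (simp_all add: set_integrable_def)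
  then show ?thesis
    by (rule Bochner_Integration.integrable_bound) (auto simp: indicator_def)
qed

lemma line_integral_tendsto:
  fixes f :: "real \<Rightarrow> complex"
  assumes "integrable lborel f" "continuous_on UNIV f"
  shows "(\<lambda>n. integral {- real n..real n} f) \<longlonglongrightarrow> (LINT t|lborel. f t)"
proof -
  have "(\<lambda>n. LINT t|lborel. indicator {- real n..real n} t *\<^sub>R f t) \<longlonglongrightarrow> (LINT t|lborel. f t)"
  proof (rule integral_dominated_convergence[where w = "\<lambda>t. norm (f t)"])
    show "AE t in lborel. (\<lambda>n. indicator {- real n..real n} t *\<^sub>R f t) \<longlonglongrightarrow> f t"
    proof (rule AE_I2)
      fix t :: real
      obtain n0 where n0: "\<bar>t\<bar> \<le> real n0" using real_arch_simple by blast
      have "\<forall>\<^sub>F n in sequentially. indicator {- real n..real n} t *\<^sub>R f t = f t"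
        using eventually_ge_at_top[of n0] by eventually_elim (use n0 in \<open>auto simp: indicator_def\<close>)
      then show "(\<lambda>n. indicator {- real n..real n} t *\<^sub>R f t) \<longlonglongrightarrow> f t"
        by (rule tendsto_eventually)
    qed
  qed (use assms in \<open>auto simp: indicator_def\<close>)
  moreover have "(LINT t|lborel. indicator {- real n..real n} t *\<^sub>R f t) = integral {- real n..real n} f" for n
  proof -
    have "set_integrable lborel {- real n..real n} f"
      using assms by (intro borel_integrable_atLeastAtMost' continuous_on_subset[OF assms(2)]) auto
    from set_borel_integral_eq_integral(2)[OF this] show ?thesis by (simp add: set_lebesgue_integral_def)
  qed
  ultimately show ?thesis by simp
qed

text \<open>The residue theorem is applied to rectangles of height tending to infinity, whose
  horizontal sides vanish by the exponential decay. The margin \<eta> provides an open convex domain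
  around the closed strip. The factor is \<open>2 * pi\<close> rather than
  \<open>2 * pi * \<i>\<close> because \<open>ds = \<i> dt\<close> on vertical lines.\<close>

lemma strip_residue:
  fixes f :: "complex \<Rightarrow> complex"
  assumes holo: "f holomorphic_on {s. c1 - \<eta> < Re s \<and> Re s < c2 + \<eta>} - pts"
    and fin: "finite pts" and "c1 < c2" "\<eta> > 0" "\<kappa> > 0"
    and pts: "\<And>p. p \<in> pts \<Longrightarrow> c1 < Re p \<and> Re p < c2"
    and decay: "\<And>s. c1 \<le> Re s \<Longrightarrow> Re s \<le> c2 \<Longrightarrow> \<bar>Im s\<bar> \<ge> T \<Longrightarrow> cmod (f s) \<le> D * exp (- \<kappa> * \<bar>Im s\<bar>)"
    and int: "integrable lborel (\<lambda>t. f (Complex c1 t))" "integrable lborel (\<lambda>t. f (Complex c2 t))"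
  shows "(LINT t|lborel. f (Complex c2 t)) - (LINT t|lborel. f (Complex c1 t)) = 2 * pi * (\<Sum>p\<in>pts. residue f p)"
proof -
  let ?U = "{s. c1 - \<eta> < Re s \<and> Re s < c2 + \<eta>}"
  have U: "open ?U" "convex ?U"
    by (auto simp: open_Collect_conj open_halfspace_Re_gt open_halfspace_Re_lt
          convex_halfspace_Re_gt convex_halfspace_Re_lt Collect_conj_eq convex_Int)
  have cont: "continuous_on (?U - pts) f" using holo by (rule holomorphic_on_imp_continuous_on)
  have cl: "continuous_on UNIV (\<lambda>t. f (Complex c t))" if "c \<in> {c1, c2}" for c
    using that assms(3,4) pts
    by (intro continuous_on_compose2[OF cont] continuous_intros) force+
  \<comment> \<open>Beyond height \<open>T0\<close> the rectangle encloses every pole, so that all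
    winding numbers are 1.\<close>
  obtain T0 where "\<forall>p\<in>pts. norm p < T0"
    using finite_imp_bounded[OF fin] by (auto simp: bounded_pos_less)
  then have T0: "\<bar>Im p\<bar> < T0" if "p \<in> pts" for p
    using that abs_Im_le_cmod[of p] by force
  define J where "J n = integral {- real n..real n} (\<lambda>t. f (Complex c2 t)) - integral {- real n..real n} (\<lambda>t. f (Complex c1 t))" for n
  have lim1: "J \<longlonglongrightarrow> (LINT t|lborel. f (Complex c2 t)) - (LINT t|lborel. f (Complex c1 t))"
    unfolding J_def using int by (intro tendsto_diff line_integral_tendsto cl) auto
  have bound: "norm (\<i> * J n - 2 * pi * \<i> * (\<Sum>p\<in>pts. residue f p)) \<le> 2 * (\<bar>D\<bar> * exp (- \<kappa> * real n) * (c2 - c1))"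
    if n: "real n > max (max T T0) 0" for n
  proof -
    define y where "y = real n"
    have y: "y > 0" "y > T" "y > T0" using n by (auto simp: y_def)
    define a1 a2 a3 a4 where "a1 = Complex c1 (-y)" "a2 = Complex c2 (-y)" "a3 = Complex c2 y" "a4 = Complex c1 y"
    note a_defs = this
    let ?g = "rectpath a1 a3"
    have img: "path_image ?g \<subseteq> ?U - pts"
    proof -
      have "path_image ?g \<subseteq> cbox a1 a3 - box a1 a3"
        using assms(3) y by (subst path_image_rectpath_cbox_minus_box) (auto simp: a_defs)
      moreover have "cbox a1 a3 \<subseteq> ?U" using \<open>\<eta> > 0\<close> by (auto simp: in_cbox_complex_iff a_defs)
      moreover have "pts \<subseteq> box a1 a3"
        using pts T0 y by (fastforce simp: in_box_complex_iff a_defs)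
      ultimately show ?thesis by blast
    qed
    have wn: "winding_number ?g p = 1" if "p \<in> pts" for p
      using pts[OF that] T0[OF that] y by (intro winding_number_rectpath) (auto simp: in_box_complex_iff a_defs)
    have "contour_integral ?g f = 2 * pi * \<i> * (\<Sum>p\<in>pts. winding_number ?g p * residue f p)"
    proof (rule Residue_theorem[OF U(1) convex_connected[OF U(2)] fin holo _ _ img])
      show "\<forall>z. z \<notin> ?U \<longrightarrow> winding_number ?g z = 0"
        using assms(3,4) y by (auto intro!: winding_number_rectpath_outside simp: in_cbox_complex_iff a_defs)
    qed auto
    also have "\<dots> = 2 * pi * \<i> * (\<Sum>p\<in>pts. residue f p)" using wn by simp
    finally have res: "contour_integral ?g f = \<dots>" .
    have segs: "closed_segment a1 a2 \<subseteq> ?U - pts" "closed_segment a2 a3 \<subseteq> ?U - pts"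
      "closed_segment a3 a4 \<subseteq> ?U - pts" "closed_segment a4 a1 \<subseteq> ?U - pts"
      using img by (auto simp: rectpath_def Let_def path_image_join a_defs)
    have ci: "f contour_integrable_on (linepath a1 a2)" "f contour_integrable_on (linepath a2 a3)"
      "f contour_integrable_on (linepath a3 a4)" "f contour_integrable_on (linepath a4 a1)"
      using segs by (auto intro!: contour_integrable_continuous_linepath continuous_on_subset[OF cont])
    have "contour_integral ?g f = contour_integral (linepath a1 a2) f + contour_integral (linepath a2 a3) f
        + contour_integral (linepath a3 a4) f + contour_integral (linepath a4 a1) f"
    proof -
      have "?g = linepath a1 a2 +++ linepath a2 a3 +++ linepath a3 a4 +++ linepath a4 a1"
        by (simp add: rectpath_def Let_def a_defs)
      then show ?thesis using ci by simp
    qed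
    moreover have "contour_integral (linepath a2 a3) f = \<i> * integral {-y..y} (\<lambda>t. f (Complex c2 t))"
      using y by (intro contour_integral_linepath_same_Re) (auto simp: a_defs)
    moreover have "contour_integral (linepath a4 a1) f = - (\<i> * integral {-y..y} (\<lambda>t. f (Complex c1 t)))"
    proof -
      have "contour_integral (linepath a1 a4) f = \<i> * integral {-y..y} (\<lambda>t. f (Complex c1 t))"
        using y by (intro contour_integral_linepath_same_Re) (auto simp: a_defs)
      moreover have "contour_integral (linepath a4 a1) f = - contour_integral (linepath a1 a4) f"
        using segs by (intro contour_integral_reverse_linepath continuous_on_subset[OF cont])
      ultimately show ?thesis by simp
    qed
    ultimately have eq: "\<i> * J n - 2 * pi * \<i> * (\<Sum>p\<in>pts. residue f p) = 
       - contour_integral (linepath a1 a2) f - contour_integral (linepath a3 a4) f"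
      using res by (simp add: J_def y_def algebra_simps)
    have b: "norm (contour_integral (linepath u v) f) \<le> \<bar>D\<bar> * exp (- \<kappa> * y) * norm (v - u)"
      if "(u, v) \<in> {(a1, a2), (a3, a4)}" for u v
    proof (rule contour_integral_bound_linepath)
      show "f contour_integrable_on (linepath u v)" using that ci by auto
      fix s assume "s \<in> closed_segment u v"
      then have s: "\<bar>Im s\<bar> = y \<and> c1 \<le> Re s \<and> Re s \<le> c2"
        using that y \<open>c1 < c2\<close> by (auto simp: a_defs closed_segment_same_Im closed_segment_eq_real_ivl)
      then have "norm (f s) \<le> D * exp (- \<kappa> * y)" using decay[of s] y by auto
      also have "\<dots> \<le> \<bar>D\<bar> * exp (- \<kappa> * y)" by (intro mult_right_mono) auto
      finally show "norm (f s) \<le> \<bar>D\<bar> * exp (- \<kappa> * y)" .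
    qed auto
    have n: "norm (a2 - a1) = c2 - c1" "norm (a4 - a3) = c2 - c1"
      using \<open>c1 < c2\<close> by (auto simp: a_defs cmod_def)
    show ?thesis unfolding eq
      using norm_triangle_ineq4[of "- contour_integral (linepath a1 a2) f" "contour_integral (linepath a3 a4) f"]
        b[of a1 a2] b[of a3 a4] n by (simp add: y_def)
  qed
  have "(\<lambda>n. \<i> * J n - 2 * pi * \<i> * (\<Sum>p\<in>pts. residue f p)) \<longlonglongrightarrow> 0"
  proof (rule Lim_null_comparison)
    show "\<forall>\<^sub>F n in sequentially. norm (\<i> * J n - 2 * pi * \<i> * (\<Sum>p\<in>pts. residue f p)) \<le> 2 * (\<bar>D\<bar> * exp (- \<kappa> * real n) * (c2 - c1))"
      using eventually_gt_at_top[of "nat \<lceil>max (max T T0) 0\<rceil>"]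
      by eventually_elim (rule bound, linarith)
    have "(\<lambda>n. exp (- \<kappa> * real n)) \<longlonglongrightarrow> 0"
      using \<open>\<kappa> > 0\<close> by real_asymp
    from tendsto_mult[OF this tendsto_const[of "2 * \<bar>D\<bar> * (c2 - c1)"]]
    show "(\<lambda>n. 2 * (\<bar>D\<bar> * exp (- \<kappa> * real n) * (c2 - c1))) \<longlonglongrightarrow> 0" by (simp add: algebra_simps)
  qed
  moreover have "(\<lambda>n. \<i> * J n - 2 * pi * \<i> * (\<Sum>p\<in>pts. residue f p)) \<longlonglongrightarrow>
    \<i> * ((LINT t|lborel. f (Complex c2 t)) - (LINT t|lborel. f (Complex c1 t))) - 2 * pi * \<i> * (\<Sum>p\<in>pts. residue f p)"
    by (intro tendsto_intros lim1)
  ultimately have "\<i> * ((LINT t|lborel. f (Complex c2 t)) - (LINT t|lborel. f (Complex c1 t))) = \<i> * (2 * pi * (\<Sum>p\<in>pts. residue f p))"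
    using LIMSEQ_unique by (force simp: algebra_simps)
  then show ?thesis by simp
qed

section \<open>Mellin--Barnes integrals\<close>

text \<open>The parameter \<open>l\<close> stands for \<open>Ln (z/2)\<close>.\<close>
definition mb_integrand :: "complex \<Rightarrow> complex \<Rightarrow> complex \<Rightarrow> complex \<Rightarrow> complex" where
  "mb_integrand A B l s = of_real pi / sin (of_real pi * s) * Gamma (A - s) * Gamma (B - s) * exp (2 * s * l)"

text \<open>The line is parametrized by its imaginary part; \<open>ds = \<i> dt\<close> turns the
  usual normalization \<open>1 / (2 \<pi> \<i>)\<close> into \<open>1 / (2 \<pi>)\<close>.\<close>

definition mb_integral :: "complex \<Rightarrow> complex \<Rightarrow> complex \<Rightarrow> complex" where
  "mb_integral A B l = (LINT t|lborel. mb_integrand A B l (Complex (1/2) t)) / (2 * of_real pi)"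

text \<open>From \<open>|sin(\<pi> s)|^2 = (cosh(2y) - cos(2x)) / 2\<close> with
  \<open>x + \<i> y = \<pi> s\<close>. On lines with half-integral abscissa the cosine is -1 and
  helps; for \<open>|Im s| \<ge> 1\<close> one has \<open>E \<ge> 7\<close>, which absorbs the
  cosine at the price of the crude factor 1/4.\<close>

lemma norm_sin_pi_ge:
  assumes "\<bar>Im s\<bar> \<ge> 1 \<or> Re s - 1 / 2 \<in> \<int>"
  shows "cmod (sin (of_real pi * s)) \<ge> exp (pi * \<bar>Im s\<bar>) / 4"
proof -
  define y where "y = pi * Im s"
  have ay: "\<bar>y\<bar> = pi * \<bar>Im s\<bar>" by (simp add: y_def abs_mult)
  define E where "E = exp (2 * \<bar>y\<bar>)"
  have E1: "E \<ge> 1" by (simp add: E_def)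
  define X where "X = exp (2 * y) + inverse (exp (2 * y))"
  define c where "c = cos (2 * (pi * Re s))"
  have eq: "(cmod (sin (of_real pi * s)))\<^sup>2 = (X - 2 * c) / 4"
    by (subst norm_sin_squared) (simp add: y_def X_def c_def)
  have E2: "E \<le> X"
    unfolding X_def by (cases "y \<ge> 0") (auto simp: E_def exp_minus[symmetric])
  have ge: "(cmod (sin (of_real pi * s)))\<^sup>2 \<ge> E / 16"
    using assms
  proof
    assume "\<bar>Im s\<bar> \<ge> 1"
    then have "1 * 3 \<le> \<bar>Im s\<bar> * pi" using pi_gt3 by (intro mult_mono) auto
    then have "\<bar>y\<bar> \<ge> 3" by (simp add: ay mult.commute)
    then have "E \<ge> 1 + 2 * 3" unfolding E_def using exp_ge_add_one_self[of "2 * \<bar>y\<bar>"] by linarith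
    then show ?thesis using E2 unfolding eq
      using cos_le_one[of "2 * (pi * Re s)", folded c_def] by (simp add: field_simps)
  next
    assume "Re s - 1 / 2 \<in> \<int>"
    then obtain n :: int where n: "Re s - 1 / 2 = of_int n" by (elim Ints_cases)
    have "c = cos (pi + 2 * pi * of_int n)"
      using n unfolding c_def by (intro arg_cong[of _ _ cos]) (simp add: field_simps)
    also have "\<dots> = - 1"
      by (metis cos_add cos_int_2pin cos_pi mult.right_neutral mult_zero_right minus_mult_left sin_int_2pin diff_zero sin_pi mult_zero_left)
    finally show ?thesis using E2 E1 unfolding eq by (simp add: field_simps)
  qed
  have "(exp (pi * \<bar>Im s\<bar>) / 4)\<^sup>2 = E / 16"
    by (simp add: E_def ay power_divide exp_double)
  with ge have "(exp (pi * \<bar>Im s\<bar>) / 4)\<^sup>2 \<le> (cmod (sin (of_real pi * s)))\<^sup>2" by (simp only:)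
  then show ?thesis by (rule power2_le_imp_le) simp
qed

lemma norm_pi_div_sin_le:
  assumes "\<bar>Im s\<bar> \<ge> 1 \<or> Re s - 1 / 2 \<in> \<int>"
  shows "cmod (of_real pi / sin (of_real pi * s)) \<le> 4 * pi * exp (- pi * \<bar>Im s\<bar>)"
proof -
  have "cmod (of_real pi / sin (of_real pi * s)) \<le> pi / (exp (pi * \<bar>Im s\<bar>) / 4)"
    unfolding norm_divide norm_of_real using norm_sin_pi_ge[OF assms]
    by (intro frac_le) auto
  then show ?thesis by (simp add: exp_minus field_simps)
qed

lemma norm_exp_mult_le: "cmod (exp (2 * s * l)) \<le> exp (2 * Re s * Re l) * exp (2 * \<bar>Im l\<bar> * \<bar>Im s\<bar>)"
proof -
  have "- (Im s * Im l) \<le> \<bar>Im s * Im l\<bar>" by linarith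
  then show ?thesis by (simp add: abs_mult flip: exp_add) (simp add: algebra_simps)
qed

text \<open>The functional equation moves \<open>w = A - s\<close> to the right by \<open>m\<close>
  steps. Each factor \<open>w + i\<close> has modulus at least \<open>|Im w| \<ge> 1\<close>, so
  this only increases the modulus of Gamma; in the right half-plane \<open>Gamma (Re w + m)\<close>
  dominates, and it is bounded on a compact interval.\<close>

lemma Gamma_bounded_vertical_strip:
  fixes A :: complex
  shows "\<exists>G\<ge>0. \<forall>s. c1 \<le> Re s \<and> Re s \<le> c2 \<and> \<bar>Im s\<bar> \<ge> \<bar>Im A\<bar> + 1 \<longrightarrow> cmod (Gamma (A - s)) \<le> G"
proof (cases "c1 \<le> c2")
  case True
  obtain m :: nat where m: "Re A - c2 + real m > 0"
    using reals_Archimedean2[of "c2 - Re A"] by (auto simp: algebra_simps)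
  have "compact (Gamma ` {Re A - c2 + real m .. Re A - c1 + real m})"
    using m by (intro compact_continuous_image continuous_on_Gamma compact_Icc) (auto elim!: nonpos_Ints_cases)
  then obtain G where "\<forall>x\<in>Gamma ` {Re A - c2 + real m .. Re A - c1 + real m}. norm x \<le> G"
    using compact_imp_bounded bounded_iff by metis
  then have G: "\<bar>Gamma x\<bar> \<le> G" if "x \<in> {Re A - c2 + real m .. Re A - c1 + real m}" for x
    using that by auto
  show ?thesis
  proof (intro exI[of _ G] conjI allI impI)
    show "G \<ge> 0" using G[of "Re A - c2 + real m"] True by force
    fix s assume s: "c1 \<le> Re s \<and> Re s \<le> c2 \<and> \<bar>Im A\<bar> + 1 \<le> \<bar>Im s\<bar>"
    define w where "w = A - s"
    have Im: "\<bar>Im w\<bar> \<ge> 1" using s unfolding w_def minus_complex.sel by linarith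
    then have "w \<notin> \<int>\<^sub>\<le>\<^sub>0" by (auto elim!: nonpos_Ints_cases)
    then have "pochhammer w m * Gamma w = Gamma (w + of_nat m)"
      by (simp add: pochhammer_Gamma Gamma_eq_zero_iff)
    moreover have "1 \<le> cmod (pochhammer w m)"
      unfolding pochhammer_prod
    proof (subst prod_norm[symmetric], rule prod_ge_1)
      fix i have "1 \<le> \<bar>Im (w + of_nat i)\<bar>" using Im by simp
      also have "\<dots> \<le> cmod (w + of_nat i)" by (rule abs_Im_le_cmod)
      finally show "1 \<le> cmod (w + of_nat i)" .
    qed
    ultimately have "cmod (Gamma w) \<le> cmod (Gamma (w + of_nat m))"
      using mult_right_mono[of 1 "cmod (pochhammer w m)" "cmod (Gamma w)"] by (metis mult_1 norm_ge_zero norm_mult)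
    also have "\<dots> \<le> Gamma (Re (w + of_nat m))"
      using s m by (intro complex_Gamma_norm_le) (auto simp: w_def)
    also have "\<dots> \<le> G" using G[of "Re (w + of_nat m)"] s by (auto simp: w_def)
    finally show "cmod (Gamma (A - s)) \<le> G" by (simp add: w_def)
  qed
qed auto

text \<open>The rate is the balance of \<open>e^(-\<pi>|Im s|)\<close> from the sine against at most
  \<open>e^(2|Im l||Im s|)\<close> from the exponential, the Gamma factors being bounded. It is
  positive exactly when \<open>|Im l| < \<pi>/2\<close>.\<close>

lemma mb_integrand_decay:
  "\<exists>D T. \<forall>s. c1 \<le> Re s \<longrightarrow> Re s \<le> c2 \<longrightarrow> T \<le> \<bar>Im s\<bar> \<longrightarrow>
     cmod (mb_integrand A B l s) \<le> D * exp (- (pi - 2 * \<bar>Im l\<bar>) * \<bar>Im s\<bar>)"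
proof -
  obtain G where G: "G \<ge> 0" "\<And>s. c1 \<le> Re s \<Longrightarrow> Re s \<le> c2 \<Longrightarrow> \<bar>Im A\<bar> + 1 \<le> \<bar>Im s\<bar> \<Longrightarrow> cmod (Gamma (A - s)) \<le> G"
    using Gamma_bounded_vertical_strip[of c1 c2 A] by blast
  obtain H where H: "H \<ge> 0" "\<And>s. c1 \<le> Re s \<Longrightarrow> Re s \<le> c2 \<Longrightarrow> \<bar>Im B\<bar> + 1 \<le> \<bar>Im s\<bar> \<Longrightarrow> cmod (Gamma (B - s)) \<le> H"
    using Gamma_bounded_vertical_strip[of c1 c2 B] by blast
  define D where "D = 4 * pi * G * H * exp (2 * (\<bar>c1\<bar> + \<bar>c2\<bar>) * \<bar>Re l\<bar>)"
  show ?thesis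
  proof (rule exI[of _ D], rule exI[of _ "\<bar>Im A\<bar> + \<bar>Im B\<bar> + 1"], intro allI impI)
    fix s assume s: "c1 \<le> Re s" "Re s \<le> c2" "\<bar>Im A\<bar> + \<bar>Im B\<bar> + 1 \<le> \<bar>Im s\<bar>"
    have "Re s * Re l \<le> \<bar>Re s\<bar> * \<bar>Re l\<bar>" by (metis abs_ge_self abs_mult)
    also have "\<dots> \<le> (\<bar>c1\<bar> + \<bar>c2\<bar>) * \<bar>Re l\<bar>" using s by (intro mult_right_mono) auto
    finally have e: "exp (2 * Re s * Re l) \<le> exp (2 * (\<bar>c1\<bar> + \<bar>c2\<bar>) * \<bar>Re l\<bar>)" by (simp only: exp_le_cancel_iff mult.assoc)
    have "cmod (mb_integrand A B l s) \<le> (4 * pi * exp (- pi * \<bar>Im s\<bar>)) * G * H * (exp (2 * (\<bar>c1\<bar> + \<bar>c2\<bar>) * \<bar>Re l\<bar>) * exp (2 * \<bar>Im l\<bar> * \<bar>Im s\<bar>))"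
      unfolding mb_integrand_def norm_mult
      using s G(1) H(1) e
      by (intro mult_mono norm_pi_div_sin_le G(2) H(2) order.trans[OF norm_exp_mult_le]) auto
    also have "\<dots> = D * (exp (- pi * \<bar>Im s\<bar>) * exp (2 * \<bar>Im l\<bar> * \<bar>Im s\<bar>))"
      by (simp add: D_def mult_ac)
    also have "\<dots> = D * exp (- (pi - 2 * \<bar>Im l\<bar>) * \<bar>Im s\<bar>)"
      by (simp add: algebra_simps flip: exp_add)
    finally show "cmod (mb_integrand A B l s) \<le> D * exp (- (pi - 2 * \<bar>Im l\<bar>) * \<bar>Im s\<bar>)" .
  qed
qed

lemma integrable_exp_decay:
  fixes g :: "real \<Rightarrow> complex"
  assumes cont: "continuous_on UNIV g" and "\<kappa> > 0"
    and dec: "\<And>t. \<bar>t\<bar> \<ge> T \<Longrightarrow> cmod (g t) \<le> D * exp (- \<kappa> * \<bar>t\<bar>)"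
  shows "integrable lborel g"
proof -
  have "compact (g ` {-\<bar>T\<bar>..\<bar>T\<bar>})"
    by (intro compact_continuous_image continuous_on_subset[OF cont]) auto
  then obtain G where "\<forall>x\<in>g ` {-\<bar>T\<bar>..\<bar>T\<bar>}. cmod x \<le> G"
    using compact_imp_bounded bounded_iff by metis
  then have G: "cmod (g t) \<le> G" if "t \<in> {-\<bar>T\<bar>..\<bar>T\<bar>}" for t using that by blast
  have G0: "G \<ge> 0" using G[of 0] norm_ge_zero[of "g 0"] by (meson abs_ge_zero atLeastAtMost_iff neg_le_0_iff_le order.trans)
  define E where "E = \<bar>D\<bar> + G * exp (\<kappa> * \<bar>T\<bar>)"
  have b: "cmod (g t) \<le> E * exp (- \<kappa> * \<bar>t\<bar>)" for t
  proof (cases "\<bar>t\<bar> \<ge> \<bar>T\<bar>")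
    case True
    then have "cmod (g t) \<le> D * exp (- \<kappa> * \<bar>t\<bar>)" using dec[of t] by linarith
    also have "\<dots> \<le> E * exp (- \<kappa> * \<bar>t\<bar>)" unfolding E_def using G0
      by (intro mult_right_mono) (auto intro: order.trans[OF abs_ge_self])
    finally show ?thesis .
  next
    case False
    then have "t \<in> {-\<bar>T\<bar>..\<bar>T\<bar>}" unfolding atLeastAtMost_iff by linarith
    then have "cmod (g t) \<le> G * 1" using G[of t] by (simp add: abs_le_iff)
    also have "\<dots> \<le> G * (exp (\<kappa> * \<bar>T\<bar>) * exp (- \<kappa> * \<bar>t\<bar>))"
      using False G0 \<open>\<kappa> > 0\<close> by (intro mult_left_mono) (auto simp flip: exp_add)
    also have "\<dots> \<le> E * exp (- \<kappa> * \<bar>t\<bar>)" unfolding E_def by (simp add: algebra_simps)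
    finally show ?thesis .
  qed
  have "integrable lborel (\<lambda>t. E * exp (- \<kappa> * \<bar>t\<bar>))"
    using integrable_exp_neg_abs[OF \<open>\<kappa> > 0\<close>] by simp
  then show ?thesis
  proof (rule Bochner_Integration.integrable_bound)
    show "g \<in> borel_measurable lborel" using cont borel_measurable_continuous_onI by auto
    show "AE t in lborel. norm (g t) \<le> norm (E * exp (- \<kappa> * \<bar>t\<bar>))"
      using b by (auto intro: order.trans[OF _ abs_ge_self])
  qed
qed

lemma sin_pi_eq_0_iff: "sin (of_real pi * s) = 0 \<longleftrightarrow> (s :: complex) \<in> \<int>"
  by (auto simp: sin_eq_0 Ints_def mult.commute)

lemma holomorphic_mb_integrand:
  assumes "\<And>s. s \<in> X \<Longrightarrow> s \<notin> \<int>" "\<And>s. s \<in> X \<Longrightarrow> A - s \<notin> \<int>\<^sub>\<le>\<^sub>0" "\<And>s. s \<in> X \<Longrightarrow> B - s \<notin> \<int>\<^sub>\<le>\<^sub>0"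
  shows "mb_integrand A B l holomorphic_on X"
  unfolding mb_integrand_def using assms
  by (intro holomorphic_intros) (auto simp: sin_pi_eq_0_iff)

text \<open>The hypotheses keep the line off all poles: a half-integral \<open>c\<close> avoids the
  integers, and the poles \<open>A + k\<close> and \<open>B + k\<close> either lie to the right of
  the line or never have real part \<open>c\<close>.\<close>

lemma integrable_mb_integrand:
  assumes "\<bar>Im l\<bar> < pi / 2" "c - 1 / 2 \<in> \<int>" "Re A - c > 0 \<or> Re A - c \<notin> \<int>" "Re B - c > 0 \<or> Re B - c \<notin> \<int>"
  shows "integrable lborel (\<lambda>t. mb_integrand A B l (Complex c t))"
proof -
  obtain D T where DT: "\<And>s. Re s = c \<Longrightarrow> T \<le> \<bar>Im s\<bar> \<Longrightarrow>
     cmod (mb_integrand A B l s) \<le> D * exp (- (pi - 2 * \<bar>Im l\<bar>) * \<bar>Im s\<bar>)"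
    using mb_integrand_decay[of c c A B l] by auto
  have "mb_integrand A B l holomorphic_on {s. Re s = c}"
  proof (intro holomorphic_mb_integrand)
    fix s assume "s \<in> {s. Re s = c}"
    then have s: "Re s = c" by simp
    show "s \<notin> \<int>"
    proof
      assume "s \<in> \<int>"
      then obtain n where "s = of_int n" by (elim Ints_cases)
      with s have "c = of_int n" by simp
      with assms(2) obtain m where "of_int n - 1 / 2 = real_of_int m" by (elim Ints_cases) auto
      then have "real_of_int (2 * n - 1) = real_of_int (2 * m)" by (simp add: field_simps)
      then have "2 * n - 1 = 2 * m" by (simp only: of_int_eq_iff)
      then show False by presburger
    qed
    show "A - s \<notin> \<int>\<^sub>\<le>\<^sub>0" "B - s \<notin> \<int>\<^sub>\<le>\<^sub>0"
      using assms(3,4) s by (auto elim!: nonpos_Ints_cases dest!: arg_cong[of _ _ Re])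
  qed
  then have "continuous_on {s. Re s = c} (mb_integrand A B l)" by (rule holomorphic_on_imp_continuous_on)
  then have "continuous_on UNIV (\<lambda>t. mb_integrand A B l (Complex c t))"
    by (rule continuous_on_compose2) (auto intro!: continuous_intros)
  then show ?thesis
    by (rule integrable_exp_decay[where \<kappa> = "pi - 2 * \<bar>Im l\<bar>" and T = T and D = D])
       (use assms(1) DT[of "Complex c _"] in auto)
qed

section \<open>Residues of the integrand and the recurrence for the integral\<close>

lemma residue_mb_integrand_nat:
  assumes "A - of_nat n \<notin> \<int>\<^sub>\<le>\<^sub>0" "B - of_nat n \<notin> \<int>\<^sub>\<le>\<^sub>0"
  shows "residue (mb_integrand A B l) (of_nat n) = (-1) ^ n * Gamma (A - of_nat n) * Gamma (B - of_nat n) * exp (2 * of_nat n * l)"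
proof (rule residue_simple')
  \<comment> \<open>An open set that omits every singularity except the one at
    \<open>of_nat n\<close>; the omitted sets are closed because they consist of integers or of
    their preimages under a continuous map.\<close>
  let ?S = "- ((\<int> - {of_nat n}) \<union> (\<lambda>s. A - s) -` \<int>\<^sub>\<le>\<^sub>0 \<union> (\<lambda>s. B - s) -` \<int>\<^sub>\<le>\<^sub>0)"
  show "open ?S"
    by (intro open_Compl closed_Un closed_vimage continuous_intros closed_subset_Ints closed_nonpos_Ints) auto
  show "of_nat n \<in> ?S" using assms by auto
  show "mb_integrand A B l holomorphic_on ?S - {of_nat n}"
    by (intro holomorphic_mb_integrand) auto
  let ?n = "of_nat n :: complex"
  have "((\<lambda>s. sin (of_real pi * s)) has_field_derivative (of_real pi * cos (of_real pi * ?n))) (at ?n)"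
    by (auto intro!: derivative_eq_intros)
  then have "(\<lambda>s. (sin (of_real pi * s) - sin (of_real pi * ?n)) / (s - ?n)) \<midarrow>?n\<rightarrow> of_real pi * cos (of_real pi * ?n)"
    by (simp add: has_field_derivative_iff)
  moreover have "sin (of_real pi * ?n) = 0" by (simp add: sin_pi_eq_0_iff)
  moreover have "cos (of_real pi * ?n) = (-1) ^ n"
    by (metis cos_npi cos_of_real mult.commute of_real_1 of_real_minus of_real_mult of_real_of_nat_eq of_real_power)
  ultimately have 1: "(\<lambda>s. sin (of_real pi * s) / (s - ?n)) \<midarrow>?n\<rightarrow> of_real pi * (-1) ^ n" by simp
  have isC: "(\<lambda>s. of_real pi * Gamma (A - s) * Gamma (B - s) * exp (2 * s * l)) \<midarrow>?n\<rightarrow> 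
     of_real pi * Gamma (A - ?n) * Gamma (B - ?n) * exp (2 * ?n * l)"
    using assms by (intro tendsto_intros) auto
  have "(-1) ^ n * (-1) ^ n = (1 :: complex)" by (simp flip: power_mult_distrib)
  then have sgn: "x / (of_real pi * (-1) ^ n) = (-1) ^ n * (x / of_real pi)" for x :: complex
    by (simp add: field_simps flip: power_add)
  from tendsto_divide[OF isC 1, unfolded sgn]
  have "(\<lambda>s. of_real pi * Gamma (A - s) * Gamma (B - s) * exp (2 * s * l) / (sin (of_real pi * s) / (s - ?n))) \<midarrow>?n\<rightarrow>
     (-1) ^ n * Gamma (A - of_nat n) * Gamma (B - of_nat n) * exp (2 * of_nat n * l)"
    by (simp add: mult_ac)
  then show "(\<lambda>s. mb_integrand A B l s * (s - ?n)) \<midarrow>?n\<rightarrow> (-1) ^ n * Gamma (A - of_nat n) * Gamma (B - of_nat n) * exp (2 * of_nat n * l)"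
    by (simp add: mb_integrand_def mult_ac)
qed

text \<open>The leading minus sign comes from the reversed variable in \<open>Gamma (A - s)\<close>.
  The hypotheses keep the pole from coinciding with one of \<open>1 / sin\<close> or of the other
  Gamma factor, so it is simple.\<close>

lemma residue_mb_integrand_Gamma:
  assumes "A + of_nat k \<notin> \<int>" "B - A - of_nat k \<notin> \<int>\<^sub>\<le>\<^sub>0"
  shows "residue (mb_integrand A B l) (A + of_nat k) = 
     - ((-1) ^ k / fact k) * (of_real pi / sin (of_real pi * (A + of_nat k))) * Gamma (B - A - of_nat k) * exp (2 * (A + of_nat k) * l)"
proof (rule residue_simple')
  let ?x = "A + of_nat k"
  let ?S = "- (\<int> \<union> (\<lambda>s. A - s) -` (\<int>\<^sub>\<le>\<^sub>0 - {- of_nat k}) \<union> (\<lambda>s. B - s) -` \<int>\<^sub>\<le>\<^sub>0)"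
  show "open ?S"
    by (intro open_Compl closed_Un closed_vimage continuous_intros closed_subset_Ints closed_nonpos_Ints closed_Ints)
       (auto elim!: nonpos_Ints_cases)
  show "?x \<in> ?S" using assms by (auto simp: algebra_simps)
  show "mb_integrand A B l holomorphic_on ?S - {?x}"
    by (intro holomorphic_mb_integrand) (auto simp: algebra_simps)
  have "filterlim (\<lambda>s. A - s) (at (- of_nat k)) (at ?x)"
    by (auto simp: filterlim_at eventually_at_filter algebra_simps intro!: tendsto_eq_intros always_eventually)
  from filterlim_compose[OF Gamma_residues this]
  have "(\<lambda>s. Gamma (A - s) * (A - s + of_nat k)) \<midarrow>?x\<rightarrow> (- 1) ^ k / fact k" .
  from tendsto_minus[OF this]
  have 1: "(\<lambda>s. Gamma (A - s) * (s - ?x)) \<midarrow>?x\<rightarrow> - ((- 1) ^ k / fact k)"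
    by (simp add: algebra_simps)
  have "(\<lambda>s. Gamma (A - s) * (s - ?x) * (of_real pi / sin (of_real pi * s)) * Gamma (B - s) * exp (2 * s * l)) \<midarrow>?x\<rightarrow> 
      - ((-1) ^ k / fact k) * (of_real pi / sin (of_real pi * ?x)) * Gamma (B - ?x) * exp (2 * ?x * l)"
    using assms by (intro tendsto_intros 1) (auto simp: sin_pi_eq_0_iff diff_diff_eq[symmetric])
  then show "(\<lambda>s. mb_integrand A B l s * (s - ?x)) \<midarrow>?x\<rightarrow> 
     - ((-1) ^ k / fact k) * (of_real pi / sin (of_real pi * (A + of_nat k))) * Gamma (B - A - of_nat k) * exp (2 * (A + of_nat k) * l)"
    by (simp add: mb_integrand_def mult_ac diff_diff_eq)
qed

lemma mb_integrand_commute: "mb_integrand A B l s = mb_integrand B A l s"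
  by (simp add: mb_integrand_def)

lemma mb_integrand_shift: "mb_integrand A B l (s - 1) = - exp (- 2 * l) * mb_integrand (A + 1) (B + 1) l s"
proof -
  have "sin (of_real pi * (s - 1)) = - sin (of_real pi * s)"
    by (simp add: right_diff_distrib sin_diff)
  moreover have "exp (2 * (s - 1) * l) = exp (- 2 * l) * exp (2 * s * l)"
    by (simp add: algebra_simps flip: exp_add)
  ultimately show ?thesis by (simp add: mb_integrand_def algebra_simps)
qed

text \<open>Between the lines \<open>Re s = -1/2\<close> and \<open>Re s = 1/2\<close> only the pole
  at 0 is crossed, with residue \<open>Gamma A * Gamma B\<close>. On the left line the substitution
  \<open>s - 1\<close> raises both parameters by 1, and the antiperiodicity of the sine supplies the
  sign.\<close>

lemma mb_integral_rec:
  assumes "Re A > 1 / 2" "Re B > 1 / 2" "\<bar>Im l\<bar> < pi / 2"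
  shows "mb_integral A B l + exp (- 2 * l) * mb_integral (A + 1) (B + 1) l = Gamma A * Gamma B"
proof -
  obtain D T where DT: "\<And>s. - 1 / 2 \<le> Re s \<Longrightarrow> Re s \<le> 1 / 2 \<Longrightarrow> T \<le> \<bar>Im s\<bar> \<Longrightarrow>
     cmod (mb_integrand A B l s) \<le> D * exp (- (pi - 2 * \<bar>Im l\<bar>) * \<bar>Im s\<bar>)"
    using mb_integrand_decay[of "-1/2" "1/2" A B l] by auto
  \<comment> \<open>The bound 1/2 keeps the integers 1 and -1 outside the widened strip; the other
    two terms keep out the Gamma poles, which start at \<open>A\<close> and
    \<open>B\<close>.\<close>
  define \<eta> where "\<eta> = min (1/2) (min (Re A - 1/2) (Re B - 1/2))"
  have \<eta>: "\<eta> > 0" "\<eta> \<le> 1 / 2" "\<eta> \<le> Re A - 1 / 2" "\<eta> \<le> Re B - 1 / 2" using assms unfolding \<eta>_def by linarith+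
  have "(LINT t|lborel. mb_integrand A B l (Complex (1/2) t)) - (LINT t|lborel. mb_integrand A B l (Complex (-1/2) t))
      = 2 * pi * (\<Sum>p\<in>{0}. residue (mb_integrand A B l) p)"
  proof (rule strip_residue[where \<eta> = \<eta> and \<kappa> = "pi - 2 * \<bar>Im l\<bar>" and T = T and D = D])
    show "mb_integrand A B l holomorphic_on {s. - 1 / 2 - \<eta> < Re s \<and> Re s < 1 / 2 + \<eta>} - {0}"
    proof (intro holomorphic_mb_integrand)
      fix s assume s: "s \<in> {s. - 1 / 2 - \<eta> < Re s \<and> Re s < 1 / 2 + \<eta>} - {0}"
      show "s \<notin> \<int>"
      proof
        assume "s \<in> \<int>"
        then obtain n where n: "s = of_int n" by (elim Ints_cases)
        with s \<eta> have "\<bar>real_of_int n\<bar> < 1" by auto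
        then have "n = 0" by linarith
        with n s show False by simp
      qed
      show "A - s \<notin> \<int>\<^sub>\<le>\<^sub>0" "B - s \<notin> \<int>\<^sub>\<le>\<^sub>0"
        using s \<eta> by (auto elim!: nonpos_Ints_cases dest!: arg_cong[of _ _ Re])
    qed
    have *: "(-1::real) / 2 - 1 / 2 \<in> \<int>" by simp
    show "integrable lborel (\<lambda>t. mb_integrand A B l (Complex (- 1 / 2) t))"
      by (rule integrable_mb_integrand) (use assms * in auto)
    show "integrable lborel (\<lambda>t. mb_integrand A B l (Complex (1 / 2) t))"
      by (rule integrable_mb_integrand) (use assms in auto)
  qed (use assms \<eta> DT in auto)
  also have "(\<Sum>p\<in>{0}. residue (mb_integrand A B l) p) = Gamma A * Gamma B"
  proof -
    have "A \<notin> \<int>\<^sub>\<le>\<^sub>0" "B \<notin> \<int>\<^sub>\<le>\<^sub>0" using assms by (auto elim!: nonpos_Ints_cases)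
    then show ?thesis using residue_mb_integrand_nat[of A 0 B l] by simp
  qed
  also have "(\<lambda>t. mb_integrand A B l (Complex (-1/2) t)) = (\<lambda>t. - exp (- 2 * l) * mb_integrand (A + 1) (B + 1) l (Complex (1/2) t))"
  proof
    fix t
    have "Complex (-1/2) t = Complex (1/2) t - 1" by (simp add: complex_eq_iff)
    then show "mb_integrand A B l (Complex (-1/2) t) = - exp (- 2 * l) * mb_integrand (A + 1) (B + 1) l (Complex (1/2) t)"
      by (simp only: mb_integrand_shift)
  qed
  finally have "(LINT t|lborel. mb_integrand A B l (Complex (1/2) t)) + exp (- 2 * l) * (LINT t|lborel. mb_integrand (A + 1) (B + 1) l (Complex (1/2) t))
      = 2 * pi * (Gamma A * Gamma B)"
    by simp
  then show ?thesis unfolding mb_integral_def by (simp add: field_simps)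
qed

section \<open>Shifting the line to the right and the residue series\<close>

lemma mb_integrand_add_1:
  assumes "A - s - 1 \<notin> \<int>\<^sub>\<le>\<^sub>0" "B - s - 1 \<notin> \<int>\<^sub>\<le>\<^sub>0"
  shows "mb_integrand A B l (s + 1) = - exp (2 * l) / ((A - s - 1) * (B - s - 1)) * mb_integrand A B l s"
proof -
  have nz: "A - s - 1 \<noteq> 0" "B - s - 1 \<noteq> 0" using assms by auto
  have "Gamma (A - s) = (A - s - 1) * Gamma (A - s - 1)" "Gamma (B - s) = (B - s - 1) * Gamma (B - s - 1)"
    using Gamma_plus1[OF assms(1)] Gamma_plus1[OF assms(2)] by simp_all
  moreover have "sin (of_real pi * (s + 1)) = - sin (of_real pi * s)"
    by (simp add: distrib_left sin_add)
  moreover have "exp (2 * (s + 1) * l) = exp (2 * l) * exp (2 * s * l)"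
    by (simp add: algebra_simps flip: exp_add)
  ultimately show ?thesis using nz
    by (simp add: mb_integrand_def diff_diff_eq)
qed

lemma tendsto_0_if_ratio_tendsto_0:
  fixes x r :: "nat \<Rightarrow> real"
  assumes "\<And>n. x (Suc n) = r n * x n" "r \<longlonglongrightarrow> 0"
  shows "x \<longlonglongrightarrow> 0"
proof -
  have "\<forall>\<^sub>F n in sequentially. \<bar>r n\<bar> < 1 / 2"
    using order_tendstoD(2)[OF tendsto_rabs[OF assms(2)], of "1/2"] by simp
  then obtain N where N: "\<And>n. n \<ge> N \<Longrightarrow> \<bar>r n\<bar> < 1 / 2" by (auto simp: eventually_sequentially)
  have "summable x"
  proof (rule summable_ratio_test[where c = "1/2" and N = N])
    fix n assume "n \<ge> N"
    then show "norm (x (Suc n)) \<le> 1 / 2 * norm (x n)"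
      unfolding assms(1) real_norm_def abs_mult using N[of n] by (intro mult_right_mono) auto
  qed simp
  then show ?thesis by (rule summable_LIMSEQ_zero)
qed

text \<open>A unit shift multiplies the integrand by
  \<open>- exp (2 * l) / ((A - s - 1) * (B - s - 1))\<close>. Estimating the denominator by real
  parts bounds this uniformly in \<open>t\<close> by a ratio of order \<open>1 / K^2\<close>, so the
  integrals are dominated by a rapidly decreasing multiple of the first one. The hypotheses on
  \<open>Re A\<close> and \<open>Re B\<close> keep the Gamma poles off all these lines.\<close>

lemma mb_integrand_line_tendsto_0:
  assumes "\<bar>Im l\<bar> < pi / 2" "Re A - 1 / 2 \<notin> \<int>" "Re B - 1 / 2 \<notin> \<int>"
  shows "(\<lambda>K. LINT t|lborel. mb_integrand A B l (Complex (1 / 2 + real K) t)) \<longlonglongrightarrow> 0"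
proof -
  define r where "r K = exp (2 * Re l) / (\<bar>Re A - 1 / 2 - real (Suc K)\<bar> * \<bar>Re B - 1 / 2 - real (Suc K)\<bar>)" for K
  define x where "x K = (\<Prod>j<K. r j)" for K
  have notint: "X - 1 / 2 - real (Suc K) \<notin> \<int>" if "X - 1 / 2 \<notin> \<int>" for X K
  proof
    assume "X - 1 / 2 - real (Suc K) \<in> \<int>"
    then have "X - 1 / 2 - real (Suc K) + real (Suc K) \<in> \<int>" by (intro Ints_add) auto
    then show False using that by simp
  qed
  have bound: "cmod (mb_integrand A B l (Complex (1 / 2 + real K) t)) \<le> x K * cmod (mb_integrand A B l (Complex (1 / 2) t))" for K t
  proof (induction K)
    case 0
    then show ?case by (simp add: x_def)
  next
    case (Suc K)
    define s where "s = Complex (1 / 2 + real K) t"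
    have s1: "Complex (1 / 2 + real (Suc K)) t = s + 1" by (simp add: s_def complex_eq_iff)
    have re: "Re (A - s - 1) = Re A - 1 / 2 - real (Suc K)" "Re (B - s - 1) = Re B - 1 / 2 - real (Suc K)"
      by (simp_all add: s_def)
    have "A - s - 1 \<notin> \<int>\<^sub>\<le>\<^sub>0" "B - s - 1 \<notin> \<int>\<^sub>\<le>\<^sub>0"
    proof -
      have "Re w \<in> \<int>" if "w \<in> \<int>\<^sub>\<le>\<^sub>0" for w :: complex using that by (auto elim!: nonpos_Ints_cases)
      then show "A - s - 1 \<notin> \<int>\<^sub>\<le>\<^sub>0" "B - s - 1 \<notin> \<int>\<^sub>\<le>\<^sub>0"
        using notint[OF assms(2), of K] notint[OF assms(3), of K] unfolding re[symmetric] by blast+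
    qed
    then have "mb_integrand A B l (s + 1) = - exp (2 * l) / ((A - s - 1) * (B - s - 1)) * mb_integrand A B l s"
      by (rule mb_integrand_add_1)
    then have "cmod (mb_integrand A B l (s + 1)) = exp (2 * Re l) / (cmod (A - s - 1) * cmod (B - s - 1)) * cmod (mb_integrand A B l s)"
      by (simp add: norm_mult norm_divide)
    also have "\<dots> \<le> r K * (x K * cmod (mb_integrand A B l (Complex (1 / 2) t)))"
    proof (intro mult_mono)
      have "\<bar>Re (A - s - 1)\<bar> \<noteq> 0" "\<bar>Re (B - s - 1)\<bar> \<noteq> 0"
        using notint[OF assms(2), of K] notint[OF assms(3), of K] unfolding re by (metis Ints_0 abs_eq_0)+
      moreover from this have "A - s - 1 \<noteq> 0" "B - s - 1 \<noteq> 0" by (metis abs_0 zero_complex.sel(1))+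
      ultimately show "exp (2 * Re l) / (cmod (A - s - 1) * cmod (B - s - 1)) \<le> r K"
        unfolding r_def re[symmetric]
        by (intro divide_left_mono mult_mono abs_Re_le_cmod mult_pos_pos) (simp_all del: minus_complex.sel)
      show "cmod (mb_integrand A B l s) \<le> x K * cmod (mb_integrand A B l (Complex (1 / 2) t))"
        using Suc.IH by (simp add: s_def)
    qed (auto simp: r_def)
    finally show ?case unfolding s1 by (simp add: x_def mult_ac)
  qed
  have "x \<longlonglongrightarrow> 0"
  proof (rule tendsto_0_if_ratio_tendsto_0)
    show "x (Suc n) = r n * x n" for n by (simp add: x_def)
    show "r \<longlonglongrightarrow> 0" unfolding r_def by real_asymp
  qed
  from tendsto_mult_left[OF this, of "LINT t|lborel. cmod (mb_integrand A B l (Complex (1 / 2) t))"]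
  have lim: "(\<lambda>K. x K * (LINT t|lborel. cmod (mb_integrand A B l (Complex (1 / 2) t)))) \<longlonglongrightarrow> 0"
    by (simp add: mult.commute)
  show ?thesis
  proof (rule Lim_null_comparison[OF _ lim], rule always_eventually, rule allI)
    fix K
    have int: "integrable lborel (\<lambda>t. mb_integrand A B l (Complex (1 / 2) t))"
      using assms by (intro integrable_mb_integrand) auto
    have "cmod (LINT t|lborel. mb_integrand A B l (Complex (1 / 2 + real K) t)) \<le> (LINT t|lborel. x K * cmod (mb_integrand A B l (Complex (1 / 2) t)))"
    proof (rule Bochner_Integration.integral_norm_bound_integral)
      show "integrable lborel (\<lambda>t. mb_integrand A B l (Complex (1 / 2 + real K) t))"
      proof (rule integrable_mb_integrand)
        show "1 / 2 + real K - 1 / 2 \<in> \<int>" by simp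
        have "Re X - 1/2 - real K \<notin> \<int>" if "Re X - 1 / 2 \<notin> \<int>" for X
          using that Ints_add[of "Re X - 1/2 - real K" "real K"] by auto
        with assms show "Re A - (1 / 2 + real K) > 0 \<or> Re A - (1 / 2 + real K) \<notin> \<int>"
          "Re B - (1 / 2 + real K) > 0 \<or> Re B - (1 / 2 + real K) \<notin> \<int>"
          by (auto simp: diff_diff_eq)
      qed (use assms in auto)
      show "integrable lborel (\<lambda>t. x K * cmod (mb_integrand A B l (Complex (1 / 2) t)))"
        using int by simp
    qed (use bound in auto)
    then show "cmod (LINT t|lborel. mb_integrand A B l (Complex (1 / 2 + real K) t)) \<le> x K * (LINT t|lborel. cmod (mb_integrand A B l (Complex (1 / 2) t)))"
      by simp
  qed
qed

definition mb_residue_Gamma :: "complex \<Rightarrow> complex \<Rightarrow> complex \<Rightarrow> nat \<Rightarrow> complex" where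
  "mb_residue_Gamma A B l k = - ((-1) ^ k / fact k) * (of_real pi / sin (of_real pi * (A + of_nat k))) *
     Gamma (B - A - of_nat k) * exp (2 * (A + of_nat k) * l)"

definition mb_residue_nat :: "complex \<Rightarrow> complex \<Rightarrow> complex \<Rightarrow> nat \<Rightarrow> complex" where
  "mb_residue_nat A B l n = (-1) ^ n * Gamma (A - of_nat n) * Gamma (B - of_nat n) * exp (2 * of_nat n * l)"

lemma add_nat_notin_Ints_iff: "x + of_nat k \<in> \<int> \<longleftrightarrow> x \<in> (\<int> :: 'a::ring_1 set)" "x - of_nat k \<in> \<int> \<longleftrightarrow> x \<in> \<int>"
proof -
  show "x + of_nat k \<in> \<int> \<longleftrightarrow> x \<in> \<int>"
    using Ints_add[of x "of_nat k"] Ints_diff[of "x + of_nat k" "of_nat k"] by auto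
  show "x - of_nat k \<in> \<int> \<longleftrightarrow> x \<in> \<int>"
    using Ints_diff[of x "of_nat k"] Ints_add[of "x - of_nat k" "of_nat k"] by auto
qed

text \<open>Three families of poles lie between the lines: the integers 1 to \<open>K\<close>, and
  the points \<open>A + k\<close> and \<open>B + k\<close>, of which \<open>m A\<close> and
  \<open>m B\<close> are counted. The non-integrality hypotheses make the families disjoint, all
  poles simple, and the boundary lines free of poles.\<close>

lemma mb_integrand_shift_right:
  fixes A B l :: complex and K :: nat
  assumes l: "\<bar>Im l\<bar> < pi / 2"
    and A: "Re A > 1 / 2" "Re A - 1 / 2 \<notin> \<int>" "A \<notin> \<int>"
    and B: "Re B > 1 / 2" "Re B - 1 / 2 \<notin> \<int>" "B \<notin> \<int>"
    and AB: "A - B \<notin> \<int>" and K: "K > 0"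
  defines "m X \<equiv> nat \<lceil>real K + 1 / 2 - Re X\<rceil>"
  shows "(LINT t|lborel. mb_integrand A B l (Complex (1 / 2 + real K) t)) - (LINT t|lborel. mb_integrand A B l (Complex (1 / 2) t))
     = 2 * pi * ((\<Sum>k<K. mb_residue_nat A B l (Suc k)) + (\<Sum>k<m A. mb_residue_Gamma A B l k) + (\<Sum>k<m B. mb_residue_Gamma B A l k))"
proof -
  have m1: "Re X + real (m X) > 1 / 2 + real K" if "Re X - 1 / 2 \<notin> \<int>" for X
  proof -
    have "real (m X) \<ge> real K + 1 / 2 - Re X" by (simp add: m_def) linarith
    moreover have "real (m X) \<noteq> real K + 1 / 2 - Re X"
    proof
      assume "real (m X) = real K + 1 / 2 - Re X"
      then have "Re X - 1 / 2 = real K - real (m X)" by simp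
      also have "\<dots> \<in> \<int>" by simp
      finally show False using that by simp
    qed
    ultimately show ?thesis by linarith
  qed
  have m2: "Re X + real k < 1 / 2 + real K" if "k < m X" for X k
  proof -
    have "int k < \<lceil>real K + 1 / 2 - Re X\<rceil>" using that by (simp add: m_def)
    then have "real_of_int (int k) < real K + 1 / 2 - Re X" by (simp only: less_ceiling_iff)
    then show ?thesis by simp
  qed
  \<comment> \<open>The distances from the right line to the first Gamma pole beyond it, capped at
    1/2 so that neither 0 nor \<open>K + 1\<close> enters the strip.\<close>
  define \<eta> where "\<eta> = min (1/2) (min (Re A + real (m A) - 1/2 - real K) (Re B + real (m B) - 1/2 - real K))"
  have \<eta>: "\<eta> > 0" "\<eta> \<le> 1 / 2" "1 / 2 + real K + \<eta> \<le> Re A + real (m A)" "1 / 2 + real K + \<eta> \<le> Re B + real (m B)"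
    using m1[OF A(2)] m1[OF B(2)] unfolding \<eta>_def by linarith+
  define P0 where "P0 = (\<lambda>k. of_nat (Suc k) :: complex) ` {..<K}"
  define PA where "PA = (\<lambda>k. A + of_nat k) ` {..<m A}"
  define PB where "PB = (\<lambda>k. B + of_nat k) ` {..<m B}"
  obtain D T where DT: "\<And>s. 1 / 2 \<le> Re s \<Longrightarrow> Re s \<le> 1 / 2 + real K \<Longrightarrow> T \<le> \<bar>Im s\<bar> \<Longrightarrow>
     cmod (mb_integrand A B l s) \<le> D * exp (- (pi - 2 * \<bar>Im l\<bar>) * \<bar>Im s\<bar>)"
    using mb_integrand_decay[of "1/2" "1/2 + real K" A B l] by blast
  have Pint: "s \<notin> \<int>" if "s \<in> PA \<or> s \<in> PB" for s
    using that A(3) B(3) by (auto simp: PA_def PB_def add_nat_notin_Ints_iff)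
  have P0int: "s \<in> \<int>" if "s \<in> P0" for s
    using that by (auto simp: P0_def)
  have PAB: "PA \<inter> PB = {}"
  proof (rule ccontr)
    assume "PA \<inter> PB \<noteq> {}"
    then obtain j k where "A + of_nat j = B + of_nat k" by (auto simp: PA_def PB_def)
    then have "A - B = of_nat k - of_nat j" by (simp add: algebra_simps)
    also have "\<dots> \<in> \<int>" by simp
    finally show False using AB by simp
  qed
  have "(LINT t|lborel. mb_integrand A B l (Complex (1 / 2 + real K) t)) - (LINT t|lborel. mb_integrand A B l (Complex (1 / 2) t))
      = 2 * pi * (\<Sum>p\<in>P0 \<union> PA \<union> PB. residue (mb_integrand A B l) p)"
  proof (rule strip_residue[where \<eta> = \<eta> and \<kappa> = "pi - 2 * \<bar>Im l\<bar>" and T = T and D = D])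
    show "mb_integrand A B l holomorphic_on {s. 1 / 2 - \<eta> < Re s \<and> Re s < 1 / 2 + real K + \<eta>} - (P0 \<union> PA \<union> PB)"
    proof (intro holomorphic_mb_integrand)
      fix s assume s: "s \<in> {s. 1 / 2 - \<eta> < Re s \<and> Re s < 1 / 2 + real K + \<eta>} - (P0 \<union> PA \<union> PB)"
      show "s \<notin> \<int>"
      proof
        assume "s \<in> \<int>"
        then obtain n where n: "s = of_int n" by (elim Ints_cases)
        with s \<eta> have "0 < real_of_int n" "real_of_int n < real_of_int (1 + int K)" by auto
        then have "n > 0" "n < 1 + int K" by linarith+
        then have "n = int (Suc (nat (n - 1)))" "nat (n - 1) < K" by auto
        then have "s = of_nat (Suc (nat (n - 1)))" "nat (n - 1) < K" using n by (metis of_int_of_nat_eq)+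
        then have "s \<in> P0" unfolding P0_def by blast
        with s show False by blast
      qed
      have *: "\<exists>k<m X. s = X + of_nat k" if "X - s \<in> \<int>\<^sub>\<le>\<^sub>0" "1 / 2 + real K + \<eta> \<le> Re X + real (m X)" for X
      proof -
        obtain k where "X - s = - of_nat k" using \<open>X - s \<in> \<int>\<^sub>\<le>\<^sub>0\<close> by (elim nonpos_Ints_cases')
        then have k: "s = X + of_nat k" by (simp add: algebra_simps)
        moreover have "k < m X"
        proof (rule ccontr)
          assume "\<not> k < m X"
          then have "Re s \<ge> Re X + real (m X)" using k by simp
          with that s show False by simp
        qed
        ultimately show ?thesis by blast
      qed
      show "A - s \<notin> \<int>\<^sub>\<le>\<^sub>0" "B - s \<notin> \<int>\<^sub>\<le>\<^sub>0"
        using *[of A] *[of B] s \<eta>(3,4) by (auto simp: PA_def PB_def)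
    qed
    show "integrable lborel (\<lambda>t. mb_integrand A B l (Complex (1 / 2) t))"
      by (rule integrable_mb_integrand) (use assms in auto)
    show "integrable lborel (\<lambda>t. mb_integrand A B l (Complex (1 / 2 + real K) t))"
    proof (rule integrable_mb_integrand)
      show "1 / 2 + real K - 1 / 2 \<in> \<int>" by simp
      have "Re X - (1 / 2 + real K) \<notin> \<int>" if "Re X - 1 / 2 \<notin> \<int>" for X
        using that add_nat_notin_Ints_iff(2)[of "Re X - 1 / 2" K] by (simp add: diff_diff_eq)
      with A B show "Re A - (1 / 2 + real K) > 0 \<or> Re A - (1 / 2 + real K) \<notin> \<int>"
        "Re B - (1 / 2 + real K) > 0 \<or> Re B - (1 / 2 + real K) \<notin> \<int>"
        by auto
    qed (use l in auto)
    fix p assume "p \<in> P0 \<union> PA \<union> PB"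
    then show "1 / 2 < Re p \<and> Re p < 1 / 2 + real K"
      using A(1) B(1) m2 by (auto simp: P0_def PA_def PB_def)
  qed (use l K \<eta> DT in \<open>auto simp: P0_def PA_def PB_def\<close>)
  also have "(\<Sum>p\<in>P0 \<union> PA \<union> PB. residue (mb_integrand A B l) p) = 
     (\<Sum>p\<in>P0. residue (mb_integrand A B l) p) + (\<Sum>p\<in>PA. residue (mb_integrand A B l) p) + (\<Sum>p\<in>PB. residue (mb_integrand A B l) p)"
  proof -
    have "finite P0" "finite PA" "finite PB" by (auto simp: P0_def PA_def PB_def)
    moreover have "P0 \<inter> PA = {}" "(P0 \<union> PA) \<inter> PB = {}" using PAB Pint P0int by blast+
    ultimately show ?thesis by (simp add: sum.union_disjoint)
  qed
  also have "(\<Sum>p\<in>P0. residue (mb_integrand A B l) p) = (\<Sum>k<K. mb_residue_nat A B l (Suc k))"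
    unfolding P0_def
  proof (subst sum.reindex)
    have notin: "X - of_nat (Suc k) \<notin> \<int>\<^sub>\<le>\<^sub>0" if "X \<notin> \<int>" for X :: complex and k
      using that add_nat_notin_Ints_iff(2)[of X "Suc k"] nonpos_Ints_Int by blast
    show "sum (residue (mb_integrand A B l) \<circ> (\<lambda>k. of_nat (Suc k))) {..<K} = (\<Sum>k<K. mb_residue_nat A B l (Suc k))"
      unfolding o_def mb_residue_nat_def
      by (intro sum.cong refl residue_mb_integrand_nat notin A B)
  qed (auto simp: inj_on_def)
  also have "(\<Sum>p\<in>PA. residue (mb_integrand A B l) p) = (\<Sum>k<m A. mb_residue_Gamma A B l k)"
    unfolding PA_def
  proof (subst sum.reindex)
    have "B - A - of_nat k \<notin> \<int>\<^sub>\<le>\<^sub>0" for k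
      using AB add_nat_notin_Ints_iff(2)[of "B - A" k] nonpos_Ints_Int minus_in_Ints_iff[of "A - B"] by force
    then show "sum (residue (mb_integrand A B l) \<circ> (\<lambda>k. A + of_nat k)) {..<m A} = (\<Sum>k<m A. mb_residue_Gamma A B l k)"
      unfolding o_def mb_residue_Gamma_def using A
      by (intro sum.cong refl residue_mb_integrand_Gamma) (auto simp: add_nat_notin_Ints_iff)
  qed (auto simp: inj_on_def)
  also have "(\<Sum>p\<in>PB. residue (mb_integrand A B l) p) = (\<Sum>k<m B. mb_residue_Gamma B A l k)"
    unfolding PB_def
  proof (subst sum.reindex)
    have "A - B - of_nat k \<notin> \<int>\<^sub>\<le>\<^sub>0" for k
      using AB add_nat_notin_Ints_iff(2)[of "A - B" k] nonpos_Ints_Int by force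
    moreover have "mb_integrand A B l = mb_integrand B A l" by (rule ext) (rule mb_integrand_commute)
    ultimately show "sum (residue (mb_integrand A B l) \<circ> (\<lambda>k. B + of_nat k)) {..<m B} = (\<Sum>k<m B. mb_residue_Gamma B A l k)"
      unfolding o_def mb_residue_Gamma_def using B
      by (simp only:, intro sum.cong refl residue_mb_integrand_Gamma) (auto simp: add_nat_notin_Ints_iff)
  qed (auto simp: inj_on_def)
  finally show ?thesis .
qed

text \<open>As \<open>K\<close> grows the right line contributes nothing in the limit, and the pole
  counts tend to infinity, so the finite sums pass to the full series. The minus sign reflects
  closing the contour to the right.\<close>

lemma mb_integral_eq_series:
  fixes A B l :: complex
  assumes l: "\<bar>Im l\<bar> < pi / 2"
    and A: "Re A > 1 / 2" "Re A - 1 / 2 \<notin> \<int>" "A \<notin> \<int>"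
    and B: "Re B > 1 / 2" "Re B - 1 / 2 \<notin> \<int>" "B \<notin> \<int>"
    and AB: "A - B \<notin> \<int>"
    and sums: "(\<lambda>n. mb_residue_nat A B l (Suc n)) sums S0" "mb_residue_Gamma A B l sums SA" "mb_residue_Gamma B A l sums SB"
  shows "mb_integral A B l = - (S0 + SA + SB)"
proof -
  define m where "m X K = nat \<lceil>real K + 1 / 2 - Re X\<rceil>" for X :: complex and K
  have m: "filterlim (m X) sequentially sequentially" for X
    unfolding filterlim_sequentially_iff_filterlim_real
  proof (rule filterlim_at_top_mono)
    show "filterlim (\<lambda>K. real K + (1 / 2 - Re X)) at_top sequentially" by real_asymp
    show "\<forall>\<^sub>F K in sequentially. real K + (1 / 2 - Re X) \<le> real (m X K)"
      unfolding m_def by (intro always_eventually allI) linarith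
  qed
  have lim1: "(\<lambda>K. 2 * pi * ((\<Sum>k<K. mb_residue_nat A B l (Suc k)) + (\<Sum>k<m A K. mb_residue_Gamma A B l k) + (\<Sum>k<m B K. mb_residue_Gamma B A l k)))
      \<longlonglongrightarrow> 2 * pi * (S0 + SA + SB)"
    using sums filterlim_compose[OF sums(2)[unfolded sums_def] m[of A]] filterlim_compose[OF sums(3)[unfolded sums_def] m[of B]]
    unfolding sums_def by (intro tendsto_intros)
  have lim2: "(\<lambda>K. (LINT t|lborel. mb_integrand A B l (Complex (1 / 2 + real K) t)) - (LINT t|lborel. mb_integrand A B l (Complex (1 / 2) t)))
     \<longlonglongrightarrow> 0 - (LINT t|lborel. mb_integrand A B l (Complex (1 / 2) t))"
    by (intro tendsto_intros mb_integrand_line_tendsto_0 l A B)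
  have ev: "\<forall>\<^sub>F K in sequentially. (LINT t|lborel. mb_integrand A B l (Complex (1 / 2 + real K) t)) - (LINT t|lborel. mb_integrand A B l (Complex (1 / 2) t))
     = 2 * pi * ((\<Sum>k<K. mb_residue_nat A B l (Suc k)) + (\<Sum>k<m A K. mb_residue_Gamma A B l k) + (\<Sum>k<m B K. mb_residue_Gamma B A l k))"
    using eventually_gt_at_top[of 0]
    by eventually_elim (unfold m_def, rule mb_integrand_shift_right[OF l A B AB])
  have "0 - (LINT t|lborel. mb_integrand A B l (Complex (1 / 2) t)) = 2 * pi * (S0 + SA + SB)"
    by (rule LIMSEQ_unique[OF Lim_transform_eventually[OF lim2 ev] lim1])
  then have "(LINT t|lborel. mb_integrand A B l (Complex (1 / 2) t)) = - (2 * pi * (S0 + SA + SB))"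
    by (simp only: diff_0 minus_equation_iff[of _ "2 * pi * (S0 + SA + SB)"])
  then show ?thesis unfolding mb_integral_def by simp
qed

section \<open>Identification with the Lommel function\<close>

lemma minus_one_power_mult_self: "(-1) ^ n * (-1) ^ n = (1 :: 'a::comm_ring_1)"
  by (simp flip: power_mult_distrib)

lemma sin_pi_add_nat: "sin (of_real pi * (x + of_nat n)) = (-1) ^ n * sin (of_real pi * (x::complex))"
proof (induction n)
  case (Suc n)
  have "of_real pi * (x + of_nat (Suc n)) = of_real pi * (x + of_nat n) + of_real pi"
    by (simp add: algebra_simps)
  then show ?case using Suc by (simp add: sin_add del: of_nat_Suc)
qed simp

lemma rGamma_eq_sin_Gamma:
  fixes a :: complex
  assumes "a \<notin> \<int>"
  shows "rGamma a = sin (of_real pi * a) / of_real pi * Gamma (1 - a)"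
proof -
  have "1 - a \<notin> \<int>" using assms Ints_diff[of 1 "1 - a"] by auto
  then have "Gamma (1 - a) \<noteq> 0" using nonpos_Ints_Int by (auto simp: Gamma_eq_zero_iff)
  then have "rGamma (1 - a) * Gamma (1 - a) = 1" by (simp add: rGamma_inverse_Gamma)
  then have "rGamma a = (rGamma a * rGamma (1 - a)) * Gamma (1 - a)" by (simp add: mult.assoc)
  then show ?thesis unfolding rGamma_reflection_complex .
qed

text \<open>Reflection turns the decreasing arguments that occur in the residues into the increasing
  \<open>rGamma\<close> arguments of the Bessel series.\<close>

lemma Gamma_diff_nat:
  fixes \<nu> :: complex
  assumes "\<nu> \<notin> \<int>"
  shows "Gamma (\<nu> - of_nat k) = (-1) ^ k * of_real pi / sin (of_real pi * \<nu>) * rGamma (- \<nu> + of_nat k + 1)"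
proof -
  have "\<nu> - of_nat k \<notin> \<int>" using assms add_nat_notin_Ints_iff(2) by blast
  then have 1: "rGamma (\<nu> - of_nat k) \<noteq> 0" using nonpos_Ints_Int by (auto simp: rGamma_eq_zero_iff)
  have s0: "sin (of_real pi * \<nu>) \<noteq> 0" using assms by (simp add: sin_pi_eq_0_iff)
  have "sin (of_real pi * \<nu>) = (-1) ^ k * sin (of_real pi * (\<nu> - of_nat k))"
    using sin_pi_add_nat[of "\<nu> - of_nat k" k] by simp
  then have s: "sin (of_real pi * (\<nu> - of_nat k)) = (-1) ^ k * sin (of_real pi * \<nu>)"
    using minus_one_power_mult_self[of k, where ?'a = complex] by (simp flip: mult.assoc)
  have "rGamma (\<nu> - of_nat k) * rGamma (- \<nu> + of_nat k + 1) = (-1) ^ k * sin (of_real pi * \<nu>) / of_real pi"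
    using rGamma_reflection_complex[of "\<nu> - of_nat k"] unfolding s by (simp add: algebra_simps)
  then have "rGamma (- \<nu> + of_nat k + 1) = (-1) ^ k * sin (of_real pi * \<nu>) / of_real pi * Gamma (\<nu> - of_nat k)"
    using 1 by (simp add: Gamma_def field_simps)
  then show ?thesis using s0 minus_one_power_mult_self[of k, where ?'a = complex]
    by (simp flip: mult.assoc)
qed

lemma exp_nat_mult_Ln:
  assumes "z \<noteq> 0"
  shows "exp (2 * of_nat n * Ln (z / 2)) = (z / 2) ^ (2 * n)"
proof -
  have "exp (of_nat (2 * n) * Ln (z / 2)) = exp (Ln (z / 2)) ^ (2 * n)" by (rule exp_of_nat_mult)
  then show ?thesis using assms by simp
qed

lemma Ln_half: "z \<noteq> 0 \<Longrightarrow> Ln (z / 2) = Ln z - of_real (ln 2)"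
  using Ln_times_of_real[of 2 "z / 2"] Ln_of_real[of 2] by simp

text \<open>The dependence on \<open>N\<close> cancels: the sign against the shifted sine, the power
  of \<open>2 / z\<close> against the exponential. Reflection writes \<open>rGamma a\<close> and
  \<open>rGamma b\<close> with sines; that of \<open>a\<close> cancels against the sine in the
  residue, and that of \<open>b\<close> survives over the sine from
  \<open>Gamma (\<nu> - k)\<close>.\<close>

lemma mb_residue_Gamma_bessel:
  fixes a b \<mu> \<nu> z :: complex
  assumes nz: "a \<notin> \<int>" "b \<notin> \<int>" "\<nu> \<notin> \<int>" "z \<noteq> 0" and ab: "b - a = \<nu>" "a + b = 1 - \<mu>"
  shows "z powr (\<mu> - 1) * rGamma a * rGamma b * (-1) ^ N * (2 / z) ^ (2 * N) * 
       mb_residue_Gamma (a + of_nat N) (b + of_nat N) (Ln (z / 2)) k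
     = - (2 powr (\<mu> - 1) * Gamma (1 - a) * Gamma (1 - b) * (sin (of_real pi * b) / sin (of_real pi * \<nu>))) *
       ((z / 2) powr (- \<nu>) * ((- (z ^ 2) / 4) ^ k * rGamma (- \<nu> + of_nat k + 1) / fact k))"
proof -
  define l where "l = Ln (z / 2)"
  define G where "G = rGamma (- \<nu> + of_nat k + 1)"
  define sa where "sa = sin (of_real pi * a)"
  define sb where "sb = sin (of_real pi * b)"
  define s\<nu> where "s\<nu> = sin (of_real pi * \<nu>)"
  have n0: "sa \<noteq> 0" "s\<nu> \<noteq> 0" using nz by (auto simp: sa_def s\<nu>_def sin_pi_eq_0_iff)
  have s1: "of_real pi / sin (of_real pi * (a + of_nat N + of_nat k)) = (-1) ^ N * (-1) ^ k * (of_real pi / sa)"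
  proof -
    have "sin (of_real pi * (a + of_nat N + of_nat k)) = (-1) ^ k * ((-1) ^ N * sa)"
      unfolding sin_pi_add_nat sa_def ..
    moreover have "x / ((-1) ^ k * ((-1) ^ N * sa)) = (-1) ^ N * (-1) ^ k * (x / sa)" for x
      by (cases "even N"; cases "even k") auto
    ultimately show ?thesis by simp
  qed
  have s2: "Gamma (b + of_nat N - (a + of_nat N) - of_nat k) = (-1) ^ k * (of_real pi / s\<nu>) * G"
    using Gamma_diff_nat[OF nz(3), of k] ab(1) by (simp add: G_def s\<nu>_def)
  have s3: "exp (2 * (a + of_nat N + of_nat k) * l) = exp (2 * a * l) * (z / 2) ^ (2 * N) * (z / 2) ^ (2 * k)"
    using exp_nat_mult_Ln[OF nz(4), of N] exp_nat_mult_Ln[OF nz(4), of k]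
    by (simp add: l_def exp_add ring_distribs)
  have s4: "z powr (\<mu> - 1) * exp (2 * a * l) = 2 powr (\<mu> - 1) * (z / 2) powr (- \<nu>)"
  proof -
    have a2: "2 * a = 1 - \<mu> - \<nu>" using ab by (simp add: algebra_simps)
    have "Ln (2 :: complex) = of_real (ln 2)" using Ln_of_real[of 2] by simp
    then show ?thesis using nz(4)
      unfolding a2 l_def by (simp add: powr_def Ln_half exp_add[symmetric] algebra_simps)
  qed
  have s5: "rGamma a = sa / of_real pi * Gamma (1 - a)" "rGamma b = sb / of_real pi * Gamma (1 - b)"
    using nz by (auto simp: sa_def sb_def rGamma_eq_sin_Gamma)
  have s6: "(- (z ^ 2) / 4) ^ k = (-1) ^ k * (z / 2) ^ (2 * k)"
  proof -
    have "- (z ^ 2) / 4 = (-1) * (z / 2) ^ 2" by (simp add: power_divide)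
    then show ?thesis by (simp only: power_mult_distrib power_mult)
  qed
  have s7: "(2 / z) ^ (2 * N) * (z / 2) ^ (2 * N) = 1"
    using nz by (simp flip: power_mult_distrib)
  have "z powr (\<mu> - 1) * rGamma a * rGamma b * (-1) ^ N * (2 / z) ^ (2 * N) * mb_residue_Gamma (a + of_nat N) (b + of_nat N) l k
     = - ((z powr (\<mu> - 1) * exp (2 * a * l)) * ((2 / z) ^ (2 * N) * (z / 2) ^ (2 * N)) * ((-1) ^ N * (-1) ^ N) * ((-1) ^ k * (-1) ^ k)
         * ((sa / of_real pi) * (of_real pi / sa)) * (sb / of_real pi * (of_real pi / s\<nu>)) *
          Gamma (1 - a) * Gamma (1 - b) * ((-1) ^ k * (z / 2) ^ (2 * k) * G / fact k))"
    unfolding mb_residue_Gamma_def s1 s2 s3 s5 by (simp only: divide_inverse mult_ac mult_minus_left mult_minus_right)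
  also have "\<dots> = - ((2 powr (\<mu> - 1) * (z / 2) powr (- \<nu>)) * (sb / s\<nu>) * Gamma (1 - a) * Gamma (1 - b) * ((- (z ^ 2) / 4) ^ k * G / fact k))"
    unfolding s4 s7 s6 minus_one_power_mult_self using n0 by simp
  finally show ?thesis by (simp add: l_def sb_def s\<nu>_def G_def mult_ac)
qed

lemma summable_bessel_series:
  fixes \<nu> w :: complex
  shows "summable (\<lambda>k. w ^ k * rGamma (\<nu> + of_nat k + 1) / fact k)"
proof (rule summable_ratio_test)
  show "(1/2 :: real) < 1" by simp
  fix k assume k: "k \<ge> nat \<lceil>cmod \<nu> + 2 * cmod w\<rceil>"
  let ?t = "\<lambda>k. w ^ k * rGamma (\<nu> + of_nat k + 1) / fact k"
  have k': "real k \<ge> cmod \<nu>" "real k \<ge> 2 * cmod w" using k by (auto simp: nat_le_iff ceiling_le_iff) (smt (verit) norm_ge_zero)+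
  have "rGamma (\<nu> + of_nat k + 1) = (\<nu> + of_nat k + 1) * rGamma (\<nu> + of_nat (Suc k) + 1)"
    using rGamma_plus1[of "\<nu> + of_nat k + 1"] by (simp add: add_ac)
  moreover have "fact (Suc k) = (of_nat k + 1) * (fact k :: complex)" by (simp add: add_ac)
  moreover have "w * (y * (c * g) / f) = c * n * (w * y * g / (n * f))" if "n \<noteq> 0" "f \<noteq> 0" for y c g f n :: complex
    using that by simp
  moreover have "of_nat k + 1 \<noteq> (0 :: complex)" by (metis of_nat_Suc of_nat_neq_0 add.commute)
  ultimately have eq: "w * ?t k = (\<nu> + of_nat k + 1) * (of_nat k + 1) * ?t (Suc k)"
    by (simp only: power_Suc) simp
  have "real k + 1 - cmod \<nu> \<le> cmod (\<nu> + of_nat k + 1)"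
    using norm_triangle_ineq2[of "of_nat k + 1" "- \<nu>"] norm_of_nat[of "Suc k", where ?'a = complex] by (simp add: add_ac)
  then have "1 \<le> cmod (\<nu> + of_nat k + 1)" using k' by linarith
  moreover have "cmod (of_nat k + 1) = real k + 1" using norm_of_nat[of "Suc k", where ?'a = complex] by (simp add: add_ac)
  ultimately have "1 * (real k + 1) * cmod (?t (Suc k)) \<le> cmod ((\<nu> + of_nat k + 1) * (of_nat k + 1) * ?t (Suc k))"
    unfolding norm_mult[of "_ * _" "?t (Suc k)"] norm_mult[of "\<nu> + of_nat k + 1"]
    by (intro mult_right_mono) auto
  also have "\<dots> = cmod w * cmod (?t k)" unfolding eq[symmetric] norm_mult ..
  also have "\<dots> \<le> (real k + 1) / 2 * cmod (?t k)" using k' by (intro mult_right_mono) auto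
  finally have "(real k + 1) * cmod (?t (Suc k)) \<le> (real k + 1) * (1 / 2 * cmod (?t k))"
    by (simp only: mult_1 times_divide_eq_left times_divide_eq_right)
  then show "norm (?t (Suc k)) \<le> 1 / 2 * norm (?t k)"
    by (rule mult_left_le_imp_le) simp
qed

lemma mb_residue_Gamma_bessel_sums:
  fixes a b \<mu> \<nu> z :: complex
  assumes nz: "a \<notin> \<int>" "b \<notin> \<int>" "\<nu> \<notin> \<int>" "z \<noteq> 0" and ab: "b - a = \<nu>" "a + b = 1 - \<mu>"
  shows "(\<lambda>k. z powr (\<mu> - 1) * rGamma a * rGamma b * (-1) ^ N * (2 / z) ^ (2 * N) * 
       mb_residue_Gamma (a + of_nat N) (b + of_nat N) (Ln (z / 2)) k) sums
     (- (2 powr (\<mu> - 1) * Gamma (1 - a) * Gamma (1 - b) * (sin (of_real pi * b) / sin (of_real pi * \<nu>))) * bessel_J (- \<nu>) z)"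
  unfolding mb_residue_Gamma_bessel[OF assms] bessel_J_def
  by (intro sums_mult summable_sums summable_bessel_series)

section \<open>Lommel coefficients and the power series of \<open>lommel_s\<close>\<close>

lemma lommel_a_Suc: "lommel_a (Suc n) \<mu> \<nu> = lommel_a n \<mu> \<nu> * ((\<mu> + of_nat (2 * Suc n) - 1)^2 - \<nu>^2)"
  by (simp add: lommel_a_def)

lemma lommel_a_0 [simp]: "lommel_a 0 \<mu> \<nu> = 1"
  by (simp add: lommel_a_def)

lemma lommel_a_eq_pochhammer:
  "lommel_a n (- \<mu>) \<nu> = 4 ^ n * pochhammer ((1 - \<mu> - \<nu>) / 2) n * pochhammer ((1 - \<mu> + \<nu>) / 2) n"
proof (induction n)
  case (Suc n)
  have "(- \<mu> + of_nat (2 * Suc n) - 1)^2 - \<nu>^2 = 4 * ((1 - \<mu> - \<nu>) / 2 + of_nat n) * ((1 - \<mu> + \<nu>) / 2 + of_nat n)"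
    by (simp add: field_simps power2_eq_square)
  then show ?case by (simp add: lommel_a_Suc Suc pochhammer_Suc mult_ac)
qed simp

lemma rGamma_mult_Gamma_add:
  fixes a :: complex
  assumes "a + of_nat n \<notin> \<int>\<^sub>\<le>\<^sub>0"
  shows "rGamma a * Gamma (a + of_nat n) = pochhammer a n"
proof -
  have "rGamma (a + of_nat n) * Gamma (a + of_nat n) = 1"
    using assms by (simp add: rGamma_inverse_Gamma Gamma_eq_zero_iff)
  then show ?thesis using pochhammer_rGamma[of a n] by (simp add: mult.assoc)
qed

text \<open>The Gamma form
  \<open>4 ^ n * Gamma (a + n) * Gamma (b + n) / (Gamma a * Gamma b)\<close> of
  \<open>lommel_a n (- \<mu>) \<nu>\<close>, continued to index \<open>- n\<close>, is the
  reciprocal of \<open>lommel_a n \<mu> \<nu>\<close>. This is why one residue formula yields both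
  the asymptotic terms and the denominators of \<open>lommel_s\<close>.\<close>

lemma lommel_a_mult_Gamma:
  assumes "(1 - \<mu> - \<nu>) / 2 \<notin> \<int>" "(1 - \<mu> + \<nu>) / 2 \<notin> \<int>"
  shows "lommel_a n \<mu> \<nu> * (Gamma ((1 - \<mu> - \<nu>) / 2 - of_nat n) * Gamma ((1 - \<mu> + \<nu>) / 2 - of_nat n))
     = 4 ^ n * (Gamma ((1 - \<mu> - \<nu>) / 2) * Gamma ((1 - \<mu> + \<nu>) / 2))"
proof (induction n)
  case (Suc n)
  define a b where "a = (1 - \<mu> - \<nu>) / 2" and "b = (1 - \<mu> + \<nu>) / 2"
  have "Gamma (x - of_nat n) = (x - of_nat (Suc n)) * Gamma (x - of_nat (Suc n))" if "x \<notin> \<int>" for x :: complex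
  proof -
    have "x - of_nat (Suc n) \<notin> \<int>\<^sub>\<le>\<^sub>0" using that add_nat_notin_Ints_iff(2)[of x "Suc n"] nonpos_Ints_Int by blast
    from Gamma_plus1[OF this] show ?thesis by (simp add: algebra_simps)
  qed
  then have G: "Gamma (a - of_nat n) = (a - of_nat (Suc n)) * Gamma (a - of_nat (Suc n))"
    "Gamma (b - of_nat n) = (b - of_nat (Suc n)) * Gamma (b - of_nat (Suc n))"
    using assms by (auto simp: a_def b_def)
  have "(\<mu> + of_nat (2 * Suc n) - 1)^2 - \<nu>^2 = 4 * (a - of_nat (Suc n)) * (b - of_nat (Suc n))"
    by (simp add: field_simps power2_eq_square a_def b_def)
  then have "lommel_a (Suc n) \<mu> \<nu> * (Gamma (a - of_nat (Suc n)) * Gamma (b - of_nat (Suc n)))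
    = 4 * (lommel_a n \<mu> \<nu> * (Gamma (a - of_nat n) * Gamma (b - of_nat n)))"
    unfolding lommel_a_Suc G by (simp only: mult_ac)
  then show ?case unfolding a_def b_def Suc.IH by simp
qed simp

definition lommel_s_term :: "complex \<Rightarrow> complex \<Rightarrow> complex \<Rightarrow> nat \<Rightarrow> complex" where
  "lommel_s_term \<mu> \<nu> z k = (-1)^k * z^(2*k) / lommel_a (Suc k) \<mu> \<nu>"

text \<open>The threshold depends on \<mu> only through the bound \<open>R\<close>; this uniformity
  provides the majorant needed when \<mu> varies.\<close>

lemma lommel_s_term_ratio:
  "\<exists>J. \<forall>\<mu>. cmod \<mu> \<le> R \<longrightarrow> (\<forall>k\<ge>J. cmod (lommel_s_term \<mu> \<nu> z (Suc k)) \<le> 1 / 2 * cmod (lommel_s_term \<mu> \<nu> z k))"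
proof (intro exI allI impI)
  fix \<mu> k assume R: "cmod \<mu> \<le> R" and k: "k \<ge> nat \<lceil>R + cmod \<nu> + 1 + 2 * cmod z\<rceil>"
  define d where "d = (\<mu> + of_nat (2 * Suc (Suc k)) - 1)^2 - \<nu>^2"
  define w where "w = \<mu> + of_nat (2 * k + 3)"
  have d: "d = (w - \<nu>) * (w + \<nu>)" by (simp add: d_def w_def algebra_simps power2_eq_square)
  have k': "real k \<ge> R + cmod \<nu> + 1 + 2 * cmod z" using k by linarith
  have ge: "cmod (w + y) \<ge> 1 + 2 * cmod z" if "cmod y = cmod \<nu>" for y
  proof -
    have "w + y = of_nat (2 * k + 3) - - (\<mu> + y)" by (simp add: w_def)
    then have "cmod (of_nat (2 * k + 3)) - cmod (- (\<mu> + y)) \<le> cmod (w + y)"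
      by (simp only: norm_triangle_ineq2)
    moreover have "cmod (- (\<mu> + y)) \<le> R + cmod \<nu>" using norm_triangle_ineq[of \<mu> y] R that unfolding norm_minus_cancel by linarith
    ultimately show ?thesis using k' unfolding norm_of_nat by simp
  qed
  have "(1 + 2 * cmod z) * (1 + 2 * cmod z) \<le> cmod d"
    using ge[of \<nu>] ge[of "- \<nu>"] unfolding d norm_mult by (intro mult_mono) auto
  moreover have "2 * cmod z ^ 2 \<le> (1 + 2 * cmod z) * (1 + 2 * cmod z)" "(1 + 2 * cmod z) * (1 + 2 * cmod z) \<ge> 1 * 1"
    by (auto simp: algebra_simps power2_eq_square)
  ultimately have dge: "2 * cmod z ^ 2 \<le> cmod d" "cmod d > 0" by linarith+
  have "lommel_s_term \<mu> \<nu> z (Suc k) = - (z^2 / d) * lommel_s_term \<mu> \<nu> z k"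
    unfolding lommel_s_term_def lommel_a_Suc[of "Suc k"] d_def[symmetric] by (simp add: power2_eq_square mult_ac)
  then have "cmod (lommel_s_term \<mu> \<nu> z (Suc k)) = (cmod z ^ 2 / cmod d) * cmod (lommel_s_term \<mu> \<nu> z k)"
    by (simp add: norm_mult norm_divide norm_power)
  also have "\<dots> \<le> 1 / 2 * cmod (lommel_s_term \<mu> \<nu> z k)"
    using dge by (intro mult_right_mono) (auto simp: field_simps)
  finally show "cmod (lommel_s_term \<mu> \<nu> z (Suc k)) \<le> 1 / 2 * cmod (lommel_s_term \<mu> \<nu> z k)" .
qed

lemma lommel_s_sums:
  "(\<lambda>k. z powr (\<mu> + 1) * lommel_s_term \<mu> \<nu> z k) sums lommel_s \<mu> \<nu> z"
proof -
  obtain J where "\<And>k. k \<ge> J \<Longrightarrow> cmod (lommel_s_term \<mu> \<nu> z (Suc k)) \<le> 1 / 2 * cmod (lommel_s_term \<mu> \<nu> z k)"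
    using lommel_s_term_ratio[of "cmod \<mu>" \<nu> z] by blast
  then have "summable (lommel_s_term \<mu> \<nu> z)" by (intro summable_ratio_test[of "1/2"]) auto
  then show ?thesis unfolding lommel_s_def lommel_s_term_def[symmetric]
    by (intro sums_mult summable_sums) (simp add: lommel_s_term_def[abs_def])
qed

lemma tendsto_lommel_s:
  assumes \<mu>: "X \<longlonglongrightarrow> \<mu>" and nz: "\<And>k. lommel_a (Suc k) \<mu> \<nu> \<noteq> 0" and "z \<noteq> 0"
  shows "(\<lambda>n. lommel_s (X n) \<nu> z) \<longlonglongrightarrow> lommel_s \<mu> \<nu> z"
proof -
  obtain J where J: "\<And>\<mu>' k. cmod \<mu>' \<le> cmod \<mu> + 1 \<Longrightarrow> k \<ge> J \<Longrightarrow> 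
     cmod (lommel_s_term \<mu>' \<nu> z (Suc k)) \<le> 1 / 2 * cmod (lommel_s_term \<mu>' \<nu> z k)"
    using lommel_s_term_ratio[of "cmod \<mu> + 1" \<nu> z] by blast
  have lim: "(\<lambda>n. lommel_s_term (X n) \<nu> z k) \<longlonglongrightarrow> lommel_s_term \<mu> \<nu> z k" for k
    unfolding lommel_s_term_def using nz[of k] \<mu> unfolding lommel_a_def
    by (intro tendsto_intros) auto
  \<comment> \<open>A geometric majorant anchored at index \<open>J\<close>: there the nearby series
    have terms at most 1 above the limiting one, and from there on they halve at each step. Below
    \<open>J\<close> no bound is claimed; Tannery's theorem only needs it eventually.\<close>
  define M where "M k = (cmod (lommel_s_term \<mu> \<nu> z J) + 1) * 2 ^ J * (1 / 2) ^ k" for k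
  have ev: "\<forall>\<^sub>F n in sequentially. cmod (X n) \<le> cmod \<mu> + 1 \<and> cmod (lommel_s_term (X n) \<nu> z J) \<le> cmod (lommel_s_term \<mu> \<nu> z J) + 1"
    using order_tendstoD(2)[OF tendsto_norm[OF \<mu>], of "cmod \<mu> + 1"]
      order_tendstoD(2)[OF tendsto_norm[OF lim[of J]], of "cmod (lommel_s_term \<mu> \<nu> z J) + 1"]
    by (auto elim: eventually_elim2)
  have bound: "cmod (lommel_s_term \<mu>' \<nu> z k) \<le> M k"
    if "cmod \<mu>' \<le> cmod \<mu> + 1 \<and> cmod (lommel_s_term \<mu>' \<nu> z J) \<le> cmod (lommel_s_term \<mu> \<nu> z J) + 1" "k \<ge> J" for \<mu>' k
    using that(2)
  proof (induction rule: dec_induct)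
    case base
    have "(2::real) ^ J * (1 / 2) ^ J = 1" by (simp flip: power_mult_distrib)
    then have "M J = cmod (lommel_s_term \<mu> \<nu> z J) + 1" by (simp add: M_def mult.assoc)
    then show ?case using that by simp
  next
    case (step k)
    then show ?case using J[of \<mu>' k] that by (simp add: M_def)
  qed
  have "(\<lambda>n. suminf (\<lambda>k. lommel_s_term (X n) \<nu> z k)) \<longlonglongrightarrow> suminf (lommel_s_term \<mu> \<nu> z)"
  proof (rule conjunct2[OF conjunct2[OF tannerys_theorem[where M = M, OF lim]]])
    show "\<forall>\<^sub>F (k, n) in sequentially \<times>\<^sub>F sequentially. cmod (lommel_s_term (X n) \<nu> z k) \<le> M k"
      unfolding case_prod_unfold
    proof (rule eventually_mono[OF eventually_prodI[OF eventually_ge_at_top[of J] ev]])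
      fix x :: "nat \<times> nat"
      assume "J \<le> fst x \<and> cmod (X (snd x)) \<le> cmod \<mu> + 1 \<and> cmod (lommel_s_term (X (snd x)) \<nu> z J) \<le> cmod (lommel_s_term \<mu> \<nu> z J) + 1"
      then show "cmod (lommel_s_term (X (snd x)) \<nu> z (fst x)) \<le> M (fst x)" using bound by blast
    qed
    show "summable M" unfolding M_def by (intro summable_mult summable_geometric) simp
  qed simp
  moreover have "(\<lambda>n. z powr (X n + 1)) \<longlonglongrightarrow> z powr (\<mu> + 1)"
    using \<open>z \<noteq> 0\<close> by (simp add: powr_def) (intro tendsto_intros \<mu>)
  ultimately show ?thesis unfolding lommel_s_def lommel_s_term_def by (intro tendsto_mult)
qed

text \<open>The Mellin-Barnes form of the remainder. Writing the prefactor with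
  \<open>rGamma\<close> keeps it continuous in the parameters even where \<open>1 / Gamma\<close>
  has its zeros.\<close>

definition lommel_rem :: "nat \<Rightarrow> complex \<Rightarrow> complex \<Rightarrow> complex \<Rightarrow> complex" where
  "lommel_rem N \<mu> \<nu> z = z powr (\<mu> - 1) * rGamma ((1 - \<mu> - \<nu>) / 2) * rGamma ((1 - \<mu> + \<nu>) / 2) *
     (-1) ^ N * (2 / z) ^ (2 * N) * 
     mb_integral ((1 - \<mu> - \<nu>) / 2 + of_nat N) ((1 - \<mu> + \<nu>) / 2 + of_nat N) (Ln (z / 2))"

definition lommel_psum :: "nat \<Rightarrow> complex \<Rightarrow> complex \<Rightarrow> complex \<Rightarrow> complex" where
  "lommel_psum N \<mu> \<nu> z = z powr (\<mu> - 1) * (\<Sum>n<N. (-1)^n * lommel_a n (-\<mu>) \<nu> / z^(2*n))"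

text \<open>Eliminates the second-kind function in favour of the orders \<open>\<nu>\<close> and
  \<open>- \<nu>\<close>, the two that the Gamma poles produce. With \<open>x\<close> and
  \<open>y\<close> as in the proof, \<open>sin(\<pi> b) = cos x\<close> and
  \<open>sin(\<pi> a) = cos(x + y)\<close>.\<close>

lemma lommel_S_gen_eq_bessel:
  fixes \<mu> \<nu> :: complex
  assumes "\<nu> \<notin> \<int>"
  defines "a \<equiv> (1 - \<mu> - \<nu>) / 2" and "b \<equiv> (1 - \<mu> + \<nu>) / 2"
  defines "c \<equiv> 2 powr (\<mu> - 1) * Gamma (1 - a) * Gamma (1 - b)"
  shows "lommel_S_gen \<mu> \<nu> z = lommel_s \<mu> \<nu> z + c * (sin (of_real pi * b) / sin (of_real pi * \<nu>)) * bessel_J (- \<nu>) z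
     - c * (sin (of_real pi * a) / sin (of_real pi * \<nu>)) * bessel_J \<nu> z"
proof -
  define x where "x = (\<mu> - \<nu>) * of_real pi / 2"
  define y where "y = \<nu> * of_real pi"
  have sb: "sin (of_real pi * b) = cos x"
  proof -
    have "of_real pi * b = of_real pi / 2 - x" by (simp add: b_def x_def field_simps)
    then show ?thesis by (simp add: sin_diff cos_of_real_pi_half)
  qed
  have sa: "sin (of_real pi * a) = cos x * cos y - sin x * sin y"
  proof -
    have "of_real pi * a = of_real pi / 2 - (x + y)" by (simp add: a_def x_def y_def field_simps)
    then show ?thesis by (simp add: sin_diff cos_of_real_pi_half cos_add)
  qed
  have y0: "sin y \<noteq> 0" using assms(1) using sin_pi_eq_0_iff[of \<nu>] by (simp add: y_def mult.commute)
  have ab: "(\<mu> + \<nu> + 1) / 2 = 1 - a" "(\<mu> - \<nu> + 1) / 2 = 1 - b" by (simp_all add: a_def b_def field_simps)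
  have y: "of_real pi * \<nu> = y" by (simp add: y_def)
  have "lommel_S_gen \<mu> \<nu> z = lommel_s \<mu> \<nu> z + c * (sin x * bessel_J \<nu> z - cos x * ((bessel_J \<nu> z * cos y - bessel_J (- \<nu>) z) / sin y))"
    unfolding lommel_S_gen_def bessel_Y_gen_def ab c_def x_def y_def by simp
  also have "\<dots> = lommel_s \<mu> \<nu> z + c * (sin (of_real pi * b) / sin (of_real pi * \<nu>)) * bessel_J (- \<nu>) z
     - c * (sin (of_real pi * a) / sin (of_real pi * \<nu>)) * bessel_J \<nu> z"
    unfolding sa sb y using y0 by (simp add: field_simps)
  finally show ?thesis .
qed

text \<open>The residues at 1 to \<open>N\<close> give the asymptotic partial sum, those beyond
  \<open>N\<close> the series of \<open>lommel_s\<close>, and the two Gamma families the Bessel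
  terms. The assumptions on \<open>a\<close> and \<open>b\<close> are those under which all poles
  are simple and off the lines.\<close>

lemma lommel_S_gen_eq_rem:
  fixes \<mu> \<nu> z :: complex and N :: nat
  defines "a \<equiv> (1 - \<mu> - \<nu>) / 2" and "b \<equiv> (1 - \<mu> + \<nu>) / 2"
  assumes z: "z \<noteq> 0" "\<bar>Im (Ln (z / 2))\<bar> < pi / 2" and \<nu>: "\<nu> \<notin> \<int>"
    and a: "Re a + real N > 1 / 2" "Re a - 1 / 2 \<notin> \<int>" "a \<notin> \<int>"
    and b: "Re b + real N > 1 / 2" "Re b - 1 / 2 \<notin> \<int>" "b \<notin> \<int>"
  shows "lommel_S_gen \<mu> \<nu> z = lommel_psum N \<mu> \<nu> z + lommel_rem N \<mu> \<nu> z"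
proof -
  define l where "l = Ln (z / 2)"
  define A where "A = a + of_nat N"
  define B where "B = b + of_nat N"
  define P where "P = z powr (\<mu> - 1) * rGamma a * rGamma b * (-1) ^ N * (2 / z) ^ (2 * N)"
  have ab: "b - a = \<nu>" "a + b = 1 - \<mu>" by (simp_all add: a_def b_def field_simps)
  have notnp: "x + of_nat n \<notin> \<int>\<^sub>\<le>\<^sub>0" "x - of_nat n \<notin> \<int>\<^sub>\<le>\<^sub>0" if "x \<notin> \<int>" for x :: complex and n
    using that add_nat_notin_Ints_iff[of x n] nonpos_Ints_Int by blast+
  have rG: "rGamma a \<noteq> 0" "rGamma b \<noteq> 0" using notnp[of _ 0] a b by (auto simp: rGamma_eq_zero_iff)
  have P: "P \<noteq> 0" using z rG by (simp add: P_def)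
  have s7: "(2 / z) ^ (2 * N) * (z / 2) ^ (2 * N) = 1"
    using z by (simp flip: power_mult_distrib)
  \<comment> \<open>Normalized residue at \<open>i + 1\<close>. Index \<open>i + N\<close> yields
    term \<open>i\<close> of \<open>lommel_s\<close>, whereas index \<open>N - 1 - n\<close> yields
    minus term \<open>n\<close> of the partial sum, which therefore appears in reverse
    order.\<close>
  define f where "f i = - P * mb_residue_nat A B l (Suc i)" for i
  have f1: "f (i + N) = z powr (\<mu> + 1) * lommel_s_term \<mu> \<nu> z i" for i
  proof -
    have la: "lommel_a (Suc i) \<mu> \<nu> * (Gamma (a - of_nat (Suc i)) * Gamma (b - of_nat (Suc i))) = 4 ^ Suc i * (Gamma a * Gamma b)"
      using lommel_a_mult_Gamma[of \<mu> \<nu> "Suc i"] a b unfolding a_def b_def by blast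
    have "Gamma a * Gamma b * (rGamma a * rGamma b) = 1" using rG by (simp add: Gamma_def field_simps)
    then have "lommel_a (Suc i) \<mu> \<nu> * (rGamma a * rGamma b * (Gamma (a - of_nat (Suc i)) * Gamma (b - of_nat (Suc i)))) = 4 ^ Suc i"
      using la by (metis mult.assoc mult.commute mult_1_right)
    moreover from this have "lommel_a (Suc i) \<mu> \<nu> \<noteq> 0" by (metis mult_zero_left power_not_zero zero_neq_numeral)
    ultimately have G: "rGamma a * rGamma b * (Gamma (a - of_nat (Suc i)) * Gamma (b - of_nat (Suc i))) = 4 ^ Suc i / lommel_a (Suc i) \<mu> \<nu>"
      by (simp add: field_simps)
    have AB: "A - of_nat (Suc (i + N)) = a - of_nat (Suc i)" "B - of_nat (Suc (i + N)) = b - of_nat (Suc i)"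
      by (simp_all add: A_def B_def)
    have e: "exp (2 * of_nat (Suc (i + N)) * l) = (z / 2) ^ (2 * N) * (z / 2) ^ (2 * Suc i)"
      unfolding l_def exp_nat_mult_Ln[OF z(1)] by (simp flip: power_add add: add_ac)
    have sg: "(-1) ^ Suc (i + N) = - ((-1) ^ i) * (-1 :: complex) ^ N" by (simp add: power_add)
    have "f (i + N) = z powr (\<mu> - 1) * (-1) ^ i * ((-1) ^ N * (-1) ^ N) * ((2 / z) ^ (2 * N) * (z / 2) ^ (2 * N)) * (z / 2) ^ (2 * Suc i) *
        (rGamma a * rGamma b * (Gamma (a - of_nat (Suc i)) * Gamma (b - of_nat (Suc i))))"
      unfolding f_def P_def mb_residue_nat_def AB e sg by (simp only: divide_inverse mult_ac mult_minus_left mult_minus_right minus_minus)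
    also have "\<dots> = z powr (\<mu> - 1) * (-1) ^ i * ((z / 2) ^ (2 * Suc i) * 4 ^ Suc i) / lommel_a (Suc i) \<mu> \<nu>"
      unfolding G s7 minus_one_power_mult_self by simp
    also have "(z / 2) ^ (2 * Suc i) * 4 ^ Suc i = z ^ 2 * z ^ (2 * i)"
      unfolding power_mult by (simp add: power_divide power_mult power2_eq_square flip: power_mult_distrib)
    also have "z powr (\<mu> - 1) * (-1) ^ i * (z ^ 2 * z ^ (2 * i)) / lommel_a (Suc i) \<mu> \<nu> = (z powr (\<mu> - 1) * z ^ 2) * lommel_s_term \<mu> \<nu> z i"
      by (simp add: lommel_s_term_def)
    also have "z powr (\<mu> - 1) * z ^ 2 = z powr (\<mu> + 1)"
      using z powr_add[of z "\<mu> - 1" 2] by (simp add: add.commute)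
    finally show ?thesis .
  qed
  have f2: "f (N - Suc n) = - (z powr (\<mu> - 1) * ((-1)^n * lommel_a n (-\<mu>) \<nu> / z^(2*n)))" if "n < N" for n
  proof -
    obtain m where m: "N = n + Suc m" using \<open>n < N\<close> less_iff_Suc_add by (metis add_Suc_right)
    have i: "Suc (N - Suc n) = Suc m" by (simp add: m)
    have AB: "A - of_nat (Suc m) = a + of_nat n" "B - of_nat (Suc m) = b + of_nat n"
      by (simp_all add: A_def B_def m)
    have G: "rGamma a * Gamma (a + of_nat n) = pochhammer a n" "rGamma b * Gamma (b + of_nat n) = pochhammer b n"
      using notnp[of _ n] a b by (auto intro!: rGamma_mult_Gamma_add)
    have e: "(2 / z) ^ (2 * N) = (2 / z) ^ (2 * n) * (2 / z) ^ (2 * Suc m)" "(-1) ^ N = (-1) ^ n * (-1 :: complex) ^ Suc m"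
      unfolding m by (simp_all only: power_add distrib_left)
    have s: "(2 / z) ^ (2 * Suc m) * (z / 2) ^ (2 * Suc m) = 1" using z by (simp only: flip: power_mult_distrib) simp
    have "f (N - Suc n) = - (z powr (\<mu> - 1) * (-1) ^ n * ((-1) ^ Suc m * (-1) ^ Suc m) * ((2 / z) ^ (2 * Suc m) * (z / 2) ^ (2 * Suc m)) * (2 / z) ^ (2 * n) *
       (rGamma a * Gamma (a + of_nat n)) * (rGamma b * Gamma (b + of_nat n)))"
      unfolding f_def P_def mb_residue_nat_def i AB e l_def exp_nat_mult_Ln[OF z(1)]
      by (simp only: divide_inverse mult_ac mult_minus_left mult_minus_right minus_minus)
    also have "\<dots> = - (z powr (\<mu> - 1) * (-1) ^ n * (4 ^ n * pochhammer a n * pochhammer b n) / z ^ (2 * n))"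
      unfolding s G minus_one_power_mult_self by (simp add: power_divide power_mult)
    also have "4 ^ n * pochhammer a n * pochhammer b n = lommel_a n (- \<mu>) \<nu>"
      by (simp add: lommel_a_eq_pochhammer a_def b_def)
    finally show ?thesis by simp
  qed
  have fsum: "(\<Sum>i<N. f i) = - lommel_psum N \<mu> \<nu> z"
  proof -
    have "(\<Sum>i<N. f i) = (\<Sum>n<N. f (N - Suc n))" by (rule sum.nat_diff_reindex[symmetric])
    also have "\<dots> = (\<Sum>n<N. - (z powr (\<mu> - 1) * ((-1)^n * lommel_a n (-\<mu>) \<nu> / z^(2*n))))"
      by (intro sum.cong refl f2) simp
    finally show ?thesis by (simp add: lommel_psum_def sum_negf sum_distrib_left)
  qed
  have "(\<lambda>i. f (i + N)) sums lommel_s \<mu> \<nu> z" unfolding f1 by (rule lommel_s_sums)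
  then have "f sums (lommel_s \<mu> \<nu> z - lommel_psum N \<mu> \<nu> z)"
    by (subst (asm) sums_iff_shift) (simp add: fsum)
  from sums_divide[OF this, of "- P"]
  have S0: "(\<lambda>n. mb_residue_nat A B l (Suc n)) sums ((lommel_s \<mu> \<nu> z - lommel_psum N \<mu> \<nu> z) / (- P))"
    using P by (simp add: f_def)
  define c where "c = 2 powr (\<mu> - 1) * Gamma (1 - a) * Gamma (1 - b)"
  define SA where "SA = - (c * (sin (of_real pi * b) / sin (of_real pi * \<nu>))) * bessel_J (- \<nu>) z"
  define SB where "SB = (c * (sin (of_real pi * a) / sin (of_real pi * \<nu>))) * bessel_J \<nu> z"
  have sA: "(\<lambda>k. P * mb_residue_Gamma A B l k) sums SA"
    using mb_residue_Gamma_bessel_sums[OF a(3) b(3) \<nu> z(1) ab, of N] by (simp add: P_def A_def B_def l_def SA_def c_def)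
  have "- \<nu> \<notin> \<int>" using \<nu> by (simp add: minus_in_Ints_iff)
  from mb_residue_Gamma_bessel_sums[OF b(3) a(3) this z(1), of \<mu> N] ab
  have sB: "(\<lambda>k. P * mb_residue_Gamma B A l k) sums SB"
    by (simp add: P_def A_def B_def l_def SB_def c_def algebra_simps)
  have sA': "mb_residue_Gamma A B l sums (SA / P)" and sB': "mb_residue_Gamma B A l sums (SB / P)"
    using sums_divide[OF sA, of P] sums_divide[OF sB, of P] P by simp_all
  have "mb_integral A B l = - ((lommel_s \<mu> \<nu> z - lommel_psum N \<mu> \<nu> z) / (- P) + SA / P + SB / P)"
  proof (rule mb_integral_eq_series)
    have "A - B = - \<nu>" by (simp add: A_def B_def ab(1)[symmetric])
    with \<open>- \<nu> \<notin> \<int>\<close> show "A - B \<notin> \<int>" by simp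
    have "Re x + real N - 1 / 2 \<notin> \<int>" if "Re x - 1 / 2 \<notin> \<int>" for x
      using that add_nat_notin_Ints_iff(1)[of "Re x - 1 / 2" N] by (simp add: algebra_simps)
    then show "Re A - 1 / 2 \<notin> \<int>" "Re B - 1 / 2 \<notin> \<int>"
      using a(2) b(2) by (simp_all add: A_def B_def)
    show "A \<notin> \<int>" "B \<notin> \<int>" using a b by (simp_all add: A_def B_def add_nat_notin_Ints_iff)
  qed (use z(2) a(1) b(1) S0 sA' sB' in \<open>auto simp: A_def B_def l_def\<close>)
  then have "P * mb_integral A B l = lommel_s \<mu> \<nu> z - lommel_psum N \<mu> \<nu> z - SA - SB"
    using P by (simp add: field_simps)
  moreover have "lommel_rem N \<mu> \<nu> z = P * mb_integral A B l"
    by (simp add: lommel_rem_def P_def A_def B_def a_def b_def l_def)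
  moreover have "lommel_S_gen \<mu> \<nu> z = lommel_s \<mu> \<nu> z - SA - SB"
    using lommel_S_gen_eq_bessel[OF \<nu>, of \<mu> z] by (simp add: SA_def SB_def c_def a_def b_def)
  ultimately show ?thesis by simp
qed

section \<open>Passage to the limit in the parameters\<close>

lemma tendsto_mb_integral:
  assumes A: "X \<longlonglongrightarrow> A" and B: "Y \<longlonglongrightarrow> B" and re: "Re A > 1 / 2" "Re B > 1 / 2" and l: "\<bar>Im l\<bar> < pi / 2"
  shows "(\<lambda>n. mb_integral (X n) (Y n) l) \<longlonglongrightarrow> mb_integral A B l"
proof -
  \<comment> \<open>On \<open>Re s = 1/2\<close> the modulus of \<open>Gamma (Z n - s)\<close> is at
    most \<open>Gamma (Re (Z n) - 1/2)\<close>, which eventually stays below its limit plus 1. This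
    makes the majorant \<open>W\<close> independent of \<open>n\<close>.\<close>
  have bnd: "\<exists>G\<ge>0. \<forall>\<^sub>F n in sequentially. Re (Z n) > 1 / 2 \<and> Gamma (Re (Z n) - 1 / 2) \<le> G"
    if Z: "Z \<longlonglongrightarrow> C" and C: "Re C > 1 / 2" for Z C
  proof -
    have "Re C - 1 / 2 \<notin> \<int>\<^sub>\<le>\<^sub>0" using C by (auto elim!: nonpos_Ints_cases)
    then have "(\<lambda>n. Gamma (Re (Z n) - 1 / 2)) \<longlonglongrightarrow> Gamma (Re C - 1 / 2)"
      by (intro tendsto_intros Z)
    from order_tendstoD(2)[OF this, of "Gamma (Re C - 1 / 2) + 1"]
    have "\<forall>\<^sub>F n in sequentially. Gamma (Re (Z n) - 1 / 2) < Gamma (Re C - 1 / 2) + 1" by simp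
    moreover have "\<forall>\<^sub>F n in sequentially. Re (Z n) > 1 / 2"
      using order_tendstoD(1)[OF tendsto_Re[OF Z] C] .
    moreover have "Gamma (Re C - 1 / 2) > 0" using C by (intro Gamma_real_pos) simp
    ultimately show ?thesis
      by (intro exI[of _ "Gamma (Re C - 1 / 2) + 1"]) (auto elim: eventually_elim2)
  qed
  obtain G where G: "G \<ge> 0" "\<forall>\<^sub>F n in sequentially. Re (X n) > 1 / 2 \<and> Gamma (Re (X n) - 1 / 2) \<le> G"
    using bnd[OF A re(1)] by blast
  obtain H where H: "H \<ge> 0" "\<forall>\<^sub>F n in sequentially. Re (Y n) > 1 / 2 \<and> Gamma (Re (Y n) - 1 / 2) \<le> H"
    using bnd[OF B re(2)] by blast
  define \<kappa> where "\<kappa> = pi - 2 * \<bar>Im l\<bar>"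
  define W where "W t = (4 * pi * G * H * exp (Re l)) * exp (- \<kappa> * \<bar>t\<bar>)" for t
  obtain n0 where n0: "\<And>n. n \<ge> n0 \<Longrightarrow> (Re (X n) > 1 / 2 \<and> Gamma (Re (X n) - 1 / 2) \<le> G) \<and> (Re (Y n) > 1 / 2 \<and> Gamma (Re (Y n) - 1 / 2) \<le> H)"
    using eventually_conj[OF G(2) H(2)] unfolding eventually_sequentially by blast
  have bound: "cmod (mb_integrand (X (n + n0)) (Y (n + n0)) l (Complex (1/2) t)) \<le> W t" for n t
  proof -
    define s where "s = Complex (1/2) t"
    have s: "Re s = 1 / 2" "Im s = t" by (simp_all add: s_def)
    have disj: "\<bar>Im s\<bar> \<ge> 1 \<or> Re s - 1 / 2 \<in> \<int>" unfolding s(1) by simp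
    have Gs: "cmod (Gamma (Z - s)) \<le> G'" if "Re Z > 1 / 2" "Gamma (Re Z - 1 / 2) \<le> G'" for Z G'
      using complex_Gamma_norm_le[of "Z - s"] that s by simp
    have "cmod (mb_integrand (X (n + n0)) (Y (n + n0)) l s) \<le> (4 * pi * exp (- pi * \<bar>Im s\<bar>)) * G * H * (exp (2 * Re s * Re l) * exp (2 * \<bar>Im l\<bar> * \<bar>Im s\<bar>))"
      unfolding mb_integrand_def norm_mult using G(1) H(1) n0[of "n + n0"]
      by (intro mult_mono norm_pi_div_sin_le[OF disj] Gs norm_exp_mult_le) auto
    also have "\<dots> = 4 * pi * G * H * exp (Re l) * (exp (- pi * \<bar>t\<bar>) * exp (2 * \<bar>Im l\<bar> * \<bar>t\<bar>))"
      by (simp add: s mult_ac)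
    also have "\<dots> = W t" by (simp add: W_def \<kappa>_def algebra_simps flip: exp_add)
    finally show ?thesis by (simp add: s_def)
  qed
  have nonp: "w \<notin> \<int>\<^sub>\<le>\<^sub>0" if "Re w > 0" for w :: complex using that by (auto elim!: nonpos_Ints_cases)
  have "(\<lambda>n. LINT t|lborel. mb_integrand (X (n + n0)) (Y (n + n0)) l (Complex (1/2) t)) \<longlonglongrightarrow> (LINT t|lborel. mb_integrand A B l (Complex (1/2) t))"
  proof (rule integral_dominated_convergence[where w = W])
    show "integrable lborel W" unfolding W_def using l
      by (intro integrable_mult_right integrable_exp_neg_abs) (auto simp: \<kappa>_def)
    show "(\<lambda>t. mb_integrand A B l (Complex (1/2) t)) \<in> borel_measurable lborel"
      using re l by (intro borel_measurable_integrable integrable_mb_integrand) auto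
    show "(\<lambda>t. mb_integrand (X (n + n0)) (Y (n + n0)) l (Complex (1/2) t)) \<in> borel_measurable lborel" for n
      using l n0[of "n + n0"] by (intro borel_measurable_integrable integrable_mb_integrand) auto
    show "AE t in lborel. cmod (mb_integrand (X (n + n0)) (Y (n + n0)) l (Complex (1/2) t)) \<le> W t" for n
      using bound by simp
    show "AE t in lborel. (\<lambda>n. mb_integrand (X (n + n0)) (Y (n + n0)) l (Complex (1/2) t)) \<longlonglongrightarrow> mb_integrand A B l (Complex (1/2) t)"
    proof (rule AE_I2)
      fix t
      have "(\<lambda>n. mb_integrand (X n) (Y n) l (Complex (1/2) t)) \<longlonglongrightarrow> mb_integrand A B l (Complex (1/2) t)"
        unfolding mb_integrand_def by (intro tendsto_mult tendsto_const tendsto_Gamma tendsto_diff A B nonp) (use re in auto)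
      then show "(\<lambda>n. mb_integrand (X (n + n0)) (Y (n + n0)) l (Complex (1/2) t)) \<longlonglongrightarrow> mb_integrand A B l (Complex (1/2) t)"
        by (rule LIMSEQ_ignore_initial_segment)
    qed
  qed
  then have "(\<lambda>n. LINT t|lborel. mb_integrand (X n) (Y n) l (Complex (1/2) t)) \<longlonglongrightarrow> (LINT t|lborel. mb_integrand A B l (Complex (1/2) t))"
    by (rule LIMSEQ_offset)
  then show ?thesis unfolding mb_integral_def by (intro tendsto_divide tendsto_const) auto
qed

lemma tendsto_powr_exponent: "X \<longlonglongrightarrow> \<mu> \<Longrightarrow> z \<noteq> 0 \<Longrightarrow> (\<lambda>n. z powr X n) \<longlonglongrightarrow> z powr (\<mu> :: complex)"
  by (simp add: powr_def) (intro tendsto_intros)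

text \<open>All ingredients are continuous at every pair (\<mu>, \<nu>) for which \<open>N\<close>
  puts both Gamma arguments beyond real part 1/2. The right-hand side of the identity can thus be
  evaluated in the limits on which \<open>lommel_S\<close> rests.\<close>

lemma tendsto_lommel_psum_rem:
  assumes X: "X \<longlonglongrightarrow> \<mu>" and Y: "Y \<longlonglongrightarrow> \<nu>" and z: "z \<noteq> 0" "\<bar>Im (Ln (z / 2))\<bar> < pi / 2"
    and N: "Re ((1 - \<mu> - \<nu>) / 2) + real N > 1 / 2" "Re ((1 - \<mu> + \<nu>) / 2) + real N > 1 / 2"
  shows "(\<lambda>n. lommel_psum N (X n) (Y n) z + lommel_rem N (X n) (Y n) z) \<longlonglongrightarrow> lommel_psum N \<mu> \<nu> z + lommel_rem N \<mu> \<nu> z"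
  unfolding lommel_psum_def lommel_rem_def lommel_a_def
  by (intro tendsto_intros tendsto_mb_integral tendsto_powr_exponent isCont_tendsto_compose[OF isCont_rGamma] X Y z) (use z N in auto)

lemma lommel_a_generic_nonzero:
  assumes "lommel_generic \<mu> \<nu>"
  shows "lommel_a n \<mu> \<nu> \<noteq> 0"
proof (induction n)
  case (Suc n)
  have "(\<mu> + of_nat (2 * Suc n) - 1)^2 - \<nu>^2 = (\<mu> + \<nu> - - of_nat (2 * n + 1)) * (\<mu> - \<nu> - - of_nat (2 * n + 1))"
    by (simp add: algebra_simps power2_eq_square)
  moreover have "\<dots> \<noteq> 0" using assms unfolding lommel_generic_def by simp
  ultimately show ?case using Suc unfolding lommel_a_Suc by simp
qed simp

lemma tendsto_lommel_S_gen:
  assumes gen: "lommel_generic \<mu> \<nu>" and X: "X \<longlonglongrightarrow> \<mu>" and z: "z \<noteq> 0"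
  shows "(\<lambda>n. lommel_S_gen (X n) \<nu> z) \<longlonglongrightarrow> lommel_S_gen \<mu> \<nu> z"
proof -
  have odd: "(w + 1) / 2 \<notin> \<int>\<^sub>\<le>\<^sub>0" if "\<And>k::nat. w \<noteq> - of_nat (2 * k + 1)" for w :: complex
  proof
    assume "(w + 1) / 2 \<in> \<int>\<^sub>\<le>\<^sub>0"
    then obtain k where "(w + 1) / 2 = - of_nat k" by (elim nonpos_Ints_cases')
    then have "w + 1 = 2 * (- of_nat k)" by (metis mult.commute nonzero_eq_divide_eq zero_neq_numeral)
    then have "w = - of_nat (2 * k + 1)" by (simp add: eq_diff_eq[symmetric])
    with that show False by blast
  qed
  have "(\<mu> + \<nu> + 1) / 2 \<notin> \<int>\<^sub>\<le>\<^sub>0" "(\<mu> - \<nu> + 1) / 2 \<notin> \<int>\<^sub>\<le>\<^sub>0"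
    using gen unfolding lommel_generic_def by (blast intro!: odd)+
  then show ?thesis unfolding lommel_S_gen_def
    by (intro tendsto_intros tendsto_lommel_s X lommel_a_generic_nonzero[OF gen] z tendsto_powr_exponent) auto
qed

text \<open>For large \<open>n\<close> the point lies strictly between
  \<open>\<lceil>x\<rceil> - 1\<close> and \<open>x\<close>; \<open>d\<close> is the distance
  between these two.\<close>

lemma eventually_notin_Ints: "\<forall>\<^sub>F n in sequentially. (x::real) - 1 / real (Suc n) \<notin> \<int>"
proof -
  define d where "d = x - of_int \<lceil>x\<rceil> + 1"
  have d: "d > 0" unfolding d_def by linarith
  have "(\<lambda>n. 1 / real (Suc n)) \<longlonglongrightarrow> 0" using lim_1_over_n LIMSEQ_Suc by fastforce
  from order_tendstoD(2)[OF this d] show ?thesis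
  proof eventually_elim
    case (elim n)
    show ?case
    proof
      assume "x - 1 / real (Suc n) \<in> \<int>"
      then obtain m where m: "x - 1 / real (Suc n) = of_int m" by (elim Ints_cases)
      have "0 < 1 / real (Suc n)" by simp
      with m have "real_of_int m < x" by linarith
      then have "real_of_int m < of_int \<lceil>x\<rceil>" using le_of_int_ceiling[of x] by linarith
      moreover have "real_of_int (\<lceil>x\<rceil> - 1) < of_int m" using m elim by (simp add: d_def)
      ultimately have "m < \<lceil>x\<rceil>" "\<lceil>x\<rceil> - 1 < m" by (simp_all only: of_int_less_iff)
      then show False by linarith
    qed
  qed
qed

text \<open>Generic parameters may still have \<open>a\<close> or \<open>b\<close> a nonpositive
  integer, or with half-integral real part. Perturbing \<mu> alone moves \<open>a\<close> and
  \<open>b\<close> together off these exceptional sets and leaves their difference \<nu> fixed; both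
  sides are continuous in \<mu>.\<close>

lemma lommel_S_gen_eq_rem_generic:
  assumes gen: "lommel_generic \<mu> \<nu>" and z: "z \<noteq> 0" "\<bar>Im (Ln (z / 2))\<bar> < pi / 2"
    and N: "Re ((1 - \<mu> - \<nu>) / 2) + real N > 1 / 2" "Re ((1 - \<mu> + \<nu>) / 2) + real N > 1 / 2"
  shows "lommel_S_gen \<mu> \<nu> z = lommel_psum N \<mu> \<nu> z + lommel_rem N \<mu> \<nu> z"
proof -
  define X where "X n = \<mu> + of_real (1 / real (Suc n))" for n
  have e0: "(\<lambda>n. 1 / real (Suc n)) \<longlonglongrightarrow> 0" using lim_1_over_n LIMSEQ_Suc by fastforce
  have X: "X \<longlonglongrightarrow> \<mu>" unfolding X_def using tendsto_add[OF tendsto_const[of \<mu>] tendsto_of_real[OF e0]] by simp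
  have lim1: "(\<lambda>n. lommel_S_gen (X n) \<nu> z) \<longlonglongrightarrow> lommel_S_gen \<mu> \<nu> z"
    by (rule tendsto_lommel_S_gen[OF gen X z(1)])
  have lim2: "(\<lambda>n. lommel_psum N (X n) \<nu> z + lommel_rem N (X n) \<nu> z) \<longlonglongrightarrow> lommel_psum N \<mu> \<nu> z + lommel_rem N \<mu> \<nu> z"
    by (rule tendsto_lommel_psum_rem[OF X tendsto_const z N])
  have nu: "\<nu> \<notin> \<int>" using gen by (simp add: lommel_generic_def)
  have good: "\<forall>\<^sub>F n in sequentially. Re w - 1 / (2 * real (Suc n)) - 1 / 2 \<notin> \<int> \<and> w - of_real (1 / (2 * real (Suc n))) \<notin> \<int>" for w :: complex
    using eventually_notin_Ints[of "2 * Re w"]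
  proof eventually_elim
    case (elim n)
    have "2 * (Re w - 1 / (2 * real (Suc n))) = 2 * Re w - 1 / real (Suc n)" by (simp add: field_simps)
    \<comment> \<open>That twice the real part is not an integer rules out integral and
      half-integral real parts at once.\<close>
    with elim have 1: "2 * (Re w - 1 / (2 * real (Suc n))) \<notin> \<int>" by simp
    have 2: "2 * x \<in> \<int>" if "x \<in> \<int>" for x :: real using that by (intro Ints_mult) auto
    have "2 * x \<in> \<int>" if "x - 1 / 2 \<in> \<int>" for x :: real
    proof -
      have "2 * x = 2 * (x - 1 / 2) + 1" by simp
      also have "\<dots> \<in> \<int>" using 2[OF that] by (intro Ints_add) auto
      finally show ?thesis .
    qed
    with 1 have "Re w - 1 / (2 * real (Suc n)) - 1 / 2 \<notin> \<int>" by blast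
    moreover have "w - of_real (1 / (2 * real (Suc n))) \<notin> \<int>"
    proof
      assume "w - of_real (1 / (2 * real (Suc n))) \<in> \<int>"
      then have "Re (w - of_real (1 / (2 * real (Suc n)))) \<in> \<int>" by (elim Ints_cases) (metis Ints_of_int complex_Re_of_int)
      then have "Re w - 1 / (2 * real (Suc n)) \<in> \<int>" by simp
      with 1 2 show False by blast
    qed
    ultimately show ?case by blast
  qed
  have pert: "(1 - X n - \<nu>) / 2 = (1 - \<mu> - \<nu>) / 2 - of_real (1 / (2 * real (Suc n)))"
     "(1 - X n + \<nu>) / 2 = (1 - \<mu> + \<nu>) / 2 - of_real (1 / (2 * real (Suc n)))" for n
  proof -
    define d :: complex where "d = of_real (1 / real (Suc n))"
    have d2: "of_real (1 / (2 * real (Suc n))) = d / 2" by (simp add: d_def)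
    show "(1 - X n - \<nu>) / 2 = (1 - \<mu> - \<nu>) / 2 - of_real (1 / (2 * real (Suc n)))"
     "(1 - X n + \<nu>) / 2 = (1 - \<mu> + \<nu>) / 2 - of_real (1 / (2 * real (Suc n)))"
      unfolding X_def d_def[symmetric] d2 by (simp_all add: field_simps)
  qed
  have reN: "\<forall>\<^sub>F n in sequentially. Re ((1 - X n - \<nu>) / 2) + real N > 1 / 2" "\<forall>\<^sub>F n in sequentially. Re ((1 - X n + \<nu>) / 2) + real N > 1 / 2"
    by (rule order_tendstoD(1)[OF _ N(1)], intro tendsto_intros X, simp)
       (rule order_tendstoD(1)[OF _ N(2)], intro tendsto_intros X, simp)
  have "\<forall>\<^sub>F n in sequentially. lommel_S_gen (X n) \<nu> z = lommel_psum N (X n) \<nu> z + lommel_rem N (X n) \<nu> z"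
    using reN good[of "(1 - \<mu> - \<nu>) / 2"] good[of "(1 - \<mu> + \<nu>) / 2"]
  proof eventually_elim
    case (elim n)
    have re: "Re (w - of_real (1 / (2 * real (Suc n)))) = Re w - 1 / (2 * real (Suc n))" for w by simp
    have "Re ((1 - X n - \<nu>) / 2) - 1 / 2 \<notin> \<int>" "(1 - X n - \<nu>) / 2 \<notin> \<int>"
      "Re ((1 - X n + \<nu>) / 2) - 1 / 2 \<notin> \<int>" "(1 - X n + \<nu>) / 2 \<notin> \<int>"
      using elim(3,4) unfolding pert re by blast+
    with elim(1,2) show ?case by (intro lommel_S_gen_eq_rem[OF z nu])
  qed
  from Lim_transform_eventually[OF lim1 this] show ?thesis
    using LIMSEQ_unique lim2 by blast
qed

text \<open>The limit defining \<open>lommel_S\<close> is determined only if generic pairs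
  accumulate at every pair.\<close>

lemma generic_accumulates: "at (\<mu>, \<nu>) within {p. lommel_generic (fst p) (snd p)} \<noteq> bot"
proof -
  define e where "e n = 1 / real (Suc n)" for n
  have e0: "e \<longlonglongrightarrow> 0" unfolding e_def using lim_1_over_n LIMSEQ_Suc by fastforce
  have e_pos: "e n > 0" for n by (simp add: e_def)
  have ev: "\<forall>\<^sub>F n in sequentially. c + k * e n \<noteq> 0" if "k \<noteq> 0" for c k :: real
  proof (cases "c = 0")
    case True
    have "e n \<noteq> 0" for n using e_pos[of n] by simp
    with True that show ?thesis by simp
  next
    case False
    have "(\<lambda>n. c + k * e n) \<longlonglongrightarrow> c + k * 0" by (intro tendsto_intros e0)
    then show ?thesis using False by (intro tendsto_imp_eventually_ne) auto
  qed
  \<comment> \<open>Imaginary displacements in ratio 1 to 2 change \<open>Im \<nu>\<close>,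
    \<open>Im (\<mu> + \<nu>)\<close> and \<open>Im (\<mu> - \<nu>)\<close> at the nonzero rates 2,
    3 and -1. All three are then eventually nonzero, which excludes every forbidden real
    value.\<close>
  define p where "p n = (\<mu> + \<i> * of_real (e n), \<nu> + \<i> * of_real (2 * e n))" for n
  have "p \<longlonglongrightarrow> (\<mu> + \<i> * of_real 0, \<nu> + \<i> * of_real (2 * 0))"
    unfolding p_def by (intro tendsto_intros e0)
  then have plim: "p \<longlonglongrightarrow> (\<mu>, \<nu>)" by simp
  have "\<forall>\<^sub>F n in sequentially. lommel_generic (fst (p n)) (snd (p n))"
    using ev[of 2 "Im \<nu>", OF zero_neq_numeral[symmetric]] ev[of 3 "Im \<mu> + Im \<nu>", OF zero_neq_numeral[symmetric]]
      ev[of "-1" "Im \<mu> - Im \<nu>", simplified]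
  proof eventually_elim
    case (elim n)
    have "snd (p n) \<notin> \<int>" using elim by (auto elim!: Ints_cases simp: p_def dest!: arg_cong[of _ _ Im])
    moreover have "fst (p n) + snd (p n) \<noteq> - of_nat (2 * k + 1)" "fst (p n) - snd (p n) \<noteq> - of_nat (2 * k + 1)" for k
      using elim by (auto simp: p_def complex_eq_iff algebra_simps)
    ultimately show ?case by (simp add: lommel_generic_def)
  qed
  then obtain n0 where n0: "\<And>n. n \<ge> n0 \<Longrightarrow> lommel_generic (fst (p n)) (snd (p n))" by (auto simp: eventually_sequentially)
  have "p n \<noteq> (\<mu>, \<nu>)" for n using e_pos[of n] by (simp add: p_def)
  then have "(\<mu>, \<nu>) islimpt {p. lommel_generic (fst p) (snd p)}"
    unfolding islimpt_sequential using n0 LIMSEQ_ignore_initial_segment[OF plim, of n0]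
    by (intro exI[of _ "\<lambda>n. p (n + n0)"]) auto
  then show ?thesis by (simp add: trivial_limit_within)
qed

text \<open>The two conditions on \<open>N\<close> are open in (\<mu>, \<nu>), so near the limit
  point the generic identity applies, and its right-hand side is continuous. Hence the limit exists
  and has this value.\<close>

lemma lommel_S_eq_rem:
  assumes z: "z \<noteq> 0" "\<bar>Im (Ln (z / 2))\<bar> < pi / 2"
    and N: "Re ((1 - \<mu> - \<nu>) / 2) + real N > 1 / 2" "Re ((1 - \<mu> + \<nu>) / 2) + real N > 1 / 2"
  shows "lommel_S \<mu> \<nu> z = lommel_psum N \<mu> \<nu> z + lommel_rem N \<mu> \<nu> z"
  unfolding lommel_S_def
proof (rule tendsto_Lim[OF generic_accumulates])
  show "((\<lambda>p. lommel_S_gen (fst p) (snd p) z) \<longlongrightarrow> lommel_psum N \<mu> \<nu> z + lommel_rem N \<mu> \<nu> z)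
     (at (\<mu>, \<nu>) within {p. lommel_generic (fst p) (snd p)})"
    unfolding tendsto_at_iff_sequentially o_def
  proof (intro allI impI)
    fix p :: "nat \<Rightarrow> complex \<times> complex"
    assume p: "\<forall>i. p i \<in> {p. lommel_generic (fst p) (snd p)} - {(\<mu>, \<nu>)}" "p \<longlonglongrightarrow> (\<mu>, \<nu>)"
    have X: "(\<lambda>n. fst (p n)) \<longlonglongrightarrow> \<mu>" and Y: "(\<lambda>n. snd (p n)) \<longlonglongrightarrow> \<nu>"
      using tendsto_fst[OF p(2)] tendsto_snd[OF p(2)] by simp_all
    have lim: "(\<lambda>n. lommel_psum N (fst (p n)) (snd (p n)) z + lommel_rem N (fst (p n)) (snd (p n)) z) \<longlonglongrightarrow> lommel_psum N \<mu> \<nu> z + lommel_rem N \<mu> \<nu> z"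
      by (rule tendsto_lommel_psum_rem[OF X Y z N])
    have "\<forall>\<^sub>F n in sequentially. Re ((1 - fst (p n) - snd (p n)) / 2) + real N > 1 / 2" "\<forall>\<^sub>F n in sequentially. Re ((1 - fst (p n) + snd (p n)) / 2) + real N > 1 / 2"
      by (rule order_tendstoD(1)[OF _ N(1)], intro tendsto_intros X Y, simp)
         (rule order_tendstoD(1)[OF _ N(2)], intro tendsto_intros X Y, simp)
    then have "\<forall>\<^sub>F n in sequentially. lommel_psum N (fst (p n)) (snd (p n)) z + lommel_rem N (fst (p n)) (snd (p n)) z = lommel_S_gen (fst (p n)) (snd (p n)) z"
      by eventually_elim (use p(1) in \<open>auto intro!: lommel_S_gen_eq_rem_generic[symmetric] z\<close>)
    from Lim_transform_eventually[OF lim this]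
    show "(\<lambda>n. lommel_S_gen (fst (p n)) (snd (p n)) z) \<longlonglongrightarrow> lommel_psum N \<mu> \<nu> z + lommel_rem N \<mu> \<nu> z" .
  qed
qed

section \<open>Estimate of the remainder\<close>

text \<open>Since \<open>|z|^2 = z^2 e^(-2i\<theta>)\<close>. This links the two forms of
  \<open>lommel_v\<close>.\<close>

lemma polar_power:
  assumes "z \<noteq> 0"
  shows "z ^ (2 * k) * exp (-2 * \<i> * of_real (Arg z)) ^ k = of_real (cmod z ^ (2 * k))"
proof -
  have "z = of_real (cmod z) * exp (\<i> * of_real (Arg z))"
    using Arg_eq[OF assms] by (simp add: mult.commute)
  then have "z\<^sup>2 * exp (-2 * \<i> * of_real (Arg z)) = of_real (cmod z)^2 * (exp (\<i> * of_real (Arg z)) ^ 2 * exp (-2 * \<i> * of_real (Arg z)))"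
    by (metis mult.assoc power_mult_distrib)
  also have "exp (\<i> * of_real (Arg z)) ^ 2 * exp (-2 * \<i> * of_real (Arg z)) = 1"
    by (simp add: power2_eq_square flip: exp_add)
  finally have "z\<^sup>2 * exp (-2 * \<i> * of_real (Arg z)) = of_real (cmod z)^2" by simp
  then have "(z\<^sup>2 * exp (-2 * \<i> * of_real (Arg z))) ^ k = (of_real (cmod z)^2) ^ k" by simp
  then show ?thesis by (simp only: power_mult_distrib power_mult of_real_power)
qed

lemma lommel_v_alt:
  assumes "z \<noteq> 0"
  shows "lommel_v N m z \<mu> \<nu> =
            1 / (1 + exp (-2 * \<i> * of_real (Arg z)))^(m+1) *
            (\<Sum>k\<le>m. of_nat (m choose k) * (-1)^(N+k) * lommel_a (N+k) (-\<mu>) \<nu> / z^(2*N+2*k)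
                      * exp (-2 * \<i> * of_real (Arg z) * (of_nat m - of_nat k)))"
proof -
  define w where "w = -2 * \<i> * of_real (Arg z)"
  define D where "D = 1 / (1 + exp w) ^ (m + 1)"
  have "(\<Sum>k\<le>m. of_nat (m choose k) * (-1)^(N+k) * lommel_a (N+k) (-\<mu>) \<nu> / z^(2*N+2*k) * exp (w * (of_nat m - of_nat k)))
     = (\<Sum>k\<le>m. ((-1)^N / z^(2*N) * exp (w * of_nat m)) * (of_nat (m choose k) * (-1)^k * lommel_a (N+k) (-\<mu>) \<nu> / of_real (cmod z ^ (2*k))))"
  proof (intro sum.cong refl)
    fix k
    have e: "exp (w * (of_nat m - of_nat k)) = exp (w * of_nat m) / exp w ^ k"
      by (simp add: right_diff_distrib exp_diff exp_of_nat2_mult)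
    have c: "of_real (cmod z ^ (2*k)) = z ^ (2 * k) * exp w ^ k" using polar_power[OF assms, of k] by (simp only: w_def)
    show "of_nat (m choose k) * (-1)^(N+k) * lommel_a (N+k) (-\<mu>) \<nu> / z^(2*N+2*k) * exp (w * (of_nat m - of_nat k))
      = ((-1)^N / z^(2*N) * exp (w * of_nat m)) * (of_nat (m choose k) * (-1)^k * lommel_a (N+k) (-\<mu>) \<nu> / of_real (cmod z ^ (2*k)))"
      unfolding e c power_add using assms by (simp add: field_simps)
  qed
  also have "\<dots> = ((-1)^N / z^(2*N) * exp (w * of_nat m)) * (\<Sum>k\<le>m. of_nat (m choose k) * (-1)^k * lommel_a (N+k) (-\<mu>) \<nu> / of_real (cmod z ^ (2*k)))"
    by (rule sum_distrib_left[symmetric])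
  finally have "D * (\<Sum>k\<le>m. of_nat (m choose k) * (-1)^(N+k) * lommel_a (N+k) (-\<mu>) \<nu> / z^(2*N+2*k) * exp (w * (of_nat m - of_nat k)))
    = lommel_v N m z \<mu> \<nu>"
    unfolding lommel_v_def w_def[symmetric] by (simp add: D_def)
  then show ?thesis unfolding D_def w_def by (rule sym)
qed

text \<open>The Euler transform applied to the normalized integrals. In each of its terms
  \<open>rGamma a\<close> and \<open>rGamma b\<close> turn Gamma values into Pochhammer symbols,
  hence into \<open>lommel_a (N + k)\<close>; these terms are the ones subtracted in
  \<open>lommel_Rhat\<close>, so only the \<open>M\<close>-th difference is left.\<close>

lemma lommel_Rhat_eq:
  fixes \<mu> \<nu> z :: complex and N M :: nat
  defines "a \<equiv> (1 - \<mu> - \<nu>) / 2" and "b \<equiv> (1 - \<mu> + \<nu>) / 2"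
  defines "A \<equiv> a + of_nat N" and "B \<equiv> b + of_nat N"
  defines "q \<equiv> exp (-2 * \<i> * of_real (Arg z))" and "c \<equiv> cmod z / 2"
  assumes z: "z \<noteq> 0" "\<bar>Arg z\<bar> < pi / 2" and N: "Re A > 1 / 2" "Re B > 1 / 2"
  shows "lommel_Rhat N M z \<mu> \<nu> = z powr (\<mu> - 1) * rGamma a * rGamma b * (-1) ^ N * (2 / z) ^ (2 * N) *
     (q / (1 + q)) ^ M * (fdiff ^^ M) (\<lambda>k. mb_integral (A + of_nat k) (B + of_nat k) (Ln (z / 2)) / of_real c ^ (2 * k)) 0"
    (is "_ = ?P * _ * (fdiff ^^ M) ?Y 0")
proof -
  define l where "l = Ln (z / 2)"
  have Iml: "Im l = Arg z" using z Ln_half[OF z(1)] by (simp add: l_def Arg_eq_Im_Ln)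
  have c: "c > 0" using z by (simp add: c_def)
  define \<Phi> where "\<Phi> k = scaled_Gamma c A k * scaled_Gamma c B k" for k
  have nonp: "w \<notin> \<int>\<^sub>\<le>\<^sub>0" if "Re w > 0" for w :: complex using that by (auto elim!: nonpos_Ints_cases)
  have rec: "?Y k + q * ?Y (Suc k) = \<Phi> k" for k
  proof -
    \<comment> \<open>Here \<open>exp (- 2 * l) = (2 / z)^2\<close>; splitting off the modulus
      \<open>1 / c^2\<close> leaves the phase \<open>q\<close>, so dividing by \<open>c^(2k)\<close>
      makes the recurrence coefficient constant.\<close>
    have "exp (- 2 * l) = q / of_real c ^ 2"
    proof -
      have "exp (2 * of_nat 1 * l) = (z / 2) ^ 2" unfolding l_def exp_nat_mult_Ln[OF z(1)] by simp
      moreover have "exp (- 2 * l) = inverse (exp (2 * of_nat 1 * l))" by (simp add: exp_minus)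
      ultimately have "exp (- 2 * l) = inverse ((z / 2) ^ 2)" by (simp only:)
      then have e: "exp (- 2 * l) = (2 / z) ^ 2" by (simp add: power_divide)
      have "z ^ 2 * q = of_real (cmod z ^ 2)" using polar_power[OF z(1), of 1] by (simp add: q_def)
      then have "q = of_real (cmod z ^ 2) / z ^ 2" using z by (simp add: field_simps)
      then have "q / of_real c ^ 2 = 4 / z ^ 2" using z by (simp add: c_def power_divide)
      then show ?thesis unfolding e by (simp add: power_divide)
    qed
    moreover have "mb_integral (A + of_nat k) (B + of_nat k) l + exp (- 2 * l) * mb_integral (A + of_nat k + 1) (B + of_nat k + 1) l = Gamma (A + of_nat k) * Gamma (B + of_nat k)"
      using N z(2) by (intro mb_integral_rec) (auto simp: Iml)
    ultimately have "mb_integral (A + of_nat k) (B + of_nat k) l + q / of_real c ^ 2 * mb_integral (A + of_nat (Suc k)) (B + of_nat (Suc k)) l = Gamma (A + of_nat k) * Gamma (B + of_nat k)"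
      by (simp add: add_ac)
    then have "(mb_integral (A + of_nat k) (B + of_nat k) l + q / of_real c ^ 2 * mb_integral (A + of_nat (Suc k)) (B + of_nat (Suc k)) l) / of_real c ^ (2 * k) = Gamma (A + of_nat k) * Gamma (B + of_nat k) / of_real c ^ (2 * k)"
      by simp
    moreover have "of_real c ^ (2 * Suc k) = of_real c ^ 2 * (of_real c ^ (2 * k) :: complex)" by (simp add: power2_eq_square)
    ultimately show ?thesis
      by (simp only: l_def[symmetric]) (simp add: \<Phi>_def scaled_Gamma_def add_divide_distrib mult_2 power_add)
  qed
  have q: "1 + q \<noteq> 0"
  proof
    assume "1 + q = 0"
    then have "Re q = -1" by (simp add: add_eq_0_iff)
    then have "cos (2 * Arg z) = -1" by (simp add: q_def Re_exp)
    moreover have "cos (2 * Arg z) = 2 * cos (Arg z) ^ 2 - 1" by (rule cos_double_cos)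
    ultimately have "cos (Arg z) = 0" by simp
    moreover have "cos (Arg z) > 0" using z(2) by (intro cos_gt_zero_pi) linarith+
    ultimately show False by simp
  qed
  have v: "?P * (q ^ m / (1 + q) ^ (m + 1) * (fdiff ^^ m) \<Phi> 0) = z powr (\<mu> - 1) * lommel_v N m z \<mu> \<nu>" for m
  proof -
    have t: "rGamma a * rGamma b * (2 / z) ^ (2 * N) * \<Phi> k = lommel_a (N + k) (- \<mu>) \<nu> / of_real (cmod z ^ (2 * k)) / z ^ (2 * N)" for k
    proof -
      have p: "rGamma a * Gamma (A + of_nat k) = pochhammer a (N + k)" "rGamma b * Gamma (B + of_nat k) = pochhammer b (N + k)"
        using rGamma_mult_Gamma_add[of a "N + k"] rGamma_mult_Gamma_add[of b "N + k"] N nonp[of "A + of_nat k"] nonp[of "B + of_nat k"]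
        by (auto simp: A_def B_def add_ac)
      have "rGamma a * rGamma b * (2 / z) ^ (2 * N) * \<Phi> k = (rGamma a * Gamma (A + of_nat k)) * (rGamma b * Gamma (B + of_nat k)) * (2 / z) ^ (2 * N) / (of_real c ^ k * of_real c ^ k)"
        by (simp add: \<Phi>_def scaled_Gamma_def mult_ac)
      then have eq: "rGamma a * rGamma b * (2 / z) ^ (2 * N) * \<Phi> k = pochhammer a (N + k) * pochhammer b (N + k) * (2 / z) ^ (2 * N) / (of_real c ^ k * of_real c ^ k)"
        unfolding p .
      have cc: "of_real c ^ k * of_real c ^ k = (of_real (cmod z ^ (2 * k)) / 4 ^ k :: complex)"
        by (simp add: c_def power_mult power_divide power2_eq_square flip: power_mult_distrib)
      have zz: "(2 / z) ^ (2 * N) = 4 ^ N / z ^ (2 * N)" by (simp add: power_mult power_divide)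
      show ?thesis unfolding eq unfolding cc zz lommel_a_eq_pochhammer a_def[symmetric] b_def[symmetric]
        by (simp add: power_add mult_ac)
    qed
    have "rGamma a * rGamma b * (2 / z) ^ (2 * N) * (fdiff ^^ m) \<Phi> 0 = 
        (\<Sum>k\<le>m. of_nat (m choose k) * (-1) ^ k * (rGamma a * rGamma b * (2 / z) ^ (2 * N) * \<Phi> k))"
      by (simp add: funpow_fdiff_eq_sum sum_distrib_left mult_ac)
    also have "\<dots> = (\<Sum>k\<le>m. of_nat (m choose k) * (-1) ^ k * lommel_a (N + k) (- \<mu>) \<nu> / of_real (cmod z ^ (2 * k))) / z ^ (2 * N)"
      unfolding t by (simp add: sum_divide_distrib)
    finally have s: "rGamma a * rGamma b * (2 / z) ^ (2 * N) * (fdiff ^^ m) \<Phi> 0 = \<dots>" .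
    have qm: "q ^ m = exp (-2 * \<i> * of_real (Arg z) * of_nat m)"
      unfolding q_def by (rule exp_of_nat2_mult[symmetric])
    have "?P * (q ^ m / (1 + q) ^ (m + 1) * (fdiff ^^ m) \<Phi> 0) = z powr (\<mu> - 1) * ((-1) ^ N * (q ^ m / (1 + q) ^ (m + 1)) * (rGamma a * rGamma b * (2 / z) ^ (2 * N) * (fdiff ^^ m) \<Phi> 0))"
      by (simp only: mult_ac)
    also have "\<dots> = z powr (\<mu> - 1) * lommel_v N m z \<mu> \<nu>"
      unfolding s qm lommel_v_def q_def[symmetric] by simp
    finally show ?thesis .
  qed
  have "lommel_S \<mu> \<nu> z = lommel_psum N \<mu> \<nu> z + lommel_rem N \<mu> \<nu> z"
    using z N by (intro lommel_S_eq_rem) (auto simp: Iml[unfolded l_def] A_def B_def a_def b_def)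
  then have "lommel_R N z \<mu> \<nu> = ?P * ?Y 0"
    by (simp add: lommel_R_def lommel_psum_def lommel_rem_def a_def b_def A_def B_def)
  also have "?Y 0 = (\<Sum>m<M. q ^ m / (1 + q) ^ (m + 1) * (fdiff ^^ m) \<Phi> 0) + (q / (1 + q)) ^ M * (fdiff ^^ M) ?Y 0"
    by (rule euler_transform_remainder[where Y = ?Y and \<Phi> = \<Phi>, OF rec q])
  also have "?P * \<dots> = (\<Sum>m<M. ?P * (q ^ m / (1 + q) ^ (m + 1) * (fdiff ^^ m) \<Phi> 0)) + ?P * (q / (1 + q)) ^ M * (fdiff ^^ M) ?Y 0"
    unfolding distrib_left sum_distrib_left by (simp only: mult.assoc)
  also have "(\<Sum>m<M. ?P * (q ^ m / (1 + q) ^ (m + 1) * (fdiff ^^ m) \<Phi> 0)) = z powr (\<mu> - 1) * (\<Sum>m<M. lommel_v N m z \<mu> \<nu>)"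
    unfolding v sum_distrib_left ..
  finally show ?thesis unfolding lommel_Rhat_def by simp
qed

text \<open>The sine and exponential factors are common to all shifted integrands, so the difference
  acts under the integral on the product of scaled Gammas alone. On \<open>Re s = 1/2\<close> the
  exponential contributes \<open>exp (Re l) = c\<close>, and \<open>4 * pi\<close> over
  \<open>2 * pi\<close> gives the 2.\<close>

lemma norm_fdiff_mb_integral_le:
  assumes l: "\<bar>Im l\<bar> \<le> pi / 2 - \<delta>" "\<delta> > 0" and c: "c > 0" "exp (Re l) = c" and re: "Re A > 1 / 2" "Re B > 1 / 2"
    and C: "\<And>t. cmod ((fdiff ^^ M) (\<lambda>k. scaled_Gamma c (A - Complex (1/2) t) k * scaled_Gamma c (B - Complex (1/2) t) k) 0) \<le> C"
  shows "cmod ((fdiff ^^ M) (\<lambda>k. mb_integral (A + of_nat k) (B + of_nat k) l / of_real c ^ (2 * k)) 0) \<le> 2 * C * c * (LINT t|lborel. exp (- (2 * \<delta>) * \<bar>t\<bar>))"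
proof -
  have l': "\<bar>Im l\<bar> < pi / 2" using l by linarith
  let ?s = "\<lambda>t. Complex (1/2) t"
  define h where "h t = (\<Sum>i\<le>M. of_nat (M choose i) * (-1) ^ i / of_real c ^ (2 * i) * mb_integrand (A + of_nat i) (B + of_nat i) l (?s t))" for t
  have int: "integrable lborel (\<lambda>t. mb_integrand (A + of_nat i) (B + of_nat i) l (?s t))" for i
    using re l' by (intro integrable_mb_integrand) auto
  have inth: "integrable lborel h" unfolding h_def
    by (intro Bochner_Integration.integrable_sum integrable_mult_right int)
  have "(fdiff ^^ M) (\<lambda>k. mb_integral (A + of_nat k) (B + of_nat k) l / of_real c ^ (2 * k)) 0 
     = (\<Sum>i\<le>M. of_nat (M choose i) * (-1) ^ i / of_real c ^ (2 * i) * (LINT t|lborel. mb_integrand (A + of_nat i) (B + of_nat i) l (?s t))) / (2 * of_real pi)"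
    by (simp add: funpow_fdiff_eq_sum mb_integral_def sum_divide_distrib mult_ac)
  also have "(\<Sum>i\<le>M. of_nat (M choose i) * (-1) ^ i / of_real c ^ (2 * i) * (LINT t|lborel. mb_integrand (A + of_nat i) (B + of_nat i) l (?s t))) = (LINT t|lborel. h t)"
    unfolding h_def by (subst Bochner_Integration.integral_sum) (auto intro!: int)
  finally have eq: "(fdiff ^^ M) (\<lambda>k. mb_integral (A + of_nat k) (B + of_nat k) l / of_real c ^ (2 * k)) 0 = (LINT t|lborel. h t) / (2 * of_real pi)" .
  have bound: "cmod (h t) \<le> (4 * pi * C * c) * exp (- (2 * \<delta>) * \<bar>t\<bar>)" for t
  proof -
    define s where "s = ?s t"
    have s: "Re s = 1 / 2" "Im s = t" by (simp_all add: s_def)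
    have disj: "\<bar>Im s\<bar> \<ge> 1 \<or> Re s - 1 / 2 \<in> \<int>" unfolding s(1) by simp
    have "h t = of_real pi / sin (of_real pi * s) * exp (2 * s * l) * (\<Sum>i\<le>M. of_nat (M choose i) * (-1) ^ i * (scaled_Gamma c (A - s) i * scaled_Gamma c (B - s) i))"
      unfolding h_def mb_integrand_def s_def[symmetric] sum_distrib_left scaled_Gamma_def
    proof (intro sum.cong refl)
      fix i
      have "of_real c ^ (2 * i) = of_real c ^ i * (of_real c ^ i :: complex)" by (simp only: mult_2 power_add)
      then show "of_nat (M choose i) * (- 1) ^ i / of_real c ^ (2 * i) * (of_real pi / sin (of_real pi * s) * Gamma (A + of_nat i - s) * Gamma (B + of_nat i - s) * exp (2 * s * l))
        = of_real pi / sin (of_real pi * s) * exp (2 * s * l) * (of_nat (M choose i) * (- 1) ^ i * (Gamma (A - s + of_nat i) / of_real c ^ i * (Gamma (B - s + of_nat i) / of_real c ^ i)))"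
        by (simp only: diff_add_eq) (simp add: mult_ac)
    qed
    also have "\<dots> = of_real pi / sin (of_real pi * s) * exp (2 * s * l) * (fdiff ^^ M) (\<lambda>k. scaled_Gamma c (A - s) k * scaled_Gamma c (B - s) k) 0"
      by (simp add: funpow_fdiff_eq_sum)
    also have "cmod \<dots> \<le> (4 * pi * exp (- pi * \<bar>Im s\<bar>)) * (exp (2 * Re s * Re l) * exp (2 * \<bar>Im l\<bar> * \<bar>Im s\<bar>)) * C"
      unfolding norm_mult using C[of t]
      by (intro mult_mono norm_pi_div_sin_le[OF disj] norm_exp_mult_le) (auto simp: s_def)
    also have "\<dots> = (4 * pi * C * c) * (exp (- pi * \<bar>t\<bar>) * exp (2 * \<bar>Im l\<bar> * \<bar>t\<bar>))"
      using c(2) by (simp add: s mult_ac)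
    also have "exp (- pi * \<bar>t\<bar>) * exp (2 * \<bar>Im l\<bar> * \<bar>t\<bar>) = exp ((2 * \<bar>Im l\<bar> - pi) * \<bar>t\<bar>)"
      by (simp add: algebra_simps flip: exp_add)
    also have "(4 * pi * C * c) * \<dots> \<le> (4 * pi * C * c) * exp (- (2 * \<delta>) * \<bar>t\<bar>)"
    proof -
      have "0 \<le> C" using C[of 0] norm_ge_zero order.trans by blast
      moreover have d: "2 * \<bar>Im l\<bar> - pi \<le> - (2 * \<delta>)" using l by linarith
      moreover from d have "(2 * \<bar>Im l\<bar> - pi) * \<bar>t\<bar> \<le> - (2 * \<delta>) * \<bar>t\<bar>"
        by (rule mult_right_mono) simp
      ultimately show ?thesis using c(1) by (intro mult_left_mono mult_nonneg_nonneg) (simp_all only: exp_le_cancel_iff, auto)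
    qed
    finally show ?thesis .
  qed
  have "cmod (LINT t|lborel. h t) \<le> (LINT t|lborel. (4 * pi * C * c) * exp (- (2 * \<delta>) * \<bar>t\<bar>))"
    using l(2) by (intro Bochner_Integration.integral_norm_bound_integral inth integrable_mult_right integrable_exp_neg_abs bound) auto
  then have "cmod (LINT t|lborel. h t) \<le> 4 * pi * C * c * (LINT t|lborel. exp (- (2 * \<delta>) * \<bar>t\<bar>))" by simp
  then have "cmod (LINT t|lborel. h t) / (2 * pi) \<le> 4 * pi * C * c * (LINT t|lborel. exp (- (2 * \<delta>) * \<bar>t\<bar>)) / (2 * pi)"
    by (intro divide_right_mono) auto
  then show ?thesis unfolding eq by (simp add: norm_divide norm_mult)
qed

text \<open>With \<open>y = N / r\<close> close to 1/2 the powers collapse to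
  \<open>(2y)^(2N) * y powr (- e - 1) * exp (- 2N) / r\<close>. From
  \<open>2y \<le> exp (2y - 1)\<close> the first factor is at most \<open>exp (4\<rho>)\<close>; the
  last exponential is at most \<open>exp (2\<rho> - r)\<close>; and \<open>r \<ge> 4\<rho>\<close>
  places \<open>y\<close> in [1/4, 1], whence the power of 4.\<close>

lemma optimal_truncation_growth:
  fixes r \<rho> e :: real and N :: nat
  assumes N: "\<bar>real N - r / 2\<bar> \<le> \<rho>" and r: "r \<ge> 4 * \<rho>" "r > 0"
  shows "r powr e * (2 / r) ^ (2 * N) * real N powr (2 * real N - e - 1) * exp (- 2 * real N) 
     \<le> 4 powr \<bar>e + 1\<bar> * exp (6 * \<rho>) * exp (- r) / r"
proof -
  have bounds: "real N \<le> r / 2 + \<rho>" "real N \<ge> r / 2 - \<rho>" using N by (simp_all add: abs_le_iff)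
  have rho: "\<rho> \<ge> 0" using N by (rule order.trans[OF abs_ge_zero])
  define y where "y = real N / r"
  have y: "1 / 4 \<le> y" "y \<le> 1" using bounds r by (auto simp: y_def field_simps)
  have N0: "real N > 0" using y r by (simp add: y_def)
  have "r powr e * (2 / r) ^ (2 * N) * real N powr (2 * real N - e - 1) * exp (- 2 * real N) 
     = (2 * y) ^ (2 * N) * y powr (- e - 1) * exp (- 2 * real N) / r"
  proof -
    have f1: "(2 / r) ^ (2 * N) * real N powr (2 * real N) = (2 * y) ^ (2 * N)"
    proof -
      have "real N powr (2 * real N) = real N ^ (2 * N)" using powr_realpow[OF N0, of "2 * N"] by simp
      then show ?thesis by (simp add: y_def flip: power_mult_distrib)
    qed
    have f2: "r powr e * real N powr (- e - 1) = y powr (- e - 1) / r"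
    proof -
      have "y powr (- e - 1) = real N powr (- e - 1) / r powr (- e - 1)"
        using N0 r by (simp add: y_def powr_divide)
      moreover have "r powr e * r powr (- e - 1) = 1 / r"
        using r by (simp add: powr_minus_divide flip: powr_add)
      moreover have "r powr (- e - 1) \<noteq> 0" using r by simp
      ultimately have N_eq: "real N powr (- e - 1) = y powr (- e - 1) * r powr (- e - 1)"
        and re: "r powr e * r powr (- e - 1) = 1 / r" by simp_all
      have "r powr e * real N powr (- e - 1) = y powr (- e - 1) * (r powr e * r powr (- e - 1))"
        unfolding N_eq by (simp only: mult_ac)
      then show ?thesis unfolding re by simp
    qed
    have f3: "real N powr (2 * real N - e - 1) = real N powr (2 * real N) * real N powr (- e - 1)"
      by (simp add: diff_diff_eq flip: powr_add) (simp add: algebra_simps)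
    have "r powr e * (2 / r) ^ (2 * N) * real N powr (2 * real N - e - 1) * exp (- 2 * real N)
      = ((2 / r) ^ (2 * N) * real N powr (2 * real N)) * (r powr e * real N powr (- e - 1)) * exp (- 2 * real N)"
      unfolding f3 by (simp only: mult_ac)
    then show ?thesis unfolding f1 f2 by simp
  qed
  also have "\<dots> \<le> exp (4 * \<rho>) * 4 powr \<bar>e + 1\<bar> * exp (- r + 2 * \<rho>) / r"
  proof (intro divide_right_mono mult_mono)
    have "2 * y \<le> exp (2 * y - 1)" using exp_ge_add_one_self[of "2 * y - 1"] by simp
    then have "(2 * y) ^ (2 * N) \<le> exp (2 * y - 1) ^ (2 * N)" using y by (intro power_mono) auto
    also have "\<dots> = exp (2 * real N * (2 * y - 1))" using exp_of_nat_mult[of "2 * N" "2 * y - 1"] by simp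
    also have "2 * real N * (2 * y - 1) \<le> 4 * \<rho>"
    proof -
      have "2 * y - 1 = (2 * real N - r) / r" using r by (simp add: y_def diff_divide_distrib)
      also have "\<dots> \<le> 2 * \<rho> / r" using bounds r by (intro divide_right_mono) auto
      finally have "2 * y - 1 \<le> 2 * \<rho> / r" .
      then have "2 * real N * (2 * y - 1) \<le> 2 * real N * (2 * \<rho> / r)" by (intro mult_left_mono) auto
      also have "\<dots> = 4 * \<rho> * y" by (simp add: y_def)
      also have "\<dots> \<le> 4 * \<rho> * 1" using y rho by (intro mult_left_mono) auto
      finally show ?thesis by simp
    qed
    finally show "(2 * y) ^ (2 * N) \<le> exp (4 * \<rho>)" by simp
    have "- ln y \<le> ln 4"
    proof -
      have "ln (1 / 4) \<le> ln y" using y by (subst ln_le_cancel_iff) auto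
      then show ?thesis by (simp add: ln_div)
    qed
    moreover have "ln y \<le> 0" using y by simp
    ultimately have "(e + 1) * (- ln y) \<le> \<bar>e + 1\<bar> * ln 4"
      by (intro mult_mono) auto
    then show "y powr (- e - 1) \<le> 4 powr \<bar>e + 1\<bar>"
      using y by (simp add: powr_def algebra_simps)
    show "exp (- 2 * real N) \<le> exp (- r + 2 * \<rho>)" using bounds by simp
  qed (use r y in auto)
  also have "exp (4 * \<rho>) * 4 powr \<bar>e + 1\<bar> * exp (- r + 2 * \<rho>) = 4 powr \<bar>e + 1\<bar> * exp (6 * \<rho>) * exp (- r)"
    by (simp flip: exp_add)
  finally show ?thesis .
qed

text \<open>Bookkeeping of powers of \<open>r\<close>, with \<open>e = Re \<mu>\<close>:
  \<open>r powr (e - 1)\<close> from the prefactor and \<open>r\<close> from the integral meet the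
  Stirling power \<open>N powr (2N - e - 1)\<close>, which leaves \<open>exp (- r) / r\<close>. The
  \<open>M\<close> differences contribute \<open>r powr (- M / 2)\<close>.\<close>

lemma lommel_Rhat_bound:
  fixes \<mu> \<nu> :: complex and M :: nat
  assumes "0 < \<delta>" "\<delta> \<le> pi / 2"
  shows "\<exists>C R0. \<forall>z N. \<bar>Arg z\<bar> \<le> pi/2 - \<delta> \<and> cmod z \<ge> R0 \<and> N \<ge> 1 \<and>
              \<bar>real N - cmod z / 2\<bar> \<le> \<rho>0 \<longrightarrow>
              cmod (lommel_Rhat N M z \<mu> \<nu>) \<le> C * exp (- cmod z) / cmod z powr (real M / 2 + 1)"
proof -
  define a b where "a = (1 - \<mu> - \<nu>) / 2" and "b = (1 - \<mu> + \<nu>) / 2"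
  define \<rho> where "\<rho> = \<bar>\<rho>0\<bar>"
  \<comment> \<open>Bounds the distance of the shapes \<open>N + Re a - 1/2\<close> and
    \<open>N + Re b - 1/2\<close> from \<open>c = r / 2\<close>; the 1/2 is the abscissa of the
    line.\<close>
  define K where "K = \<rho> + \<bar>Re a\<bar> + \<bar>Re b\<bar> + 1 / 2"
  have K: "K \<ge> 0" by (simp add: K_def \<rho>_def)
  obtain C1 where C1: "C1 \<ge> 0" "\<And>c A B. c \<ge> 1 \<Longrightarrow> Re A > 0 \<Longrightarrow> \<bar>Re A - c\<bar> \<le> K \<Longrightarrow> Re B > 0 \<Longrightarrow> \<bar>Re B - c\<bar> \<le> K \<Longrightarrow>
     cmod ((fdiff ^^ M) (\<lambda>k. scaled_Gamma c A k * scaled_Gamma c B k) 0) \<le> C1 * (1 / sqrt c) ^ M * (Gamma (Re A) * Gamma (Re B))"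
    using fdiff_scaled_Gamma_mult_bound[OF K, of M] by blast
  obtain Ca Na where Ca: "Ca \<ge> 0" "\<And>n. n \<ge> Na \<Longrightarrow> 0 < real n + (Re a - 1 / 2) \<and> 
     Gamma (real n + (Re a - 1 / 2)) \<le> Ca * real n powr (real n + (Re a - 1 / 2) - 1 / 2) * exp (- real n)"
    using Gamma_nat_add_bound[of "Re a - 1 / 2"] by blast
  obtain Cb Nb where Cb: "Cb \<ge> 0" "\<And>n. n \<ge> Nb \<Longrightarrow> 0 < real n + (Re b - 1 / 2) \<and> 
     Gamma (real n + (Re b - 1 / 2)) \<le> Cb * real n powr (real n + (Re b - 1 / 2) - 1 / 2) * exp (- real n)"
    using Gamma_nat_add_bound[of "Re b - 1 / 2"] by blast
  define I where "I = (LINT t|lborel. exp (- (2 * \<delta>) * \<bar>t\<bar>))"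
  have I: "I \<ge> 0" unfolding I_def by (intro Bochner_Integration.integral_nonneg) auto
  define e where "e = Re \<mu>"
  define C where "C = exp (pi * \<bar>Im \<mu>\<bar>) * cmod (rGamma a) * cmod (rGamma b) * (1 / (2 * sin \<delta>)) ^ M * C1 * I * Ca * Cb * 2 powr (real M / 2) * (4 powr \<bar>e + 1\<bar> * exp (6 * \<rho>))"
  \<comment> \<open>Together with the \<open>2 * \<rho>\<close> added below, this ensures
    \<open>c \<ge> 1\<close>, \<open>r \<ge> 4 * \<rho>\<close>, and \<open>N\<close> beyond both
    Stirling thresholds.\<close>
  define R0 where "R0 = 4 * \<rho> + 2 + 2 * real (Na + Nb)"
  have sin\<delta>: "sin \<delta> > 0" using assms pi_gt_zero by (intro sin_gt_zero) linarith+
  show ?thesis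
  proof (rule exI[of _ C], rule exI[of _ "R0 + 2 * \<rho>"], intro allI impI)
    fix z :: complex and N :: nat
    assume asm: "\<bar>Arg z\<bar> \<le> pi/2 - \<delta> \<and> cmod z \<ge> R0 + 2 * \<rho> \<and> N \<ge> 1 \<and> \<bar>real N - cmod z / 2\<bar> \<le> \<rho>0"
    define r where "r = cmod z"
    define c where "c = r / 2"
    define l where "l = Ln (z / 2)"
    have rho: "\<rho> \<ge> 0" "\<bar>real N - r / 2\<bar> \<le> \<rho>" using asm by (auto simp: \<rho>_def r_def)
    have r: "r \<ge> 4 * \<rho>" "r \<ge> 2" "r / 2 - \<rho> \<ge> real Na" "r / 2 - \<rho> \<ge> real Nb"
      using asm rho(1) by (simp_all add: r_def R0_def)
    have z: "z \<noteq> 0" using r(2) by (auto simp: r_def)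
    have Arg: "\<bar>Arg z\<bar> < pi / 2" using asm assms by linarith
    have NN: "N \<ge> Na" "N \<ge> Nb" using r rho by linarith+
    define A B where "A = a + of_nat N" and "B = b + of_nat N"
    \<comment> \<open>Positivity of \<open>N + Re a - 1/2\<close> is part of the Stirling lemma at
      shift \<open>Re a - 1/2\<close>, and likewise for \<open>b\<close>.\<close>
    have re: "Re A > 1 / 2" "Re B > 1 / 2" using Ca(2)[OF NN(1)] Cb(2)[OF NN(2)] by (simp_all add: A_def B_def)
    have c: "c \<ge> 1" using r by (simp add: c_def)
    define q where "q = exp (-2 * \<i> * of_real (Arg z))"
    define Ga Gb where "Ga = Gamma (real N + (Re a - 1 / 2))" and "Gb = Gamma (real N + (Re b - 1 / 2))"
    define x where "x = (1 / sqrt c) ^ M"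
    have x0: "x \<ge> 0" using c by (simp add: x_def)
    have pos: "Ga > 0" "Gb > 0" unfolding Ga_def Gb_def using Ca(2)[OF NN(1)] Cb(2)[OF NN(2)] by (auto intro!: Gamma_real_pos)
    have b1: "cmod ((fdiff ^^ M) (\<lambda>k. mb_integral (A + of_nat k) (B + of_nat k) l / of_real c ^ (2 * k)) 0) \<le> 2 * (C1 * x * (Ga * Gb)) * c * I"
      unfolding I_def
    proof (rule norm_fdiff_mb_integral_le)
      show "\<bar>Im l\<bar> \<le> pi / 2 - \<delta>" using asm Ln_half[OF z] by (simp add: l_def Arg_eq_Im_Ln[OF z])
      show "exp (Re l) = c" using z by (simp add: l_def c_def r_def Re_Ln norm_divide)
      fix t
      have ReA: "Re (A - Complex (1 / 2) t) = real N + (Re a - 1 / 2)" and ReB: "Re (B - Complex (1 / 2) t) = real N + (Re b - 1 / 2)"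
        by (simp_all add: A_def B_def)
      have "\<bar>real N + (Re a - 1 / 2) - c\<bar> \<le> K" "\<bar>real N + (Re b - 1 / 2) - c\<bar> \<le> K"
        using rho unfolding K_def c_def by linarith+
      then show "cmod ((fdiff ^^ M) (\<lambda>k. scaled_Gamma c (A - Complex (1 / 2) t) k * scaled_Gamma c (B - Complex (1 / 2) t) k) 0) \<le> C1 * x * (Ga * Gb)"
        using C1(2)[OF c, of "A - Complex (1 / 2) t" "B - Complex (1 / 2) t"] Ca(2)[OF NN(1)] Cb(2)[OF NN(2)]
        unfolding ReA ReB x_def Ga_def Gb_def by blast
    qed (use assms c re in auto)
    \<comment> \<open>Factoring out \<open>e^(-i\<theta>)\<close> gives
      \<open>|1 + q| = 2 |cos \<theta>|\<close>, and in the sector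
      \<open>cos \<theta> \<ge> sin \<delta>\<close>.\<close>
    have b2: "cmod (q / (1 + q)) \<le> 1 / (2 * sin \<delta>)"
    proof -
      have "1 + q = exp (- \<i> * of_real (Arg z)) * (2 * cos (of_real (Arg z)))"
      proof -
        have "2 * cos (of_real (Arg z) :: complex) = exp (\<i> * of_real (Arg z)) + exp (- (\<i> * of_real (Arg z)))"
          by (simp add: cos_exp_eq)
        then show ?thesis unfolding q_def by (simp add: distrib_left mult.assoc flip: exp_add)
      qed
      then have "cmod (1 + q) = 2 * \<bar>cos (Arg z)\<bar>"
        by (simp add: norm_mult cos_of_real)
      moreover have "sin \<delta> \<le> cos (Arg z)"
      proof -
        have "cos (pi / 2 - \<delta>) \<le> cos \<bar>Arg z\<bar>" using asm assms pi_gt_zero by (intro cos_monotone_0_pi_le) linarith+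
        then show ?thesis by (simp add: cos_diff)
      qed
      ultimately have "cmod (1 + q) \<ge> 2 * sin \<delta>" by simp
      moreover have "cmod q = 1" by (simp add: q_def)
      ultimately show ?thesis using sin\<delta> unfolding norm_divide by (auto intro!: divide_left_mono mult_pos_pos)
    qed
    have b3: "cmod (z powr (\<mu> - 1)) \<le> r powr (e - 1) * exp (pi * \<bar>Im \<mu>\<bar>)"
    proof -
      have "cmod (z powr (\<mu> - 1)) = exp (Re ((\<mu> - 1) * Ln z))" using z by (simp add: powr_def)
      also have "Re ((\<mu> - 1) * Ln z) = (e - 1) * ln r - Im \<mu> * Arg z"
        using z by (simp add: e_def r_def Re_Ln Arg_eq_Im_Ln)
      also have "exp \<dots> \<le> exp ((e - 1) * ln r + pi * \<bar>Im \<mu>\<bar>)"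
      proof -
        have "- (Im \<mu> * Arg z) \<le> \<bar>Im \<mu>\<bar> * \<bar>Arg z\<bar>" by (metis abs_ge_minus_self abs_mult)
        also have "\<dots> \<le> \<bar>Im \<mu>\<bar> * pi" using Arg pi_gt_zero by (intro mult_left_mono) linarith+
        finally show ?thesis by (simp add: mult.commute)
      qed
      also have "\<dots> = r powr (e - 1) * exp (pi * \<bar>Im \<mu>\<bar>)" using r by (simp add: powr_def exp_add)
      finally show ?thesis .
    qed
    have GG: "Ga * Gb \<le> Ca * Cb * (real N powr (2 * real N - e - 1) * exp (- 2 * real N))"
    proof -
      have "Ga * Gb \<le> (Ca * real N powr (real N + (Re a - 1 / 2) - 1 / 2) * exp (- real N)) * (Cb * real N powr (real N + (Re b - 1 / 2) - 1 / 2) * exp (- real N))"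
        using Ca(2)[OF NN(1)] Cb(2)[OF NN(2)] pos Ca(1) unfolding Ga_def Gb_def
        by (intro mult_mono) auto
      also have "\<dots> = Ca * Cb * ((real N powr (real N + (Re a - 1 / 2) - 1 / 2) * real N powr (real N + (Re b - 1 / 2) - 1 / 2)) * (exp (- real N) * exp (- real N)))"
        by (simp only: mult_ac)
      also have "real N powr (real N + (Re a - 1 / 2) - 1 / 2) * real N powr (real N + (Re b - 1 / 2) - 1 / 2) = real N powr (2 * real N - e - 1)"
      proof -
        have "Re a + Re b = 1 - e" by (simp add: a_def b_def e_def field_simps)
        then have "real N + (Re a - 1 / 2) - 1 / 2 + (real N + (Re b - 1 / 2) - 1 / 2) = 2 * real N - e - 1" by linarith
        then show ?thesis by (metis powr_add)
      qed
      also have "exp (- real N) * exp (- real N) = exp (- 2 * real N)" by (simp flip: exp_add)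
      finally show ?thesis .
    qed
    have x: "x = 2 powr (real M / 2) * r powr (- (real M / 2))"
    proof -
      have "x = (c powr (- 1 / 2)) ^ M" using c by (simp add: x_def powr_half_sqrt powr_minus_divide)
      also have "\<dots> = c powr (- (real M / 2))" using c by (simp add: powr_powr flip: powr_realpow)
      also have "\<dots> = r powr (- (real M / 2)) / 2 powr (- (real M / 2))" using r by (simp add: c_def powr_divide)
      finally show ?thesis by (simp add: powr_minus_divide)
    qed
    define P where "P = exp (pi * \<bar>Im \<mu>\<bar>) * cmod (rGamma a) * cmod (rGamma b) * (1 / (2 * sin \<delta>)) ^ M * C1 * I"
    have P: "P \<ge> 0" using C1(1) I sin\<delta> by (auto simp: P_def)
    have "cmod (lommel_Rhat N M z \<mu> \<nu>) = cmod (z powr (\<mu> - 1)) * cmod (rGamma a) * cmod (rGamma b) * 1 * (2 / r) ^ (2 * N) * cmod (q / (1 + q)) ^ M *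
       cmod ((fdiff ^^ M) (\<lambda>k. mb_integral (A + of_nat k) (B + of_nat k) l / of_real c ^ (2 * k)) 0)"
      using lommel_Rhat_eq[OF z Arg, of \<mu> \<nu> N M] re unfolding A_def B_def a_def b_def
      by (simp add: norm_mult norm_power norm_divide r_def l_def c_def q_def)
    also have "\<dots> \<le> (r powr (e - 1) * exp (pi * \<bar>Im \<mu>\<bar>)) * cmod (rGamma a) * cmod (rGamma b) * 1 * (2 / r) ^ (2 * N) * (1 / (2 * sin \<delta>)) ^ M *
       (2 * (C1 * x * (Ga * Gb)) * c * I)"
      using r sin\<delta> by (intro mult_mono b1 b3 power_mono b2) auto
    also have "\<dots> = P * x * (r powr (e - 1) * r) * (2 / r) ^ (2 * N) * (Ga * Gb)"
      by (simp add: P_def c_def mult_ac)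
    also have "r powr (e - 1) * r = r powr e" using r powr_add[of r "e - 1" 1] by simp
    also have "P * x * r powr e * (2 / r) ^ (2 * N) * (Ga * Gb) \<le> P * x * r powr e * (2 / r) ^ (2 * N) * (Ca * Cb * (real N powr (2 * real N - e - 1) * exp (- 2 * real N)))"
      using P x0 r by (intro mult_left_mono GG mult_nonneg_nonneg) auto
    also have "\<dots> = P * x * Ca * Cb * (r powr e * (2 / r) ^ (2 * N) * real N powr (2 * real N - e - 1) * exp (- 2 * real N))"
      by (simp only: mult_ac)
    also have "\<dots> \<le> P * x * Ca * Cb * (4 powr \<bar>e + 1\<bar> * exp (6 * \<rho>) * exp (- r) / r)"
      using P x0 Ca(1) Cb(1) r rho by (intro mult_left_mono optimal_truncation_growth mult_nonneg_nonneg) auto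
    also have "\<dots> = C * exp (- r) * (r powr (- (real M / 2)) / r)"
      unfolding x by (simp add: C_def P_def mult_ac)
    also have "r powr (- (real M / 2)) / r = 1 / r powr (real M / 2 + 1)"
      using r by (simp add: powr_add powr_minus_divide)
    finally show "cmod (lommel_Rhat N M z \<mu> \<nu>) \<le> C * exp (- cmod z) / cmod z powr (real M / 2 + 1)"
      by (simp add: r_def)
  qed
qed

text \<open>The decomposition of \<open>lommel_R\<close> is the definition of
  \<open>lommel_Rhat\<close>, so what remains is the agreement of the two formulas for
  \<open>lommel_v\<close> and the order estimate. Boundedness of \<rho> is expressed by
  \<open>\<rho>0\<close>; the constants are chosen before \<open>z\<close> and
  \<open>N\<close>.\<close>

theorem theorem4:
  fixes M :: nat and \<mu> \<nu> :: complex and \<delta> \<rho>0 :: real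
  assumes "0 < \<delta>" and "\<delta> \<le> pi / 2"
  shows "(\<forall>N m z. z \<noteq> 0 \<longrightarrow> lommel_v N m z \<mu> \<nu> =
            1 / (1 + exp (-2 * \<i> * of_real (Arg z)))^(m+1) *
            (\<Sum>k\<le>m. of_nat (m choose k) * (-1)^(N+k) * lommel_a (N+k) (-\<mu>) \<nu> / z^(2*N+2*k)
                      * exp (-2 * \<i> * of_real (Arg z) * (of_nat m - of_nat k))))
       \<and> (\<exists>C R0. \<forall>z N. \<bar>Arg z\<bar> \<le> pi/2 - \<delta> \<and> cmod z \<ge> R0 \<and> N \<ge> 1 \<and>
              \<bar>real N - cmod z / 2\<bar> \<le> \<rho>0 \<longrightarrow>
              cmod (lommel_Rhat N M z \<mu> \<nu>) \<le> C * exp (- cmod z) / cmod z powr (real M / 2 + 1))"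
  using lommel_v_alt lommel_Rhat_bound[OF assms] by blast

end
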